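(* Let $\mathcal{A}\subset\mathbb{R}^2$ be a generic arrangement of $d$ real lines. (i) For an arbitrary small deformation $\mathcal{R}$ of $\mathcal{A}$, the number of real cusps of the evolute of $\mathcal{R}$ is at least $d(d-1)$ plus the number of bounded edges of $\mathcal{A}$ respected by $\mathcal{R}$. (ii) If $\mathcal{A}$ is given by the equation $\prod_{i=1}^d L_i=0$, where the $L_i$'s are linear equations describing the lines of $\mathcal{A}$, then for any sufficiently small real number $\epsilon\ne 0$, the deformation $\mathcal{R}$ given by $\prod_{i=1}^d L_i=\epsilon$ respects all the bounded edges of $\mathcal{A}$. In this case the total number of real cusps on its evolute is greater than or equal to $d(2d-3)$.
   Context: The evolute of a plane curve $\Gamma\subset\mathbb{R}^2$ is the locus of its centers of curvature (equivalently, the envelope of its normal lines). Real cusps of the evolute correspond to vertices of $\Gamma$, i.e. to critical points of the curvature of $\Gamma$. A line arrangement $\mathcal{A}\subset\mathbb{R}^2$ is generic if no two of its lines are parallel and no three of its lines pass through one point. Its vertices (crunodes) are the intersection points of pairs of its lines. An edge of $\mathcal{A}$ is a connected component of $\mathcal{A}$ minus the set of its vertices; it is bounded if both its endpoints are vertices. A small deformation (small resolution) $\mathcal{R}$ of $\mathcal{A}$ is a smooth real curve of degree $d$ resolving all the crunodes of $\mathcal{A}$, obtained as the zero locus of $G+\epsilon H$, where $G$ is a product of $d$ linear polynomials with zero locus $\mathcal{A}$, $H$ is a real polynomial of degree at most $d$ not vanishing at any vertex of $\mathcal{A}$, and $\epsilon\neq 0$ is a real number with $|\epsilon|$ sufficiently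 small (depending on $G$ and $H$). For a bounded edge $e$ of $\mathcal{A}$, let $\mathcal{R}_e$ be the restriction of $\mathcal{R}$ to a sufficiently small neighborhood $U_e\subset\mathbb{R}^2$ of $e$; it consists of three connected components. One says that $\mathcal{R}$ respects $e$ if each of the three connected components of $\mathcal{R}_e$ is close to the union of edges bounding a single connected domain of $U_e\setminus\mathcal{A}$; otherwise $\mathcal{R}$ twists $e$. *)

theory Defs
  imports
    "HOL-Analysis.Analysis"
    "HOL-Computational_Algebra.Polynomial"
    "HOL-Library.Extended_Nat"
begin

text \<open>
  A polynomial in \<open>\<real>[X, Y]\<close> is a \<open>real poly poly\<close>: the outer variable is \<open>Y\<close>, the
  coefficients are polynomials in \<open>X\<close>.
\<close>

definition eval2 :: "real poly poly \<Rightarrow> real^2 \<Rightarrow> real" where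
  "eval2 F p = poly (poly F [:p $ 2:]) (p $ 1)"

definition zero_locus :: "real poly poly \<Rightarrow> (real^2) set" where
  "zero_locus F = {p. eval2 F p = 0}"

definition total_degree_le :: "nat \<Rightarrow> real poly poly \<Rightarrow> bool" where
  "total_degree_le d F \<longleftrightarrow> (\<forall>i j. coeff (coeff F i) j \<noteq> 0 \<longrightarrow> i + j \<le> d)"

text \<open>The polynomials \<open>a X + b Y + c\<close> that define a line.\<close>

definition linear_poly :: "real poly poly \<Rightarrow> bool" where
  "linear_poly F \<longleftrightarrow> (\<exists>a b c. (a \<noteq> 0 \<or> b \<noteq> 0) \<and> F = [:[:c, a:], [:b:]:])"

lemma eval2_linear: "eval2 [:[:c, a:], [:b:]:] p = a * p $ 1 + b * p $ 2 + c"
  by (simp add: eval2_def algebra_simps)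


section \<open>Line arrangements\<close>

definition generic_arrangement :: "(real^2) set set \<Rightarrow> bool" where
  "generic_arrangement \<A> \<longleftrightarrow>
     finite \<A> \<and>
     (\<forall>l\<in>\<A>. affine l \<and> aff_dim l = 1) \<and>
     (\<forall>l\<in>\<A>. \<forall>m\<in>\<A>. l \<noteq> m \<longrightarrow> \<not> affine_parallel l m) \<and>
     (\<forall>l\<in>\<A>. \<forall>m\<in>\<A>. \<forall>n\<in>\<A>. l \<noteq> m \<longrightarrow> m \<noteq> n \<longrightarrow> l \<noteq> n \<longrightarrow> l \<inter> m \<inter> n = {})"

definition crunodes :: "(real^2) set set \<Rightarrow> (real^2) set" where
  "crunodes \<A> = {p. \<exists>l\<in>\<A>. \<exists>m\<in>\<A>. l \<noteq> m \<and> p \<in> l \<inter> m}"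

definition edges :: "(real^2) set set \<Rightarrow> (real^2) set set" where
  "edges \<A> = components (\<Union>\<A> - crunodes \<A>)"

definition bounded_edges :: "(real^2) set set \<Rightarrow> (real^2) set set" where
  "bounded_edges \<A> =
     {e \<in> edges \<A>. \<exists>v\<in>crunodes \<A>. \<exists>w\<in>crunodes \<A>. e = open_segment v w}"

text \<open>
  \<open>L 0, \<dots>, L (d - 1)\<close> are linear polynomials whose product has zero locus \<open>\<Union>\<A>\<close>. As \<open>\<A>\<close> will
  consist of \<open>d\<close> distinct lines, each of them is then the zero locus of exactly one \<open>L i\<close>.
\<close>

definition line_equations :: "(real^2) set set \<Rightarrow> nat \<Rightarrow> (nat \<Rightarrow> real poly poly) \<Rightarrow> bool" where
  "line_equations \<A> d L \<longleftrightarrow>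
     (\<forall>i<d. linear_poly (L i)) \<and> zero_locus (\<Prod>i<d. L i) = \<Union>\<A>"


section \<open>Respected edges\<close>

definition tube :: "real \<Rightarrow> (real^2) set \<Rightarrow> (real^2) set" where
  "tube \<eta> e = (\<Union>x\<in>e. ball x \<eta>)"

text \<open>Each of the two sets lies in the \<open>\<delta>\<close>-neighbourhood of the other (Hausdorff closeness).\<close>

definition hausdorff_close :: "real \<Rightarrow> (real^2) set \<Rightarrow> (real^2) set \<Rightarrow> bool" where
  "hausdorff_close \<delta> S T \<longleftrightarrow>
     (\<forall>x\<in>S. \<exists>y\<in>T. dist x y < \<delta>) \<and> (\<forall>y\<in>T. \<exists>x\<in>S. dist x y < \<delta>)"

text \<open>
  The curve \<open>R\<close> respects the edge \<open>e\<close>, at the scales \<open>\<eta>\<close> (size of the neighbourhood \<open>U\<^sub>e\<close> of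
  \<open>e\<close>) and \<open>\<delta>\<close> (meaning of ``close''). For a domain \<open>D\<close> of the complement of the arrangement in
  \<open>U\<^sub>e\<close>, the union of the edges bounding it is \<open>frontier D \<inter> U\<^sub>e\<close>. The notion is meant for
  \<open>\<eta>\<close> small, \<open>\<delta>\<close> small depending on \<open>\<eta>\<close>, and \<open>R\<close> a deformation that is small depending on both.
\<close>

definition respects_edge ::
  "real \<Rightarrow> real \<Rightarrow> (real^2) set set \<Rightarrow> (real^2) set \<Rightarrow> (real^2) set \<Rightarrow> bool" where
  "respects_edge \<eta> \<delta> \<A> R e \<longleftrightarrow>
     card (components (R \<inter> tube \<eta> e)) = 3 \<and>
     (\<forall>C \<in> components (R \<inter> tube \<eta> e). \<exists>D \<in> components (tube \<eta> e - \<Union>\<A>).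
        hausdorff_close \<delta> C (frontier D \<inter> tube \<eta> e))"


section \<open>The evolute and its cusps\<close>

definition vderiv :: "(real \<Rightarrow> 'a::real_normed_vector) \<Rightarrow> real \<Rightarrow> 'a" where
  "vderiv \<gamma> = (\<lambda>t. vector_derivative \<gamma> (at t))"

definition smooth_on :: "real set \<Rightarrow> (real \<Rightarrow> 'a::real_normed_vector) \<Rightarrow> bool" where
  "smooth_on I \<gamma> \<longleftrightarrow> (\<forall>n. \<forall>t\<in>I. (vderiv ^^ n) \<gamma> differentiable (at t))"

text \<open>A smooth regular parametrization of an open piece of \<open>\<Gamma>\<close>, passing through \<open>p\<close> at time \<open>0\<close>.\<close>

definition local_parametrization :: "(real^2) set \<Rightarrow> real^2 \<Rightarrow> (real \<Rightarrow> real^2) \<Rightarrow> bool" where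
  "local_parametrization \<Gamma> p \<gamma> \<longleftrightarrow>
     \<gamma> 0 = p \<and>
     (\<exists>r>0. \<exists>W g.
        openin (top_of_set \<Gamma>) W \<and>
        homeomorphism {-r<..<r} W \<gamma> g \<and>
        smooth_on {-r<..<r} \<gamma> \<and>
        (\<forall>t\<in>{-r<..<r}. vderiv \<gamma> t \<noteq> 0))"

definition rot90 :: "real^2 \<Rightarrow> real^2" where
  "rot90 v = vector [- (v $ 2), v $ 1]"

definition det2 :: "real^2 \<Rightarrow> real^2 \<Rightarrow> real" where
  "det2 u v = u $ 1 * v $ 2 - u $ 2 * v $ 1"

definition curvature :: "(real \<Rightarrow> real^2) \<Rightarrow> real \<Rightarrow> real" where
  "curvature \<gamma> t = det2 (vderiv \<gamma> t) (vderiv (vderiv \<gamma>) t) / norm (vderiv \<gamma> t) ^ 3"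

text \<open>
  The center of curvature: \<open>\<gamma> + (1/\<kappa>) n\<close>, where \<open>n\<close> is the unit normal \<open>rot90 \<gamma>' / |\<gamma>'|\<close>. It goes
  to infinity at an inflection point (\<open>\<kappa> = 0\<close>).
\<close>

definition curvature_center :: "(real \<Rightarrow> real^2) \<Rightarrow> real \<Rightarrow> real^2" where
  "curvature_center \<gamma> t =
     \<gamma> t + (1 / curvature \<gamma> t) *\<^sub>R ((1 / norm (vderiv \<gamma> t)) *\<^sub>R rot90 (vderiv \<gamma> t))"

text \<open>
  The evolute as a curve in the real projective plane: homogeneous coordinates of the center of
  curvature, multiplied by \<open>det2 \<gamma>' \<gamma>''\<close> so that they make sense at inflection points too (where
  they give the point at infinity of the normal line).
\<close>

definition evolute_lift :: "(real \<Rightarrow> real^2) \<Rightarrow> real \<Rightarrow> real^3" where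
  "evolute_lift \<gamma> t =
     (let k = det2 (vderiv \<gamma> t) (vderiv (vderiv \<gamma>) t);
          c = k *\<^sub>R \<gamma> t + (norm (vderiv \<gamma> t))\<^sup>2 *\<^sub>R rot90 (vderiv \<gamma> t)
      in vector [c $ 1, c $ 2, k])"

lemma evolute_lift_center:
  assumes "curvature \<gamma> t \<noteq> 0"
  shows "evolute_lift \<gamma> t =
    det2 (vderiv \<gamma> t) (vderiv (vderiv \<gamma>) t) *\<^sub>R
      vector [curvature_center \<gamma> t $ 1, curvature_center \<gamma> t $ 2, 1]"
  using assms
  by (auto simp: evolute_lift_def curvature_center_def curvature_def Let_def vec_eq_iff forall_3
      field_simps power3_eq_cube power2_eq_square)

text \<open>
  The evolute has a cusp at the parameter \<open>t\<close> if, as a curve in the projective plane, it is not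
  immersed there: the homogeneous lift and its derivative are linearly dependent.
\<close>

definition evolute_cusp_at :: "(real \<Rightarrow> real^2) \<Rightarrow> real \<Rightarrow> bool" where
  "evolute_cusp_at \<gamma> t \<longleftrightarrow> collinear {0, evolute_lift \<gamma> t, vderiv (evolute_lift \<gamma>) t}"

text \<open>The cusps of the evolute are exactly the critical points of the curvature.\<close>

lemma evolute_cusp_at_iff_curvature_critical:
  assumes d0: "\<gamma> differentiable (at t)" and d1: "vderiv \<gamma> differentiable (at t)"
    and d2: "vderiv (vderiv \<gamma>) differentiable (at t)" and reg: "vderiv \<gamma> t \<noteq> 0"
  shows "evolute_cusp_at \<gamma> t \<longleftrightarrow> (curvature \<gamma> has_real_derivative 0) (at t)"
proof -
  have comp: "((\<lambda>s. f s $ i) has_real_derivative vderiv f t $ i) (at t)"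
    if "f differentiable (at t)" for f :: "real \<Rightarrow> real^2" and i
  proof -
    have "(f has_vector_derivative vderiv f t) (at t)"
      using that by (simp add: vderiv_def vector_derivative_works)
    from bounded_linear.has_vector_derivative[OF bounded_linear_vec_nth this]
    show ?thesis by (simp add: has_real_derivative_iff_has_vector_derivative)
  qed
  define p q where "p = (\<lambda>s. \<gamma> s $ 1)" and "q = (\<lambda>s. \<gamma> s $ 2)"
  define p1 q1 where "p1 = (\<lambda>s. vderiv \<gamma> s $ 1)" and "q1 = (\<lambda>s. vderiv \<gamma> s $ 2)"
  define p2 q2 where "p2 = (\<lambda>s. vderiv (vderiv \<gamma>) s $ 1)" and "q2 = (\<lambda>s. vderiv (vderiv \<gamma>) s $ 2)"
  define p3 q3 where "p3 = vderiv (vderiv (vderiv \<gamma>)) t $ 1" and "q3 = vderiv (vderiv (vderiv \<gamma>)) t $ 2"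
  have D: "(p has_real_derivative p1 t) (at t)" "(q has_real_derivative q1 t) (at t)"
    "(p1 has_real_derivative p2 t) (at t)" "(q1 has_real_derivative q2 t) (at t)"
    "(p2 has_real_derivative p3) (at t)" "(q2 has_real_derivative q3) (at t)"
    unfolding p_def q_def p1_def q1_def p2_def q2_def p3_def q3_def
    by (rule comp d0 d1 d2)+
  define S where "S = (\<lambda>s. (p1 s)\<^sup>2 + (q1 s)\<^sup>2)"
  define K where "K = (\<lambda>s. p1 s * q2 s - q1 s * p2 s)"
  define S' where "S' = 2 * p1 t * p2 t + 2 * q1 t * q2 t"
  define K' where "K' = p1 t * q3 - q1 t * p3"
  have nrm: "norm (vderiv \<gamma> s) = sqrt (S s)" for s
    by (simp add: norm_vec_def L2_set_def UNIV_2 S_def p1_def q1_def)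
  have S0: "S t > 0"
    using reg nrm[of t] by (metis norm_le_zero_iff not_le real_sqrt_le_0_iff)
  have Sd: "(S has_real_derivative S') (at t)"
    unfolding S_def S'_def by (auto intro!: derivative_eq_intros D)
  have Kd: "(K has_real_derivative K') (at t)"
    unfolding K_def K'_def by (auto intro!: derivative_eq_intros D)
  have curv: "curvature \<gamma> = (\<lambda>s. K s / sqrt (S s) ^ 3)"
    by (auto simp: curvature_def det2_def nrm K_def p1_def q1_def p2_def q2_def)
  define c where "c = (K' * S t - 3/2 * K t * S') / (sqrt (S t) ^ 5)"
  have curvd: "(curvature \<gamma> has_real_derivative c) (at t)"
  proof -
    have sq: "sqrt (S t) * sqrt (S t) = S t" "sqrt (S t) > 0" using S0 by auto
    define r where "r = sqrt (S t)"
    have r: "S t = r * r" "r > 0" using sq r_def by auto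
    have sd: "((\<lambda>s. sqrt (S s)) has_real_derivative S' / (2 * r)) (at t)"
      using S0 by (auto intro!: derivative_eq_intros Sd simp: r_def field_simps)
    have "((\<lambda>s. K s / sqrt (S s) ^ 3) has_real_derivative
            (K' * r ^ 3 - K t * (3 * r ^ 2 * (S' / (2 * r)))) / (r ^ 3 * r ^ 3)) (at t)"
      by (rule derivative_eq_intros Kd sd refl | use r in \<open>simp add: r_def[symmetric]\<close>)+
    moreover have "(K' * r ^ 3 - K t * (3 * r ^ 2 * (S' / (2 * r)))) / (r ^ 3 * r ^ 3) = c"
      unfolding c_def r_def[symmetric] unfolding r(1)
      using r(2) by (simp add: field_simps power_numeral_reduce)
    ultimately show ?thesis unfolding curv by simp
  qed
  have crit: "(curvature \<gamma> has_real_derivative 0) (at t) \<longleftrightarrow> 2 * K' * S t = 3 * K t * S'"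
  proof -
    have "(curvature \<gamma> has_real_derivative 0) (at t) \<longleftrightarrow> c = 0"
      using curvd DERIV_unique by metis
    also have "\<dots> \<longleftrightarrow> 2 * K' * S t = 3 * K t * S'"
      using S0 by (auto simp: c_def)
    finally show ?thesis .
  qed
  define E1 E2 where "E1 = (\<lambda>s. K s * p s - S s * q1 s)" and "E2 = (\<lambda>s. K s * q s + S s * p1 s)"
  define E1' E2' where "E1' = K' * p t + K t * p1 t - (S' * q1 t + S t * q2 t)"
    and "E2' = K' * q t + K t * q1 t + (S' * p1 t + S t * p2 t)"
  have E: "evolute_lift \<gamma> = (\<lambda>s. vector [E1 s, E2 s, K s])"
  proof -
    have "0 \<le> S s" for s by (simp add: S_def)
    then show ?thesis
      by (auto simp: evolute_lift_def Let_def det2_def nrm rot90_def E1_def E2_def K_def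
          p_def q_def p1_def q1_def p2_def q2_def)
  qed
  have E1d: "(E1 has_real_derivative E1') (at t)"
    unfolding E1_def E1'_def by (auto intro!: derivative_eq_intros D Sd Kd)
  have E2d: "(E2 has_real_derivative E2') (at t)"
    unfolding E2_def E2'_def by (auto intro!: derivative_eq_intros D Sd Kd)
  have vec: "vector [x, y, z] = x *\<^sub>R axis 1 1 + y *\<^sub>R axis 2 1 + z *\<^sub>R (axis 3 1 :: real^3)" for x y z
    by (simp add: vec_eq_iff forall_3 axis_def)
  have Ed: "(evolute_lift \<gamma> has_vector_derivative vector [E1', E2', K']) (at t)"
  proof -
    have *: "((\<lambda>s. f s *\<^sub>R (v :: real^3)) has_vector_derivative f' *\<^sub>R v) (at t)"
      if "(f has_real_derivative f') (at t)" for f f' v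
      using has_vector_derivative_scaleR[OF that has_vector_derivative_const[of v]] by simp
    show ?thesis
      unfolding E vec by (intro has_vector_derivative_add * E1d E2d Kd)
  qed
  then have Ev: "vderiv (evolute_lift \<gamma>) t = vector [E1', E2', K']"
    unfolding vderiv_def by (rule vector_derivative_at)
  have cr: "evolute_cusp_at \<gamma> t \<longleftrightarrow>
     E2 t * K' - K t * E2' = 0 \<and> K t * E1' - E1 t * K' = 0 \<and> E1 t * E2' - E2 t * E1' = 0"
    unfolding evolute_cusp_at_def cross_eq_0[symmetric] Ev
    by (simp add: E cross3_def vec_eq_iff forall_3)
  define M where "M = 2 * K' * S t - 3 * K t * S'"
  have i1: "2 * (E2 t * K' - K t * E2') = p1 t * M"
    unfolding E2_def E2'_def M_def S'_def K_def S_def by algebra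
  have i2: "2 * (K t * E1' - E1 t * K') = q1 t * M"
    unfolding E1_def E1'_def M_def S'_def K_def S_def by algebra
  have i3: "2 * (E1 t * E2' - E2 t * E1') = - (p t * p1 t + q t * q1 t) * M"
    unfolding E1_def E1'_def E2_def E2'_def M_def S'_def K_def S_def by algebra
  have "p1 t \<noteq> 0 \<or> q1 t \<noteq> 0" using S0 by (auto simp: S_def)
  then have "evolute_cusp_at \<gamma> t \<longleftrightarrow> M = 0"
    unfolding cr using i1 i2 i3 by (metis mult_eq_0_iff mult_zero_right zero_neq_numeral)
  then show ?thesis unfolding crit M_def by simp
qed

text \<open>
  Cusps are recorded by the point of \<open>\<Gamma>\<close> that they come from, so that cusps on different branches of
  the evolute are counted separately even if they happen to coincide in the plane.
\<close>

definition evolute_cusps :: "(real^2) set \<Rightarrow> (real^2) set" where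
  "evolute_cusps \<Gamma> = {p \<in> \<Gamma>. \<exists>\<gamma>. local_parametrization \<Gamma> p \<gamma> \<and> evolute_cusp_at \<gamma> 0}"

definition num_evolute_cusps :: "(real^2) set \<Rightarrow> enat" where
  "num_evolute_cusps \<Gamma> =
     (if finite (evolute_cusps \<Gamma>) then enat (card (evolute_cusps \<Gamma>)) else \<infinity>)"

end

theory Submission imports Defs
begin

text \<open>
  The cusps of the evolute are the critical points of the curvature, so one has to find many critical
  points of the curvature on the curve \<open>G + \<epsilon> H = 0\<close>, where \<open>G\<close> is a product of equations of the lines.
  They are found as extrema. For this the curvature is written as a function \<open>level_curvature F\<close> of the
  point alone, and maximised over compact pieces of the curve; a maximum in the interior of such a piece
  is a cusp (\<open>extremal_cusp_in_region\<close>).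

  Near a crunode \<open>v\<close> the curve consists of two branches that look like those of a hyperbola. When \<open>\<epsilon>\<close>
  tends to \<open>0\<close>, the curvature tends to infinity on every ray from \<open>v\<close> that is transversal to the two lines
  (\<open>ray_curvature_blowup\<close>), whereas it stays bounded at a fixed distance from \<open>v\<close>. So, taken with the right sign,
  it has an interior maximum on each of the two branches. This gives two cusps for each of the \<open>d (d - 1) / 2\<close>
  crunodes (\<open>eventually_cusp_on_node_branch\<close>).

  The sign of the curvature near \<open>v\<close>, with respect to the orientation by the gradient, is that of \<open>\<epsilon> H(v)\<close>.
  Hence if \<open>H\<close> has the same sign at the two ends of a bounded edge, the curvature is large and of the same
  sign on both ends of the strip around the edge, but bounded in the middle, and an interior minimum
  gives one more cusp (\<open>eventually_cusp_along_edge\<close>). The extrema are distinct, which is checked in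
  \<open>eventually_many_cusps\<close>.

  It remains to see that \<open>H\<close> has the same sign at both ends of a respected edge, and that for constant \<open>H\<close>
  all edges are respected. For the former, suppose that the component of the curve near the middle of the
  edge is close to the frontier of the domain \<open>D\<close>. If the branch near \<open>v\<close> did not lie in \<open>D\<close>, then the line through
  \<open>v\<close> across \<open>D\<close> would not meet the curve; but it separates points of the component
  (\<open>eventually_branch_side\<close>). For the latter, \<open>\<bar>G\<bar>\<close> is a product of positive affine functions on each domain
  cut out by the lines, hence logarithmically concave; a radial projection shows that the level curve in the
  domain is connected (\<open>connected_level_in_cell\<close>), and compactness shows that it is close to the frontier. As there
  are \<open>d (d - 2)\<close> bounded edges, the total number of cusps is at least \<open>d (d - 1) + d (d - 2) = d (2 d - 3)\<close>.
\<close>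

section \<open>Polynomial functions on the plane\<close>

lemma real_polynomial_function_linear: "bounded_linear f \<Longrightarrow> real_polynomial_function f"
  and real_polynomial_function_const: "real_polynomial_function (\<lambda>x. c)"
  and real_polynomial_function_add:
    "real_polynomial_function f \<Longrightarrow> real_polynomial_function g \<Longrightarrow> real_polynomial_function (\<lambda>x. f x + g x)"
  and real_polynomial_function_mult:
    "real_polynomial_function f \<Longrightarrow> real_polynomial_function g \<Longrightarrow> real_polynomial_function (\<lambda>x. f x * g x)"
  by (simp_all add: real_polynomial_function.intros)

lemma real_polynomial_function_coord: "real_polynomial_function (\<lambda>p::real^2. p $ i)"
  by (rule real_polynomial_function_linear) (rule bounded_linear_vec_nth)

lemmas real_polynomial_function_intros =
  real_polynomial_function_const real_polynomial_function_coord
  real_polynomial_function_add real_polynomial_function_diff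
  real_polynomial_function_minus real_polynomial_function_mult real_polynomial_function_power

text \<open>
  Polynomials are treated as functions here: the class is closed under partial derivatives, and the
  derivatives of \<open>G + \<epsilon> H\<close> are visibly continuous in the point and \<open>\<epsilon>\<close> together.
\<close>

definition pdx :: "(real^2 \<Rightarrow> real) \<Rightarrow> real^2 \<Rightarrow> real" where
  "pdx f p = frechet_derivative f (at p) (axis 1 1)"

definition pdy :: "(real^2 \<Rightarrow> real) \<Rightarrow> real^2 \<Rightarrow> real" where
  "pdy f p = frechet_derivative f (at p) (axis 2 1)"

lemma partial_derivativesI:
  assumes "\<And>p. (f has_derivative (\<lambda>h. a p * h $ 1 + b p * h $ 2)) (at p)"
  shows "pdx f = a" "pdy f = b"
  by (simp_all add: pdx_def pdy_def fun_eq_iff frechet_derivative_at[OF assms, symmetric] axis_def)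

lemma real_polynomial_function_partials:
  fixes f :: "real^2 \<Rightarrow> real"
  assumes "real_polynomial_function f"
  shows "\<exists>a b. real_polynomial_function a \<and> real_polynomial_function b \<and>
    (\<forall>p. (f has_derivative (\<lambda>h. a p * h $ 1 + b p * h $ 2)) (at p))"
  using assms
proof induction
  case (linear f)
  have *: "f h = f (axis 1 1) * h $ 1 + f (axis 2 1) * h $ 2" for h
  proof -
    interpret bounded_linear f by fact
    have "h = h $ 1 *\<^sub>R axis 1 1 + h $ 2 *\<^sub>R axis 2 1"
      by (simp add: vec_eq_iff forall_2 axis_def)
    then have "f h = f (h $ 1 *\<^sub>R axis 1 1 + h $ 2 *\<^sub>R axis 2 1)" by simp
    then show ?thesis by (simp add: add scaleR)
  qed
  have "(f has_derivative (\<lambda>h. f (axis 1 1) * h $ 1 + f (axis 2 1) * h $ 2)) (at p)" for p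
    unfolding *[symmetric] by (simp add: bounded_linear_imp_has_derivative linear)
  then show ?case
    by (intro exI[of _ "\<lambda>_. f (axis 1 1)"] exI[of _ "\<lambda>_. f (axis 2 1)"] conjI allI
        real_polynomial_function_const)
next
  case (const c)
  then show ?case by (intro exI[of _ "\<lambda>_. 0"]) auto
next
  case (add f g)
  then obtain a b c d where
    "real_polynomial_function a" "real_polynomial_function b"
    "real_polynomial_function c" "real_polynomial_function d"
    and D: "\<And>p. (f has_derivative (\<lambda>h. a p * h $ 1 + b p * h $ 2)) (at p)"
      "\<And>p. (g has_derivative (\<lambda>h. c p * h $ 1 + d p * h $ 2)) (at p)"
    by blast
  then show ?case
    by (intro exI[of _ "\<lambda>p. a p + c p"] exI[of _ "\<lambda>p. b p + d p"])
      (auto intro!: derivative_eq_intros D simp: algebra_simps)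
next
  case (mult f g)
  then obtain a b c d where
    P: "real_polynomial_function a" "real_polynomial_function b"
    "real_polynomial_function c" "real_polynomial_function d"
    and D: "\<And>p. (f has_derivative (\<lambda>h. a p * h $ 1 + b p * h $ 2)) (at p)"
      "\<And>p. (g has_derivative (\<lambda>h. c p * h $ 1 + d p * h $ 2)) (at p)"
    by blast
  then show ?case using mult.hyps
    by (intro exI[of _ "\<lambda>p. a p * g p + f p * c p"] exI[of _ "\<lambda>p. b p * g p + f p * d p"])
      (auto intro!: derivative_eq_intros D simp: algebra_simps)
qed

lemma real_polynomial_function_pdx [intro]:
    "real_polynomial_function f \<Longrightarrow> real_polynomial_function (pdx f)"
  and real_polynomial_function_pdy [intro]:
    "real_polynomial_function f \<Longrightarrow> real_polynomial_function (pdy f)"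
  and real_polynomial_function_has_derivative:
    "real_polynomial_function f \<Longrightarrow> (f has_derivative (\<lambda>h. pdx f p * h $ 1 + pdy f p * h $ 2)) (at p)"
  using real_polynomial_function_partials[of f] partial_derivativesI[of f] by blast+

lemma real_polynomial_function_continuous_on:
  fixes f :: "real^2 \<Rightarrow> real"
  shows "real_polynomial_function f \<Longrightarrow> continuous_on S f"
  by (simp add: continuous_at_imp_continuous_on continuous_real_polymonial_function)

lemma pd_add:
  assumes "real_polynomial_function f" "real_polynomial_function g"
  shows "pdx (\<lambda>p. f p + g p) = (\<lambda>p. pdx f p + pdx g p)"
    and "pdy (\<lambda>p. f p + g p) = (\<lambda>p. pdy f p + pdy g p)"
proof -
  have "((\<lambda>p. f p + g p) has_derivative
      (\<lambda>h. (pdx f p + pdx g p) * h $ 1 + (pdy f p + pdy g p) * h $ 2)) (at p)" for p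
    by (rule has_derivative_eq_rhs[OF has_derivative_add[OF
          assms[THEN real_polynomial_function_has_derivative]]]) (simp add: algebra_simps)
  then show "pdx (\<lambda>p. f p + g p) = (\<lambda>p. pdx f p + pdx g p)"
    and "pdy (\<lambda>p. f p + g p) = (\<lambda>p. pdy f p + pdy g p)"
    by (rule partial_derivativesI)+
qed

lemma pd_mult:
  assumes "real_polynomial_function f" "real_polynomial_function g"
  shows "pdx (\<lambda>p. f p * g p) = (\<lambda>p. pdx f p * g p + f p * pdx g p)"
    and "pdy (\<lambda>p. f p * g p) = (\<lambda>p. pdy f p * g p + f p * pdy g p)"
proof -
  have "((\<lambda>p. f p * g p) has_derivative
      (\<lambda>h. (pdx f p * g p + f p * pdx g p) * h $ 1 + (pdy f p * g p + f p * pdy g p) * h $ 2)) (at p)" for p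
    by (rule has_derivative_eq_rhs[OF has_derivative_mult[OF
          assms[THEN real_polynomial_function_has_derivative]]]) (simp add: algebra_simps)
  then show "pdx (\<lambda>p. f p * g p) = (\<lambda>p. pdx f p * g p + f p * pdx g p)"
    and "pdy (\<lambda>p. f p * g p) = (\<lambda>p. pdy f p * g p + f p * pdy g p)"
    by (rule partial_derivativesI)+
qed

lemma pd_const: "pdx (\<lambda>p. c) = (\<lambda>p. 0)" "pdy (\<lambda>p. c) = (\<lambda>p. 0)"
  using partial_derivativesI[of "\<lambda>p. c" "\<lambda>p. 0" "\<lambda>p. 0"] by auto

lemma pd_add_cmult:
  assumes "real_polynomial_function f" "real_polynomial_function g"
  shows "pdx (\<lambda>p. f p + c * g p) = (\<lambda>p. pdx f p + c * pdx g p)"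
    and "pdy (\<lambda>p. f p + c * g p) = (\<lambda>p. pdy f p + c * pdy g p)"
  by (simp_all add: assms pd_add pd_mult pd_const real_polynomial_function_const real_polynomial_function_mult)

lemma has_real_derivative_along:
  fixes f :: "real^2 \<Rightarrow> real"
  assumes "real_polynomial_function f" "(\<gamma> has_vector_derivative v) (at t within T)"
  shows "((\<lambda>t. f (\<gamma> t)) has_real_derivative (pdx f (\<gamma> t) * v $ 1 + pdy f (\<gamma> t) * v $ 2)) (at t within T)"
  using diff_chain_within[OF assms(2)[unfolded has_vector_derivative_def]
      has_derivative_at_withinI[OF real_polynomial_function_has_derivative[OF assms(1), of "\<gamma> t"]]]
  unfolding o_def has_field_derivative_def
  by (rule has_derivative_eq_rhs) (auto simp: algebra_simps)

lemma inner_real2: "(u::real^2) \<bullet> v = u $ 1 * v $ 1 + u $ 2 * v $ 2"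
  by (simp add: inner_vec_def sum_2)

lemma real_polynomial_function_linear_offset: "real_polynomial_function (\<lambda>p::real^2. n \<bullet> (p - v))"
  unfolding inner_real2 vector_minus_component
  by (intro real_polynomial_function_intros)

lemma pd_linear_offset:
  "pdx (\<lambda>p::real^2. n \<bullet> (p - v)) = (\<lambda>p. n $ 1)" "pdy (\<lambda>p::real^2. n \<bullet> (p - v)) = (\<lambda>p. n $ 2)"
proof -
  have "((\<lambda>p::real^2. n \<bullet> (p - v)) has_derivative (\<lambda>h. n $ 1 * h $ 1 + n $ 2 * h $ 2)) (at p)" for p
    by (auto intro!: derivative_eq_intros bounded_linear_imp_has_derivative[OF bounded_linear_vec_nth] simp: inner_real2)
  then show "pdx (\<lambda>p::real^2. n \<bullet> (p - v)) = (\<lambda>p. n $ 1)" "pdy (\<lambda>p::real^2. n \<bullet> (p - v)) = (\<lambda>p. n $ 2)"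
    by (rule partial_derivativesI)+
qed

lemma eval2_real_polynomial_function: "real_polynomial_function (eval2 F)"
proof -
  have A: "real_polynomial_function (\<lambda>p::real^2. poly a (p $ 1))" for a
    by (induction a) (auto intro!: real_polynomial_function_intros)
  show ?thesis unfolding eval2_def
  proof (induction F)
    case (pCons a F)
    have "(\<lambda>p::real^2. poly (poly (pCons a F) [:p $ 2:]) (p $ 1)) =
        (\<lambda>p. poly a (p $ 1) + p $ 2 * poly (poly F [:p $ 2:]) (p $ 1))"
      by auto
    then show ?case using pCons A by (auto intro!: real_polynomial_function_intros)
  qed (auto intro: real_polynomial_function_intros)
qed

section \<open>Curvature of level curves\<close>

definition grad :: "(real^2 \<Rightarrow> real) \<Rightarrow> real^2 \<Rightarrow> real^2" where
  "grad F p = vector [pdx F p, pdy F p]"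

definition gradsq :: "(real^2 \<Rightarrow> real) \<Rightarrow> real^2 \<Rightarrow> real" where
  "gradsq F p = (pdx F p)\<^sup>2 + (pdy F p)\<^sup>2"

text \<open>
  The second derivative of \<open>F\<close> in the direction of the tangent vector \<open>J \<nabla>F = (-F\<^sub>y, F\<^sub>x)\<close>.
\<close>

definition hess_tangent :: "(real^2 \<Rightarrow> real) \<Rightarrow> real^2 \<Rightarrow> real" where
  "hess_tangent F p = pdx (pdx F) p * (pdy F p)\<^sup>2
     - (pdx (pdy F) p + pdy (pdx F) p) * pdx F p * pdy F p + pdy (pdy F) p * (pdx F p)\<^sup>2"

text \<open>
  The curvature of the level curve of \<open>F\<close> oriented by \<open>J \<nabla>F\<close>. No parametrization enters, so that this
  function can be maximised over any compact piece of the curve.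
\<close>

definition level_curvature :: "(real^2 \<Rightarrow> real) \<Rightarrow> real^2 \<Rightarrow> real" where
  "level_curvature F p = hess_tangent F p / sqrt (gradsq F p) ^ 3"

text \<open>
  The inverse function theorem applies to \<open>q \<mapsto> (J \<nabla>F(p) \<bullet> (q - p), F q)\<close>. Along the preimage \<open>\<gamma>\<close> of the first axis,
  \<open>\<nabla>F \<bullet> \<gamma>' = 0\<close> and \<open>J \<nabla>F(p) \<bullet> \<gamma>' = 1\<close>, whence \<open>\<gamma>' = J \<nabla>F / Q\<close> with \<open>Q = \<nabla>F(p) \<bullet> \<nabla>F\<close>.
\<close>

lemma level_curve_local_parametrization:
  assumes F: "real_polynomial_function F" and p: "F p = 0" "gradsq F p > 0"
  obtains \<gamma> r Q where "r > 0" "\<gamma> 0 = p" "\<And>t. \<bar>t\<bar> < r \<Longrightarrow> F (\<gamma> t) = 0"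
    "\<exists>W g. openin (top_of_set {q. F q = 0}) W \<and> homeomorphism {-r<..<r} W \<gamma> g"
    "real_polynomial_function Q" "\<And>t. \<bar>t\<bar> < r \<Longrightarrow> Q (\<gamma> t) > 0"
    "\<And>t. \<bar>t\<bar> < r \<Longrightarrow> gradsq F (\<gamma> t) > 0"
    "\<And>t. \<bar>t\<bar> < r \<Longrightarrow> (\<gamma> has_vector_derivative (1 / Q (\<gamma> t)) *\<^sub>R rot90 (grad F (\<gamma> t))) (at t)"
proof -
  define a b where "a = pdx F p" and "b = pdy F p"
  define Q where "Q = (\<lambda>q. a * pdx F q + b * pdy F q)"
  have Qpoly: "real_polynomial_function Q"
    unfolding Q_def using F by (intro real_polynomial_function_intros) auto
  define \<Psi> :: "real^2 \<Rightarrow> real^2" where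
    "\<Psi> = (\<lambda>q. vector [a * (q $ 2 - p $ 2) - b * (q $ 1 - p $ 1), F q])"
  define D :: "real^2 \<Rightarrow> real^2 \<Rightarrow> real^2" where
    "D = (\<lambda>q h. vector [a * h $ 2 - b * h $ 1, pdx F q * h $ 1 + pdy F q * h $ 2])"
  have vec: "vector [x, y] = x *\<^sub>R axis 1 1 + y *\<^sub>R (axis 2 1 :: real^2)" for x y
    by (simp add: vec_eq_iff forall_2 axis_def)
  have Dlin: "bounded_linear (D q)" for q
    unfolding D_def vec
    by (intro bounded_linear_add bounded_linear_scaleR_const bounded_linear_sub
        bounded_linear_const_mult bounded_linear_vec_nth)
  define f' where "f' = (\<lambda>q. Blinfun (D q))"
  have f'app: "blinfun_apply (f' q) = D q" for q
    by (simp add: f'_def bounded_linear_Blinfun_apply Dlin)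
  have der\<Psi>: "(\<Psi> has_derivative D q) (at q)" for q
    unfolding \<Psi>_def D_def vec
    by (auto intro!: derivative_eq_intros real_polynomial_function_has_derivative[OF F]
      bounded_linear_imp_has_derivative[OF bounded_linear_vec_nth])
  define U where "U = {q. Q q > 0}"
  have opU: "open U"
    unfolding U_def
    by (intro open_Collect_less continuous_intros real_polynomial_function_continuous_on Qpoly)
  have pU: "p \<in> U" using p(2) by (simp add: U_def Q_def a_def b_def gradsq_def power2_eq_square)
  have contf': "continuous_on U f'"
  proof (rule continuous_on_blinfun_componentwise)
    fix i :: "real^2"
    show "continuous_on U (\<lambda>q. blinfun_apply (f' q) i)"
      unfolding f'app D_def vec using F
      by (intro continuous_intros real_polynomial_function_continuous_on) auto
  qed
  define s where "s = a\<^sup>2 + b\<^sup>2"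
  have s0: "s > 0" using p(2) by (simp add: s_def a_def b_def gradsq_def)
  define E :: "real^2 \<Rightarrow> real^2" where
    "E = (\<lambda>h. vector [(a * h $ 2 - b * h $ 1) / s, (b * h $ 2 + a * h $ 1) / s])"
  have Elin: "bounded_linear E"
    unfolding E_def vec
    by (intro bounded_linear_add bounded_linear_scaleR_const bounded_linear_sub
        bounded_linear_divide[THEN bounded_linear_compose]
        bounded_linear_const_mult bounded_linear_vec_nth)
  have ED: "E (D p h) = h" for h
  proof -
    have 1: "a * (a * h $ 1 + b * h $ 2) - b * (a * h $ 2 - b * h $ 1) = s * h $ 1"
      "b * (a * h $ 1 + b * h $ 2) + a * (a * h $ 2 - b * h $ 1) = s * h $ 2"
      by (simp_all add: s_def algebra_simps power2_eq_square)
    show ?thesis using s0 1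
      by (simp add: E_def D_def a_def[symmetric] b_def[symmetric] vec_eq_iff forall_2)
  qed
  have inv: "Blinfun E o\<^sub>L f' p = id_blinfun"
    by (rule blinfun_eqI) (simp add: f'app bounded_linear_Blinfun_apply[OF Elin] ED)
  obtain U' V g g' where U': "open U'" "U' \<subseteq> U" "p \<in> U'" and V: "open V" "\<Psi> p \<in> V"
    and hom: "homeomorphism U' V \<Psi> g"
    and g: "\<And>y. y \<in> V \<Longrightarrow> (g has_derivative (g' y)) (at y)"
    using inverse_function_theorem[OF opU _ contf' pU inv, of \<Psi>] der\<Psi> unfolding f'app by metis
  define \<iota> :: "real \<Rightarrow> real^2" where "\<iota> = (\<lambda>t. vector [t, 0])"
  have \<iota>: "\<iota> = (\<lambda>t. t *\<^sub>R axis 1 1)" by (auto simp: \<iota>_def vec)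
  have \<Psi>p: "\<Psi> p = \<iota> 0" by (simp add: \<Psi>_def \<iota>_def p)
  have "open (\<iota> -` V)" unfolding \<iota>
    by (rule open_vimage[OF V(1)]) (intro continuous_intros)
  moreover have "0 \<in> \<iota> -` V" using V(2) \<Psi>p by simp
  ultimately obtain r where r: "r > 0" "ball 0 r \<subseteq> \<iota> -` V" using open_contains_ball by blast
  have rV: "\<iota> t \<in> V" if "\<bar>t\<bar> < r" for t using r(2) that by (auto simp: dist_norm)
  define \<gamma> where "\<gamma> = (\<lambda>t. g (\<iota> t))"
  have \<gamma>U: "\<gamma> t \<in> U'" "\<Psi> (\<gamma> t) = \<iota> t" if "\<bar>t\<bar> < r" for t
    using hom rV[OF that] by (auto simp: homeomorphism_def \<gamma>_def)
  have F0: "F (\<gamma> t) = 0" if "\<bar>t\<bar> < r" for t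
    using \<gamma>U(2)[OF that] by (simp add: \<Psi>_def \<iota>_def vec_eq_iff forall_2)
  have Qpos: "Q (\<gamma> t) > 0" if "\<bar>t\<bar> < r" for t
    using \<gamma>U(1)[OF that] U'(2) by (auto simp: U_def)
  have grad: "gradsq F (\<gamma> t) > 0" if "\<bar>t\<bar> < r" for t
    using Qpos[OF that] by (auto simp: Q_def gradsq_def sum_power2_gt_zero_iff)
  have \<gamma>0: "\<gamma> 0 = p"
    using hom U'(3) by (simp add: \<gamma>_def \<Psi>p[symmetric] homeomorphism_def)
  have der: "(\<gamma> has_vector_derivative (1 / Q (\<gamma> t)) *\<^sub>R rot90 (grad F (\<gamma> t))) (at t)" if t: "\<bar>t\<bar> < r" for t
  proof -
    have "(\<iota> has_vector_derivative axis 1 1) (at t)"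
      unfolding \<iota> by (auto intro!: derivative_eq_intros)
    from vector_derivative_diff_chain_within[OF this has_derivative_at_withinI[OF g[OF rV[OF t]]]]
    have 1: "(\<gamma> has_vector_derivative g' (\<iota> t) (axis 1 1)) (at t)"
      by (simp add: \<gamma>_def o_def)
    define v where "v = g' (\<iota> t) (axis 1 1)"
    have v: "(\<gamma> has_vector_derivative v) (at t)" using 1 by (simp add: v_def)
    have ev: "\<forall>\<^sub>F x in nhds t. \<bar>x\<bar> < r"
      using t by (intro order_tendstoD[where y = "\<bar>t\<bar>"] tendsto_intros filterlim_ident)
    have "((\<lambda>t. \<Psi> (\<gamma> t)) has_vector_derivative D (\<gamma> t) v) (at t)"
      using vector_derivative_diff_chain_within[OF v has_derivative_at_withinI[OF der\<Psi>]]
      by (simp add: o_def)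
    moreover have "((\<lambda>t. \<Psi> (\<gamma> t)) has_vector_derivative axis 1 1) (at t)"
    proof (rule has_vector_derivative_transform_within[of \<iota> _ _ _ "r - \<bar>t\<bar>"])
      show "(\<iota> has_vector_derivative axis 1 1) (at t)" by fact
      show "\<iota> x = \<Psi> (\<gamma> x)" if "dist x t < r - \<bar>t\<bar>" for x
        using \<gamma>U(2)[of x] that by (auto simp: dist_norm)
    qed (use t in auto)
    ultimately have Dv: "D (\<gamma> t) v = axis 1 1" using vector_derivative_unique_at by blast
    let ?x = "pdx F (\<gamma> t)" and ?y = "pdy F (\<gamma> t)"
    have e: "a * v $ 2 - b * v $ 1 = 1" "?x * v $ 1 + ?y * v $ 2 = 0"
      using Dv by (auto simp: D_def vec_eq_iff forall_2 axis_def)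
    have q: "Q (\<gamma> t) = a * ?x + b * ?y" by (simp add: Q_def)
    have "Q (\<gamma> t) * v $ 1 = - ?y" "Q (\<gamma> t) * v $ 2 = ?x"
      using e unfolding q by algebra+
    then have "v = (1 / Q (\<gamma> t)) *\<^sub>R rot90 (grad F (\<gamma> t))"
      using Qpos[OF t] by (simp add: vec_eq_iff forall_2 rot90_def grad_def field_simps)
    with v show ?thesis by simp
  qed
  define W where "W = {q \<in> U'. \<bar>a * (q $ 2 - p $ 2) - b * (q $ 1 - p $ 1)\<bar> < r \<and> F q = 0}"
  define k where "k = (\<lambda>q::real^2. a * (q $ 2 - p $ 2) - b * (q $ 1 - p $ 1))"
  have "openin (top_of_set {q. F q = 0}) W"
  proof -
    have "W = {q. F q = 0} \<inter> (U' \<inter> {q. \<bar>k q\<bar> < r})" by (auto simp: W_def k_def)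
    moreover have "open (U' \<inter> {q. \<bar>k q\<bar> < r})" unfolding k_def
      by (intro open_Int U' open_Collect_less continuous_intros)
    ultimately show ?thesis by blast
  qed
  moreover have "homeomorphism {-r<..<r} W \<gamma> k"
  proof (rule homeomorphismI)
    show "continuous_on {-r<..<r} \<gamma>"
      by (intro continuous_at_imp_continuous_on ballI has_vector_derivative_continuous[OF der]) auto
    show "continuous_on W k" unfolding k_def by (intro continuous_intros)
    have kg: "k (\<gamma> t) = t" if "\<bar>t\<bar> < r" for t
      using \<gamma>U(2)[OF that] by (simp add: k_def \<Psi>_def \<iota>_def vec_eq_iff forall_2)
    show "k (\<gamma> t) = t" if "t \<in> {-r<..<r}" for t using kg that by auto
    have "\<gamma> t \<in> W" if "\<bar>t\<bar> < r" for t
      using kg[OF that] \<gamma>U(1)[OF that] F0[OF that] that by (simp add: W_def k_def)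
    then show "\<gamma> ` {-r<..<r} \<subseteq> W" by auto
    show "k ` W \<subseteq> {-r<..<r}" by (auto simp: W_def k_def)
    show "\<gamma> (k q) = q" if "q \<in> W" for q
    proof -
      have "\<Psi> q = \<iota> (k q)" using that by (simp add: \<Psi>_def \<iota>_def W_def k_def)
      moreover have "g (\<Psi> q) = q" using hom that by (auto simp: homeomorphism_def W_def)
      ultimately show ?thesis by (simp add: \<gamma>_def)
    qed
  qed
  ultimately show thesis using that[OF r(1) \<gamma>0 F0 _ Qpoly Qpos grad der] by blast
qed

lemma has_vector_derivative_vector2:
  assumes "(f has_real_derivative a) (at t)" "(g has_real_derivative b) (at t)"
  shows "((\<lambda>t. vector [f t, g t] :: real^2) has_vector_derivative vector [a, b]) (at t)"
proof -
  have vec: "vector [x, y] = x *\<^sub>R axis 1 1 + y *\<^sub>R (axis 2 1 :: real^2)" for x y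
    by (simp add: vec_eq_iff forall_2 axis_def)
  have "((\<lambda>t. f t *\<^sub>R axis 1 1 + g t *\<^sub>R (axis 2 1 :: real^2)) has_vector_derivative
      (f t *\<^sub>R 0 + a *\<^sub>R axis 1 1) + (g t *\<^sub>R 0 + b *\<^sub>R axis 2 1)) (at t)"
    by (intro has_vector_derivative_add has_vector_derivative_scaleR assms has_vector_derivative_const)
  then show ?thesis by (simp add: vec)
qed

text \<open>
  Along a level curve travelled with velocity \<open>J \<nabla>F / Q\<close>, differentiation maps a quotient of a
  polynomial by a power of \<open>Q\<close> to a quotient of the same kind. Hence all higher derivatives exist.
\<close>

lemma iterated_vderiv_level_curve:
  assumes F: "real_polynomial_function F" and Q: "real_polynomial_function Q"
    and Qpos: "\<And>t. \<bar>t\<bar> < r \<Longrightarrow> Q (\<gamma> t) > 0"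
    and der: "\<And>t. \<bar>t\<bar> < r \<Longrightarrow>
      (\<gamma> has_vector_derivative (1 / Q (\<gamma> t)) *\<^sub>R rot90 (grad F (\<gamma> t))) (at t)"
  shows "\<exists>a b k. real_polynomial_function a \<and> real_polynomial_function b \<and>
    (\<forall>t. \<bar>t\<bar> < r \<longrightarrow> (vderiv ^^ n) \<gamma> t = vector [a (\<gamma> t) / Q (\<gamma> t) ^ k, b (\<gamma> t) / Q (\<gamma> t) ^ k] \<and>
       (vderiv ^^ n) \<gamma> differentiable (at t))"
proof -
  define \<delta> where "\<delta> = (\<lambda>a p. pdy a p * pdx F p - pdx a p * pdy F p)"
  have \<delta>: "real_polynomial_function (\<delta> a)" if "real_polynomial_function a" for a
    unfolding \<delta>_def using F that by (intro real_polynomial_function_intros) auto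
  have along: "((\<lambda>t. a (\<gamma> t)) has_real_derivative \<delta> a (\<gamma> t) / Q (\<gamma> t)) (at t)"
    if "real_polynomial_function a" "\<bar>t\<bar> < r" for a t
    using has_real_derivative_along[OF that(1) der[OF that(2)]]
    by (rule DERIV_cong) (simp add: \<delta>_def rot90_def grad_def diff_divide_distrib)
  define \<Delta> where "\<Delta> = (\<lambda>k a p. \<delta> a p * Q p - real k * a p * \<delta> Q p)"
  have \<Delta>: "real_polynomial_function (\<Delta> k a)" if "real_polynomial_function a" for a k
    unfolding \<Delta>_def using that Q by (intro real_polynomial_function_intros \<delta>) auto
  have quot: "((\<lambda>t. a (\<gamma> t) / Q (\<gamma> t) ^ k) has_real_derivative \<Delta> k a (\<gamma> t) / Q (\<gamma> t) ^ (k + 2)) (at t)"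
    if a: "real_polynomial_function a" and t: "\<bar>t\<bar> < r" for a k t
  proof -
    have "((\<lambda>t. a (\<gamma> t) / Q (\<gamma> t) ^ k) has_real_derivative
       (\<delta> a (\<gamma> t) / Q (\<gamma> t) * Q (\<gamma> t) ^ k - a (\<gamma> t) * (real k * (\<delta> Q (\<gamma> t) / Q (\<gamma> t) * Q (\<gamma> t) ^ (k - Suc 0))))
        / (Q (\<gamma> t) ^ k * Q (\<gamma> t) ^ k)) (at t)"
      using Qpos[OF t] by (intro DERIV_divide DERIV_power along a t Q) auto
    moreover have "(\<delta> a (\<gamma> t) / Q (\<gamma> t) * Q (\<gamma> t) ^ k - a (\<gamma> t) * (real k * (\<delta> Q (\<gamma> t) / Q (\<gamma> t) * Q (\<gamma> t) ^ (k - Suc 0))))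
        / (Q (\<gamma> t) ^ k * Q (\<gamma> t) ^ k) = \<Delta> k a (\<gamma> t) / Q (\<gamma> t) ^ (k + 2)"
    proof -
      have "(x / q * q ^ k - y * (real k * (z / q * q ^ (k - Suc 0)))) / (q ^ k * q ^ k)
        = (x * q - real k * y * z) / q ^ (k + 2)" if "q > 0" for x y z q :: real
        using that by (cases k) (simp_all add: field_simps)
      then show ?thesis using Qpos[OF t] by (simp add: \<Delta>_def)
    qed
    ultimately show ?thesis by simp
  qed
  have dif: "h differentiable (at t)" "vderiv h t = vector [\<Delta> k a (\<gamma> t) / Q (\<gamma> t) ^ (k + 2), \<Delta> k b (\<gamma> t) / Q (\<gamma> t) ^ (k + 2)]"
    if "real_polynomial_function a" "real_polynomial_function b" "\<bar>t\<bar> < r"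
      and h: "\<And>t. \<bar>t\<bar> < r \<Longrightarrow> h t = vector [a (\<gamma> t) / Q (\<gamma> t) ^ k, b (\<gamma> t) / Q (\<gamma> t) ^ k]" for a b k t and h :: "real \<Rightarrow> real^2"
  proof -
    have "(h has_vector_derivative vector [\<Delta> k a (\<gamma> t) / Q (\<gamma> t) ^ (k + 2), \<Delta> k b (\<gamma> t) / Q (\<gamma> t) ^ (k + 2)]) (at t)"
    proof (rule has_vector_derivative_transform_within[OF has_vector_derivative_vector2[OF quot quot]])
      show "vector [a (\<gamma> t') / Q (\<gamma> t') ^ k, b (\<gamma> t') / Q (\<gamma> t') ^ k] = h t'" if "dist t' t < r - \<bar>t\<bar>" for t'
        using h[of t'] that by (auto simp: dist_norm)
    qed (use that in auto)
    then show "h differentiable (at t)" "vderiv h t = vector [\<Delta> k a (\<gamma> t) / Q (\<gamma> t) ^ (k + 2), \<Delta> k b (\<gamma> t) / Q (\<gamma> t) ^ (k + 2)]"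
      unfolding vderiv_def by (auto simp: vector_derivative_at intro: differentiableI_vector)
  qed
  have "\<exists>a b k. real_polynomial_function a \<and> real_polynomial_function b \<and>
    (\<forall>t. \<bar>t\<bar> < r \<longrightarrow> (vderiv ^^ n) \<gamma> t = vector [a (\<gamma> t) / Q (\<gamma> t) ^ k, b (\<gamma> t) / Q (\<gamma> t) ^ k])"
  proof (induction n)
    case 0
    show ?case
      by (intro exI[of _ "\<lambda>p. p $ 1"] exI[of _ "\<lambda>p. p $ 2"] exI[of _ 0] conjI real_polynomial_function_intros)
        (simp add: vec_eq_iff forall_2)
  next
    case (Suc n)
    then obtain a b k where ab: "real_polynomial_function a" "real_polynomial_function b"
      "\<And>t. \<bar>t\<bar> < r \<Longrightarrow> (vderiv ^^ n) \<gamma> t = vector [a (\<gamma> t) / Q (\<gamma> t) ^ k, b (\<gamma> t) / Q (\<gamma> t) ^ k]"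
      by blast
    show ?case
      using dif(2)[OF ab(1,2) _ ab(3)] \<Delta>[OF ab(1)] \<Delta>[OF ab(2)]
      by (intro exI[of _ "\<Delta> k a"] exI[of _ "\<Delta> k b"] exI[of _ "k + 2"]) simp
  qed
  then show ?thesis using dif(1) by metis
qed

text \<open>
  With \<open>\<gamma>' = \<mu> J \<nabla>F\<close> and \<open>\<mu> > 0\<close>, the derivative of \<open>\<mu>\<close> contributes to \<open>\<gamma>''\<close> a multiple of \<open>\<gamma>'\<close>, which the determinant
  does not see; what is left is \<open>\<mu>\<^sup>3\<close> times the Hessian on the tangent vector.
\<close>

lemma curvature_level_curve:
  assumes F: "real_polynomial_function F" and Q: "real_polynomial_function Q"
    and Qpos: "\<And>t. \<bar>t\<bar> < r \<Longrightarrow> Q (\<gamma> t) > 0"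
    and der: "\<And>t. \<bar>t\<bar> < r \<Longrightarrow>
      (\<gamma> has_vector_derivative (1 / Q (\<gamma> t)) *\<^sub>R rot90 (grad F (\<gamma> t))) (at t)"
    and t: "\<bar>t\<bar> < r"
  shows "curvature \<gamma> t = level_curvature F (\<gamma> t)"
proof -
  let ?q = "Q (\<gamma> t)"
  define fx fy where "fx = pdx F (\<gamma> t)" and "fy = pdy F (\<gamma> t)"
  define \<mu> where "\<mu> = 1 / ?q"
  have \<mu>: "\<mu> > 0" using Qpos[OF t] by (simp add: \<mu>_def)
  have v1: "vderiv \<gamma> s = (1 / Q (\<gamma> s)) *\<^sub>R rot90 (grad F (\<gamma> s))" if "\<bar>s\<bar> < r" for s
    using der[OF that] unfolding vderiv_def by (rule vector_derivative_at)
  have v1': "vderiv \<gamma> s = vector [- pdy F (\<gamma> s) / Q (\<gamma> s), pdx F (\<gamma> s) / Q (\<gamma> s)]" if "\<bar>s\<bar> < r" for s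
    using v1[OF that] by (simp add: rot90_def grad_def vec_eq_iff forall_2)
  define xx xy yx yy where "xx = pdx (pdx F) (\<gamma> t)" and "xy = pdy (pdx F) (\<gamma> t)"
    and "yx = pdx (pdy F) (\<gamma> t)" and "yy = pdy (pdy F) (\<gamma> t)"
  have along: "((\<lambda>t. a (\<gamma> t)) has_real_derivative \<mu> * (pdy a (\<gamma> t) * fx - pdx a (\<gamma> t) * fy)) (at t)"
    if "real_polynomial_function a" for a
    using has_real_derivative_along[OF that der[OF t]]
    by (rule DERIV_cong) (simp add: \<mu>_def fx_def fy_def rot90_def grad_def diff_divide_distrib)
  obtain q' where q': "((\<lambda>t. Q (\<gamma> t)) has_real_derivative q') (at t)" using along[OF Q] by blast
  define a b where "a = - (\<mu> * (yy * fx - yx * fy)) * \<mu> + fy * q' * \<mu>\<^sup>2"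
    and "b = (\<mu> * (xy * fx - xx * fy)) * \<mu> - fx * q' * \<mu>\<^sup>2"
  have "(vderiv \<gamma> has_vector_derivative vector [a, b]) (at t)"
  proof (rule has_vector_derivative_transform_within[OF has_vector_derivative_vector2])
    have "((\<lambda>t. - pdy F (\<gamma> t)) has_real_derivative - (\<mu> * (yy * fx - yx * fy))) (at t)"
      unfolding yy_def yx_def using F by (intro DERIV_minus along) auto
    from DERIV_divide[OF this q']
    show "((\<lambda>t. - pdy F (\<gamma> t) / Q (\<gamma> t)) has_real_derivative a) (at t)"
      by (rule DERIV_cong) (use Qpos[OF t] in \<open>simp_all add: a_def \<mu>_def fy_def field_simps power2_eq_square\<close>)
    have "((\<lambda>t. pdx F (\<gamma> t)) has_real_derivative (\<mu> * (xy * fx - xx * fy))) (at t)"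
      unfolding xy_def xx_def using F by (intro along) auto
    from DERIV_divide[OF this q']
    show "((\<lambda>t. pdx F (\<gamma> t) / Q (\<gamma> t)) has_real_derivative b) (at t)"
      by (rule DERIV_cong) (use Qpos[OF t] in \<open>simp_all add: b_def \<mu>_def fx_def field_simps power2_eq_square\<close>)
    show "vector [- pdy F (\<gamma> s) / Q (\<gamma> s), pdx F (\<gamma> s) / Q (\<gamma> s)] = vderiv \<gamma> s" if "dist s t < r - \<bar>t\<bar>" for s
      using v1'[of s] that by (auto simp: dist_norm)
  qed (use t in auto)
  then have v2: "vderiv (vderiv \<gamma>) t = vector [a, b]"
    unfolding vderiv_def by (rule vector_derivative_at)
  have v1t: "vderiv \<gamma> t = vector [- \<mu> * fy, \<mu> * fx]"
    using v1'[OF t] by (simp add: \<mu>_def fx_def fy_def vec_eq_iff forall_2)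
  have det: "det2 (vderiv \<gamma> t) (vderiv (vderiv \<gamma>) t) = \<mu> ^ 3 * hess_tangent F (\<gamma> t)"
    unfolding v1t v2 det2_def hess_tangent_def a_def b_def fx_def[symmetric] fy_def[symmetric]
      xx_def[symmetric] xy_def[symmetric] yx_def[symmetric] yy_def[symmetric]
    by (simp add: algebra_simps power2_eq_square power3_eq_cube)
  have "norm (vderiv \<gamma> t) = sqrt ((\<mu> * fy)\<^sup>2 + (\<mu> * fx)\<^sup>2)"
    by (simp add: v1t norm_vec_def L2_set_def UNIV_2)
  also have "(\<mu> * fy)\<^sup>2 + (\<mu> * fx)\<^sup>2 = \<mu>\<^sup>2 * gradsq F (\<gamma> t)"
    by (simp add: gradsq_def fx_def fy_def algebra_simps power_mult_distrib)
  also have "sqrt \<dots> = \<mu> * sqrt (gradsq F (\<gamma> t))"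
    using \<mu> by (simp add: real_sqrt_mult)
  finally have nrm: "norm (vderiv \<gamma> t) = \<mu> * sqrt (gradsq F (\<gamma> t))" .
  show ?thesis unfolding curvature_def det nrm level_curvature_def
    using \<mu> by (simp add: power_mult_distrib)
qed

lemma real_polynomial_function_gradsq [intro]:
    "real_polynomial_function F \<Longrightarrow> real_polynomial_function (gradsq F)"
  and real_polynomial_function_hess_tangent [intro]:
    "real_polynomial_function F \<Longrightarrow> real_polynomial_function (hess_tangent F)"
  unfolding gradsq_def hess_tangent_def by (intro real_polynomial_function_intros; auto)+

text \<open>
  Fermat's theorem along a local parametrization turns the search for cusps into an optimisation problem.
\<close>

lemma level_curvature_extremum_cusp:
  assumes F: "real_polynomial_function F" and p: "F p = 0" "gradsq F p > 0"
    and U: "open U" "p \<in> U" and s: "s = 1 \<or> s = -1"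
    and ext: "\<And>q. q \<in> U \<Longrightarrow> F q = 0 \<Longrightarrow> s * level_curvature F q \<le> s * level_curvature F p"
  shows "p \<in> evolute_cusps {q. F q = 0}"
proof -
  obtain \<gamma> r Q where r: "r > 0" and \<gamma>0: "\<gamma> 0 = p" and F0: "\<And>t. \<bar>t\<bar> < r \<Longrightarrow> F (\<gamma> t) = 0"
    and W: "\<exists>W g. openin (top_of_set {q. F q = 0}) W \<and> homeomorphism {-r<..<r} W \<gamma> g"
    and Q: "real_polynomial_function Q" and Qpos: "\<And>t. \<bar>t\<bar> < r \<Longrightarrow> Q (\<gamma> t) > 0"
    and grad: "\<And>t. \<bar>t\<bar> < r \<Longrightarrow> gradsq F (\<gamma> t) > 0"
    and der: "\<And>t. \<bar>t\<bar> < r \<Longrightarrow> (\<gamma> has_vector_derivative (1 / Q (\<gamma> t)) *\<^sub>R rot90 (grad F (\<gamma> t))) (at t)"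
    by (rule level_curve_local_parametrization[OF F p]) (rule that; assumption)
  have diff: "(vderiv ^^ n) \<gamma> differentiable (at t)" if "\<bar>t\<bar> < r" for n t
    using iterated_vderiv_level_curve[OF F Q Qpos der, of r n] that by blast
  have v0: "vderiv \<gamma> t \<noteq> 0" if "\<bar>t\<bar> < r" for t
  proof
    assume 0: "vderiv \<gamma> t = 0"
    have "(1 / Q (\<gamma> t)) *\<^sub>R rot90 (grad F (\<gamma> t)) = 0"
      using 0 vector_derivative_at[OF der[OF that]] by (simp add: vderiv_def)
    then have "pdx F (\<gamma> t) = 0 \<and> pdy F (\<gamma> t) = 0"
      using Qpos[OF that] by (simp add: vec_eq_iff forall_2 rot90_def grad_def)
    then show False using grad[OF that] by (simp add: gradsq_def)
  qed
  have par: "local_parametrization {q. F q = 0} p \<gamma>"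
    unfolding local_parametrization_def smooth_on_def using \<gamma>0 r W diff v0
    by (metis abs_less_iff greaterThanLessThan_iff minus_less_iff)
  have curv: "curvature \<gamma> t = level_curvature F (\<gamma> t)" if "\<bar>t\<bar> < r" for t
    by (rule curvature_level_curve[OF F Q Qpos der that])
  obtain c where c: "((\<lambda>t. level_curvature F (\<gamma> t)) has_real_derivative c) (at 0)"
  proof -
    have 0: "\<bar>0\<bar> < r" using r by simp
    obtain n' where n': "((\<lambda>t. hess_tangent F (\<gamma> t)) has_real_derivative n') (at 0)"
      using has_real_derivative_along[OF _ der[OF 0]] F by blast
    obtain g' where g': "((\<lambda>t. gradsq F (\<gamma> t)) has_real_derivative g') (at 0)"
      using has_real_derivative_along[OF _ der[OF 0]] F by blast
    show thesis
      unfolding level_curvature_def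
      by (rule that[unfolded level_curvature_def], rule DERIV_divide[OF n' DERIV_power[OF
              DERIV_chain2[OF DERIV_real_sqrt g']]]) (use grad[OF 0] in auto)
  qed
  have c': "(curvature \<gamma> has_real_derivative c) (at 0)"
    by (rule has_field_derivative_transform_within[OF c r]) (auto simp: curv)
  have "isCont \<gamma> 0"
    using der[of 0] r has_vector_derivative_continuous by force
  then have "\<forall>\<^sub>F t in at 0. \<gamma> t \<in> U"
    using topological_tendstoD[of \<gamma> "\<gamma> 0" "at 0" U] U \<gamma>0 by (simp add: isCont_def)
  then obtain d where "d > 0" "\<And>t. t \<noteq> 0 \<Longrightarrow> \<bar>t\<bar> < d \<Longrightarrow> \<gamma> t \<in> U"
    by (auto simp: eventually_at dist_norm)
  then have d: "d > 0" "\<And>t. \<bar>t\<bar> < d \<Longrightarrow> \<gamma> t \<in> U"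
    using U \<gamma>0 by metis+
  have "s * c = 0"
  proof (rule DERIV_local_max)
    show "((\<lambda>t. s * curvature \<gamma> t) has_real_derivative s * c) (at 0)"
      by (rule DERIV_cmult[OF c'])
    show "0 < min d r" using d r by simp
    show "\<forall>t. \<bar>0 - t\<bar> < min d r \<longrightarrow> s * curvature \<gamma> t \<le> s * curvature \<gamma> 0"
      using ext d F0 r by (auto simp: curv \<gamma>0)
  qed
  then have "c = 0" using s by auto
  then have "evolute_cusp_at \<gamma> 0"
    using evolute_cusp_at_iff_curvature_critical[of \<gamma> 0] c' diff[of 0 0] diff[of 0 1] diff[of 0 2] v0[of 0] r
    by (simp add: numeral_2_eq_2)
  then show ?thesis using par p(1) by (auto simp: evolute_cusps_def)
qed

section \<open>Small perturbations of a polynomial\<close>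

lemma eventually_perturbation_smaller:
  fixes G H :: "'a::topological_space \<Rightarrow> real"
  assumes "compact Z" "continuous_on Z G" "continuous_on Z H" "\<And>p. p \<in> Z \<Longrightarrow> G p \<noteq> 0"
  shows "\<forall>\<^sub>F \<epsilon> in at 0. \<forall>p\<in>Z. \<bar>\<epsilon> * H p\<bar> < \<bar>G p\<bar>"
proof (cases "Z = {}")
  case False
  obtain p0 where p0: "p0 \<in> Z" "\<And>p. p \<in> Z \<Longrightarrow> \<bar>G p0\<bar> \<le> \<bar>G p\<bar>"
    using continuous_attains_inf[OF assms(1) False continuous_on_rabs[OF assms(2)]] by blast
  obtain p1 where p1: "p1 \<in> Z" "\<And>p. p \<in> Z \<Longrightarrow> \<bar>H p\<bar> \<le> \<bar>H p1\<bar>"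
    using continuous_attains_sup[OF assms(1) False continuous_on_rabs[OF assms(3)]] by blast
  have "((\<lambda>\<epsilon>. \<bar>\<epsilon>\<bar> * \<bar>H p1\<bar>) \<longlongrightarrow> \<bar>0\<bar> * \<bar>H p1\<bar>) (at 0)"
    by (intro tendsto_intros)
  moreover have "\<bar>0\<bar> * \<bar>H p1\<bar> < \<bar>G p0\<bar>" using assms(4)[OF p0(1)] by simp
  ultimately have "\<forall>\<^sub>F \<epsilon> in at 0. \<bar>\<epsilon>\<bar> * \<bar>H p1\<bar> < \<bar>G p0\<bar>"
    by (rule order_tendstoD(2))
  then show ?thesis
  proof eventually_elim
    case (elim \<epsilon>)
    show ?case
    proof
      fix p assume p: "p \<in> Z"
      have "\<bar>\<epsilon> * H p\<bar> \<le> \<bar>\<epsilon>\<bar> * \<bar>H p1\<bar>" using p1(2)[OF p] by (simp add: abs_mult mult_left_mono)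
      then show "\<bar>\<epsilon> * H p\<bar> < \<bar>G p\<bar>" using elim p0(2)[OF p] by linarith
    qed
  qed
qed auto

lemma eventually_no_zero:
  fixes G H :: "'a::topological_space \<Rightarrow> real"
  assumes "compact Z" "continuous_on Z G" "continuous_on Z H" "\<And>p. p \<in> Z \<Longrightarrow> G p \<noteq> 0"
  shows "\<forall>\<^sub>F \<epsilon> in at 0. \<forall>p\<in>Z. G p + \<epsilon> * H p \<noteq> 0"
proof -
  have "\<forall>\<^sub>F \<epsilon> in at 0. \<forall>p\<in>Z. \<bar>\<epsilon> * H p\<bar> < \<bar>G p\<bar>"
    by (rule eventually_perturbation_smaller) (use assms in auto)
  then show ?thesis by eventually_elim force
qed

text \<open>
  Although \<open>G\<close> vanishes at \<open>v\<close>, no zero appears if \<open>G\<close> and \<open>\<epsilon> H\<close> have the same sign near \<open>v\<close>; away from \<open>v\<close>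
  the perturbation is too small to create one.
\<close>

lemma eventually_no_zero_barrier:
  fixes G H :: "real^2 \<Rightarrow> real"
  assumes Z: "compact Z" and G: "continuous_on UNIV G" and H: "continuous_on UNIV H" and v: "H v \<noteq> 0"
    and v0: "G v = 0" and sgn: "\<And>p. p \<in> Z \<Longrightarrow> p \<noteq> v \<Longrightarrow> k * G p > 0"
  shows "\<forall>\<^sub>F \<epsilon> in at 0. k * \<epsilon> * H v > 0 \<longrightarrow> (\<forall>p\<in>Z. G p + \<epsilon> * H p \<noteq> 0)"
proof -
  have op: "open {p. H p * H v > 0}"
    by (intro open_Collect_less continuous_intros H)
  let ?Z = "Z - {p. H p * H v > 0}"
  have vn: "v \<notin> ?Z" using v by (simp flip: power2_eq_square)
  have "\<forall>\<^sub>F \<epsilon> in at 0. \<forall>p\<in>?Z. G p + \<epsilon> * H p \<noteq> 0"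
    by (rule eventually_no_zero)
      (use Z op vn sgn in \<open>fastforce intro: compact_diff continuous_on_subset[OF G] continuous_on_subset[OF H]\<close>)+
  then show ?thesis
  proof eventually_elim
    case (elim \<epsilon>)
    show ?case
    proof (intro impI ballI)
      fix p assume e: "k * \<epsilon> * H v > 0" and p: "p \<in> Z"
      show "G p + \<epsilon> * H p \<noteq> 0"
      proof (cases "H p * H v > 0")
        case False then show ?thesis using elim p by blast
      next
        case True
        have "(k * \<epsilon> * H v) * (H p * H v) > 0" using e True by simp
        then have "(k * \<epsilon> * H p) * (H v)\<^sup>2 > 0" by (simp add: power2_eq_square algebra_simps)
        then have 1: "k * \<epsilon> * H p > 0" using v by (simp add: zero_less_mult_iff)
        show ?thesis
        proof
          assume "G p + \<epsilon> * H p = 0"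
          then have "k * G p + k * \<epsilon> * H p = 0" by (metis distrib_left mult.assoc mult_zero_right)
          moreover have "k * G p \<ge> 0" 
            using sgn[OF p] v0 by (cases "p = v") auto
          ultimately show False using 1 by linarith
        qed
      qed
    qed
  qed
qed

lemma eventually_uniformly_positive:
  fixes \<Phi> :: "'a::metric_space \<Rightarrow> real \<Rightarrow> real"
  assumes Z: "compact Z" and c: "continuous_on (Z \<times> {-1..1}) (\<lambda>(p, \<epsilon>). \<Phi> p \<epsilon>)"
    and pos: "\<And>p. p \<in> Z \<Longrightarrow> \<Phi> p 0 > 0"
  shows "\<exists>m>0. \<forall>\<^sub>F \<epsilon> in at 0. \<forall>p\<in>Z. \<Phi> p \<epsilon> > m"
proof (cases "Z = {}")
  case True then show ?thesis by (intro exI[of _ 1]) auto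
next
  case False
  have "continuous_on Z (\<lambda>p. (\<lambda>(p, \<epsilon>). \<Phi> p \<epsilon>) (p, 0))"
    by (rule continuous_on_compose2[OF c]) (auto intro!: continuous_intros)
  then obtain p0 where p0: "p0 \<in> Z" "\<And>p. p \<in> Z \<Longrightarrow> \<Phi> p0 0 \<le> \<Phi> p 0"
    using continuous_attains_inf[OF Z False, of "\<lambda>p. \<Phi> p 0"] by auto
  define m where "m = \<Phi> p0 0 / 2"
  have m: "m > 0" using pos[OF p0(1)] by (simp add: m_def)
  have "uniformly_continuous_on (Z \<times> {-1..1}) (\<lambda>(p, \<epsilon>). \<Phi> p \<epsilon>)"
    by (intro compact_uniformly_continuous c compact_Times Z) auto
  from uniformly_continuous_onE[OF this m] obtain d where d: "d > 0"
    "\<And>x x'. x \<in> Z \<times> {-1..1} \<Longrightarrow> x' \<in> Z \<times> {-1..1} \<Longrightarrow> dist x' x < d \<Longrightarrow>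
      dist (case_prod \<Phi> x') (case_prod \<Phi> x) < m" by (metis)
  have "\<forall>\<^sub>F \<epsilon> in at 0. \<bar>\<epsilon>\<bar> < min d 1"
    using d(1) by (auto simp: eventually_at dist_norm intro!: exI[of _ "min d 1"])
  then have "\<forall>\<^sub>F \<epsilon> in at 0. \<forall>p\<in>Z. \<Phi> p \<epsilon> > m"
  proof eventually_elim
    case (elim \<epsilon>)
    show ?case
    proof
      fix p assume p: "p \<in> Z"
      have "dist (\<Phi> p \<epsilon>) (\<Phi> p 0) < m"
      proof -
        have "\<epsilon> \<in> {-1..1}" using elim by auto
        then show ?thesis
          using d(2)[of "(p, 0)" "(p, \<epsilon>)"] elim p by (simp add: dist_Pair_Pair dist_norm)
      qed
      then show "\<Phi> p \<epsilon> > m" using p0(2)[OF p] by (auto simp: m_def dist_real_def abs_if split: if_splits)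
    qed
  qed
  then show ?thesis using m by blast
qed

abbreviation perturb :: "(real^2 \<Rightarrow> real) \<Rightarrow> (real^2 \<Rightarrow> real) \<Rightarrow> real \<Rightarrow> real^2 \<Rightarrow> real" where
  "perturb G H \<epsilon> \<equiv> (\<lambda>p. G p + \<epsilon> * H p)"

lemma real_polynomial_function_perturb [intro]:
  "real_polynomial_function G \<Longrightarrow> real_polynomial_function H \<Longrightarrow> real_polynomial_function (perturb G H \<epsilon>)"
  by (intro real_polynomial_function_intros)

lemma gradsq_perturb:
  assumes "real_polynomial_function G" "real_polynomial_function H"
  shows "gradsq (perturb G H \<epsilon>) p = (pdx G p + \<epsilon> * pdx H p)\<^sup>2 + (pdy G p + \<epsilon> * pdy H p)\<^sup>2"
  using assms by (simp add: gradsq_def pd_add_cmult)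

lemma hess_tangent_perturb:
  assumes "real_polynomial_function G" "real_polynomial_function H"
  shows "hess_tangent (perturb G H \<epsilon>) p =
     (pdx (pdx G) p + \<epsilon> * pdx (pdx H) p) * (pdy G p + \<epsilon> * pdy H p)\<^sup>2
     - (pdx (pdy G) p + \<epsilon> * pdx (pdy H) p + (pdy (pdx G) p + \<epsilon> * pdy (pdx H) p))
       * (pdx G p + \<epsilon> * pdx H p) * (pdy G p + \<epsilon> * pdy H p)
     + (pdy (pdy G) p + \<epsilon> * pdy (pdy H) p) * (pdx G p + \<epsilon> * pdx H p)\<^sup>2"
  using assms by (simp add: hess_tangent_def pd_add_cmult real_polynomial_function_pdx real_polynomial_function_pdy)

lemma continuous_on_poly_fst:
  "real_polynomial_function f \<Longrightarrow> continuous_on S (\<lambda>x. f (fst x :: real^2))"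
  by (rule continuous_on_compose2[OF real_polynomial_function_continuous_on[of f UNIV]])
    (auto intro!: continuous_intros)

text \<open>
  The sum of \<open>(G + \<epsilon> H)\<^sup>2\<close> and the squared gradient is positive on \<open>Z\<close> for \<open>\<epsilon> = 0\<close>, hence bounded below for small
  \<open>\<epsilon>\<close>; on the perturbed curve it is the squared gradient.
\<close>

lemma eventually_regular_bounded_curvature:
  assumes G: "real_polynomial_function G" and H: "real_polynomial_function H"
    and Z: "compact Z" and reg: "\<And>p. p \<in> Z \<Longrightarrow> G p = 0 \<Longrightarrow> gradsq G p > 0"
  shows "\<exists>M. \<forall>\<^sub>F \<epsilon> in at 0. \<forall>p\<in>Z. perturb G H \<epsilon> p = 0 \<longrightarrow>
     gradsq (perturb G H \<epsilon>) p > 0 \<and> \<bar>level_curvature (perturb G H \<epsilon>) p\<bar> \<le> M"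
proof -
  define \<Phi> where "\<Phi> = (\<lambda>p \<epsilon>. (perturb G H \<epsilon> p)\<^sup>2 + gradsq (perturb G H \<epsilon>) p)"
  have c1: "continuous_on (Z \<times> {-1..1}) (\<lambda>(p, \<epsilon>). \<Phi> p \<epsilon>)"
    unfolding \<Phi>_def gradsq_perturb[OF G H] split_beta using G H
    by (intro continuous_intros continuous_on_poly_fst) auto
  have c2: "continuous_on (Z \<times> {-1..1}) (\<lambda>(p, \<epsilon>). hess_tangent (perturb G H \<epsilon>) p)"
    unfolding hess_tangent_perturb[OF G H] split_beta using G H
    by (intro continuous_intros continuous_on_poly_fst) auto
  have pos: "\<Phi> p 0 > 0" if "p \<in> Z" for p
    using reg[OF that]
    by (cases "G p = 0") (auto simp: \<Phi>_def gradsq_def intro: add_pos_nonneg)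
  obtain m where m: "m > 0" "\<forall>\<^sub>F \<epsilon> in at 0. \<forall>p\<in>Z. \<Phi> p \<epsilon> > m"
    using eventually_uniformly_positive[OF Z c1 pos] by blast
  have "bounded ((\<lambda>(p, \<epsilon>). hess_tangent (perturb G H \<epsilon>) p) ` (Z \<times> {-1..1}))"
    by (intro compact_imp_bounded compact_continuous_image c2 compact_Times Z) auto
  then obtain C where C: "C > 0" "\<And>p \<epsilon>. p \<in> Z \<Longrightarrow> \<epsilon> \<in> {-1..1} \<Longrightarrow> \<bar>hess_tangent (perturb G H \<epsilon>) p\<bar> \<le> C"
    unfolding bounded_pos by fastforce
  have "\<forall>\<^sub>F \<epsilon> in at 0. \<bar>\<epsilon>\<bar> < (1::real)"
    by (auto simp: eventually_at dist_norm intro!: exI[of _ 1])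
  with m(2) have "\<forall>\<^sub>F \<epsilon> in at 0. \<forall>p\<in>Z. perturb G H \<epsilon> p = 0 \<longrightarrow>
     gradsq (perturb G H \<epsilon>) p > 0 \<and> \<bar>level_curvature (perturb G H \<epsilon>) p\<bar> \<le> C / sqrt m ^ 3"
  proof eventually_elim
    case (elim \<epsilon>)
    show ?case
    proof (intro ballI impI)
      fix p assume p: "p \<in> Z" and 0: "perturb G H \<epsilon> p = 0"
      have gs: "gradsq (perturb G H \<epsilon>) p > m"
        using elim(1) p 0 by (auto simp: \<Phi>_def)
      have "\<bar>level_curvature (perturb G H \<epsilon>) p\<bar> = \<bar>hess_tangent (perturb G H \<epsilon>) p\<bar> / sqrt (gradsq (perturb G H \<epsilon>) p) ^ 3"
        using gs m by (simp add: level_curvature_def abs_divide)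
      also have "\<dots> \<le> C / sqrt m ^ 3"
        using C(1) C(2)[OF p, of \<epsilon>] elim(2) gs m
        by (intro frac_le power_mono) (auto simp: abs_le_iff abs_less_iff)
      finally show "gradsq (perturb G H \<epsilon>) p > 0 \<and> \<bar>level_curvature (perturb G H \<epsilon>) p\<bar> \<le> C / sqrt m ^ 3"
        using gs m by simp
    qed
  qed
  then show ?thesis by blast
qed

section \<open>Curvature near a node\<close>

lemma tendsto_along_ray:
  fixes f :: "real^2 \<Rightarrow> real"
  assumes "real_polynomial_function f"
  shows "((\<lambda>t. f (v + t *\<^sub>R a)) \<longlongrightarrow> f v) (at_right 0)"
proof -
  have "continuous_on UNIV (\<lambda>t. f (v + t *\<^sub>R a))"
    by (rule continuous_on_compose2[OF real_polynomial_function_continuous_on[OF assms, of UNIV]])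
      (auto intro!: continuous_intros)
  then have "isCont (\<lambda>t. f (v + t *\<^sub>R a)) 0" by (simp add: continuous_on_eq_continuous_at)
  then show ?thesis by (simp add: isCont_def filterlim_at_split)
qed

lemma tendsto_quotient_along_ray:
  assumes f: "real_polynomial_function f" and "f v = 0"
  shows "((\<lambda>t. f (v + t *\<^sub>R a) / t) \<longlongrightarrow> pdx f v * a $ 1 + pdy f v * a $ 2) (at_right 0)"
proof -
  have "((\<lambda>t. v + t *\<^sub>R a) has_vector_derivative a) (at 0)"
    by (auto intro!: derivative_eq_intros)
  from has_real_derivative_along[OF f this] show ?thesis
    using assms(2) by (simp add: DERIV_def filterlim_at_split)
qed

text \<open>
  The perturbed curve through \<open>v + t a\<close> has the parameter \<open>\<epsilon> = - G / H = o(t)\<close>. Let \<open>B\<close> be the Hessian of \<open>G\<close> at \<open>v\<close>.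
  The gradient at this point, divided by \<open>t\<close>, tends to \<open>B a\<close>, and the Hessian on the tangent vector, divided by \<open>t\<^sup>2\<close>,
  tends to \<open>B(J B a, J B a) = det B \<cdot> B(a, a)\<close>. So \<open>t\<close> times the curvature has a nonzero limit, whose sign is
  opposite to that of \<open>q = B(a, a)\<close> because \<open>det B < 0\<close> at a node.
\<close>

lemma ray_curvature_blowup:
  fixes a v :: "real^2"
  assumes G: "real_polynomial_function G" and H: "real_polynomial_function H"
    and v: "G v = 0" "pdx G v = 0" "pdy G v = 0" "H v \<noteq> 0"
    and sym: "pdx (pdy G) v = B" "pdy (pdx G) v = B"
    and A: "pdx (pdx G) v = A" and C: "pdy (pdy G) v = C"
    and det: "A * C - B\<^sup>2 < 0"
    and q: "q = A * (a $ 1)\<^sup>2 + 2 * B * a $ 1 * a $ 2 + C * (a $ 2)\<^sup>2" "q \<noteq> 0"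
  shows "\<forall>\<^sub>F t in at_right 0.
    - sgn q * level_curvature (perturb G H (- G (v + t *\<^sub>R a) / H (v + t *\<^sub>R a))) (v + t *\<^sub>R a) > M"
proof -
  define p where "p = (\<lambda>t. v + t *\<^sub>R a)"
  define \<epsilon> where "\<epsilon> = (\<lambda>t. - G (p t) / H (p t))"
  define F where "F = (\<lambda>t. perturb G H (\<epsilon> t))"
  have lim: "((\<lambda>t. f (p t)) \<longlongrightarrow> f v) (at_right 0)" if "real_polynomial_function f" for f
    unfolding p_def by (rule tendsto_along_ray[OF that])
  have quot: "((\<lambda>t. f (p t) / t) \<longlongrightarrow> pdx f v * a $ 1 + pdy f v * a $ 2) (at_right 0)"
    if "real_polynomial_function f" "f v = 0" for f
    unfolding p_def by (rule tendsto_quotient_along_ray[OF that])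
  have "((\<lambda>t. - (G (p t) / t) / H (p t)) \<longlongrightarrow> - (pdx G v * a $ 1 + pdy G v * a $ 2) / H v) (at_right 0)"
    by (intro tendsto_intros quot lim G H v)
  moreover have "(\<lambda>t. - (G (p t) / t) / H (p t)) = (\<lambda>t. \<epsilon> t / t)"
    by (simp add: \<epsilon>_def fun_eq_iff)
  ultimately have \<epsilon>t: "((\<lambda>t. \<epsilon> t / t) \<longlongrightarrow> 0) (at_right 0)" by (simp add: v)
  have "((\<lambda>t. - G (p t) / H (p t)) \<longlongrightarrow> - G v / H v) (at_right 0)"
    by (intro tendsto_intros lim G H v)
  then have \<epsilon>0: "(\<epsilon> \<longlongrightarrow> 0) (at_right 0)" by (simp add: v \<epsilon>_def)
  define X Y where "X = A * a $ 1 + B * a $ 2" and "Y = B * a $ 1 + C * a $ 2"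
  have X: "((\<lambda>t. pdx (F t) (p t) / t) \<longlongrightarrow> X) (at_right 0)"
  proof -
    have "((\<lambda>t. pdx G (p t) / t + (\<epsilon> t / t) * pdx H (p t)) \<longlongrightarrow>
        (pdx (pdx G) v * a $ 1 + pdy (pdx G) v * a $ 2) + 0 * pdx H v) (at_right 0)"
      using G H by (intro tendsto_intros quot lim \<epsilon>t v) auto
    then show ?thesis by (simp add: F_def pd_add_cmult[OF G H] A sym X_def add_divide_distrib)
  qed
  have Y: "((\<lambda>t. pdy (F t) (p t) / t) \<longlongrightarrow> Y) (at_right 0)"
  proof -
    have "((\<lambda>t. pdy G (p t) / t + (\<epsilon> t / t) * pdy H (p t)) \<longlongrightarrow>
        (pdx (pdy G) v * a $ 1 + pdy (pdy G) v * a $ 2) + 0 * pdy H v) (at_right 0)"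
      using G H by (intro tendsto_intros quot lim \<epsilon>t v) auto
    then show ?thesis by (simp add: F_def pd_add_cmult[OF G H] C sym Y_def add_divide_distrib)
  qed
  have second: "((\<lambda>t. f (p t) + \<epsilon> t * g (p t)) \<longlongrightarrow> f v) (at_right 0)"
    if "real_polynomial_function f" "real_polynomial_function g" for f g
  proof -
    have "((\<lambda>t. f (p t) + \<epsilon> t * g (p t)) \<longlongrightarrow> f v + 0 * g v) (at_right 0)"
      by (intro tendsto_intros lim \<epsilon>0 that)
    then show ?thesis by simp
  qed
  have xx: "((\<lambda>t. pdx (pdx (F t)) (p t)) \<longlongrightarrow> A) (at_right 0)"
    and xy: "((\<lambda>t. pdx (pdy (F t)) (p t)) \<longlongrightarrow> B) (at_right 0)"
    and yx: "((\<lambda>t. pdy (pdx (F t)) (p t)) \<longlongrightarrow> B) (at_right 0)"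
    and yy: "((\<lambda>t. pdy (pdy (F t)) (p t)) \<longlongrightarrow> C) (at_right 0)"
    using second[of "pdx (pdx G)" "pdx (pdx H)"] second[of "pdx (pdy G)" "pdx (pdy H)"]
      second[of "pdy (pdx G)" "pdy (pdx H)"] second[of "pdy (pdy G)" "pdy (pdy H)"] G H
    by (simp_all add: F_def pd_add_cmult real_polynomial_function_pdx real_polynomial_function_pdy sym A C)
  define h where "h = A * Y\<^sup>2 - (B + B) * X * Y + C * X\<^sup>2"
  have h: "h = (A * C - B\<^sup>2) * q"
    unfolding h_def X_def Y_def q by (simp add: power2_eq_square algebra_simps)
  have XY: "X\<^sup>2 + Y\<^sup>2 > 0"
  proof -
    have "X * a $ 1 + Y * a $ 2 = q" by (simp add: X_def Y_def q power2_eq_square algebra_simps)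
    then have "X \<noteq> 0 \<or> Y \<noteq> 0" using q(2) by auto
    then show ?thesis by (simp add: sum_power2_gt_zero_iff)
  qed
  define c where "c = h / sqrt (X\<^sup>2 + Y\<^sup>2) ^ 3"
  have "((\<lambda>t. (pdx (pdx (F t)) (p t) * (pdy (F t) (p t) / t)\<^sup>2
      - (pdx (pdy (F t)) (p t) + pdy (pdx (F t)) (p t)) * (pdx (F t) (p t) / t) * (pdy (F t) (p t) / t)
      + pdy (pdy (F t)) (p t) * (pdx (F t) (p t) / t)\<^sup>2)
      / sqrt ((pdx (F t) (p t) / t)\<^sup>2 + (pdy (F t) (p t) / t)\<^sup>2) ^ 3) \<longlongrightarrow> c) (at_right 0)"
    unfolding c_def h_def using XY by (intro tendsto_intros xx xy yx yy X Y) auto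
  moreover have "\<forall>\<^sub>F t in at_right 0. t > (0::real)" by (simp add: eventually_at_right_less)
  then have "\<forall>\<^sub>F t in at_right 0. (pdx (pdx (F t)) (p t) * (pdy (F t) (p t) / t)\<^sup>2
      - (pdx (pdy (F t)) (p t) + pdy (pdx (F t)) (p t)) * (pdx (F t) (p t) / t) * (pdy (F t) (p t) / t)
      + pdy (pdy (F t)) (p t) * (pdx (F t) (p t) / t)\<^sup>2)
      / sqrt ((pdx (F t) (p t) / t)\<^sup>2 + (pdy (F t) (p t) / t)\<^sup>2) ^ 3 = t * level_curvature (F t) (p t)"
  proof eventually_elim
    case (elim t)
    have "(xx * (y / t)\<^sup>2 - b * (x / t) * (y / t) + yy * (x / t)\<^sup>2) / sqrt ((x / t)\<^sup>2 + (y / t)\<^sup>2) ^ 3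
      = t * ((xx * y\<^sup>2 - b * x * y + yy * x\<^sup>2) / sqrt (x\<^sup>2 + y\<^sup>2) ^ 3)" for xx b yy x y
    proof -
      have "sqrt ((x / t)\<^sup>2 + (y / t)\<^sup>2) = sqrt (x\<^sup>2 + y\<^sup>2) / t"
        using elim by (simp add: power_divide add_divide_distrib[symmetric] real_sqrt_divide)
      moreover have "xx * (y / t)\<^sup>2 - b * (x / t) * (y / t) + yy * (x / t)\<^sup>2 = (xx * y\<^sup>2 - b * x * y + yy * x\<^sup>2) / t\<^sup>2"
        using elim by (simp add: field_simps power2_eq_square)
      moreover have "(N / t\<^sup>2) / (R / t) ^ 3 = t * (N / R ^ 3)" for N R
        using elim by (simp add: power_divide power2_eq_square power3_eq_cube)
      ultimately show ?thesis by metis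
    qed
    then show ?case unfolding level_curvature_def hess_tangent_def gradsq_def by blast
  qed
  ultimately have lc: "((\<lambda>t. t * level_curvature (F t) (p t)) \<longlongrightarrow> c) (at_right 0)"
    by (rule Lim_transform_eventually)
  have "- sgn q * c > 0"
    using XY det q(2) unfolding c_def h by (auto simp: sgn_if mult_less_0_iff zero_less_mult_iff divide_less_0_iff)
  moreover have "((\<lambda>t. - sgn q * (t * level_curvature (F t) (p t)) - t * M) \<longlongrightarrow> - sgn q * c - 0 * M) (at_right 0)"
    by (intro tendsto_intros lc)
  ultimately have "\<forall>\<^sub>F t in at_right 0. - sgn q * (t * level_curvature (F t) (p t)) - t * M > 0"
    by (intro order_tendstoD(1)) auto
  moreover have "\<forall>\<^sub>F t in at_right 0. t > (0::real)" by (simp add: eventually_at_right_less)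
  ultimately have "\<forall>\<^sub>F t in at_right 0. - sgn q * level_curvature (F t) (p t) > M"
  proof eventually_elim
    case (elim t)
    then have "t * (- sgn q * level_curvature (F t) (p t) - M) > 0" by (simp add: algebra_simps)
    then show ?case using elim(2) by (simp add: zero_less_mult_iff)
  qed
  then show ?thesis by (simp only: F_def p_def \<epsilon>_def)
qed

text \<open>
  For small \<open>\<epsilon>\<close> the curve can meet the ray only close to \<open>v\<close>, where the curvature is large. Its sign is
  opposite to that of \<open>G\<close>, and as \<open>\<epsilon> H = - G\<close> on the curve, this is the sign of \<open>\<epsilon> H v\<close>, whichever the ray.
\<close>

lemma eventually_ray_curvature_large:
  fixes a v :: "real^2"
  assumes G: "real_polynomial_function G" and H: "real_polynomial_function H"
    and v: "G v = 0" "pdx G v = 0" "pdy G v = 0" "H v \<noteq> 0"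
    and sym: "pdx (pdy G) v = B" "pdy (pdx G) v = B"
    and A: "pdx (pdx G) v = A" and C: "pdy (pdy G) v = C"
    and det: "A * C - B\<^sup>2 < 0"
    and q: "q = A * (a $ 1)\<^sup>2 + 2 * B * a $ 1 * a $ 2 + C * (a $ 2)\<^sup>2" "q \<noteq> 0"
    and Gpos: "\<And>t. 0 < t \<Longrightarrow> t \<le> T \<Longrightarrow> q * G (v + t *\<^sub>R a) > 0"
  shows "\<forall>\<^sub>F \<epsilon> in at 0. \<forall>t. 0 < t \<and> t \<le> T \<and> perturb G H \<epsilon> (v + t *\<^sub>R a) = 0 \<longrightarrow>
    sgn (\<epsilon> * H v) * level_curvature (perturb G H \<epsilon>) (v + t *\<^sub>R a) > M"
proof -
  have "((\<lambda>t. H (v + t *\<^sub>R a) * H v) \<longlongrightarrow> H v * H v) (at_right 0)"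
    by (intro tendsto_intros tendsto_along_ray H)
  moreover have "H v * H v > 0" using v(4) by (simp flip: power2_eq_square)
  ultimately have "\<forall>\<^sub>F t in at_right 0. H (v + t *\<^sub>R a) * H v > 0"
    by (rule order_tendstoD(1))
  with ray_curvature_blowup[OF G H v sym A C det q, of M]
  have "\<forall>\<^sub>F t in at_right 0. H (v + t *\<^sub>R a) * H v > 0 \<and>
     - sgn q * level_curvature (perturb G H (- G (v + t *\<^sub>R a) / H (v + t *\<^sub>R a))) (v + t *\<^sub>R a) > M"
    by eventually_elim auto
  then obtain t0 where t0: "t0 > 0" and near: "\<And>t. 0 < t \<Longrightarrow> t < t0 \<Longrightarrow> H (v + t *\<^sub>R a) * H v > 0 \<and>
     - sgn q * level_curvature (perturb G H (- G (v + t *\<^sub>R a) / H (v + t *\<^sub>R a))) (v + t *\<^sub>R a) > M"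
    unfolding eventually_at_right_field by auto
  have cont: "continuous_on S (\<lambda>t. f (v + t *\<^sub>R a))" if "real_polynomial_function f" for f S
    by (rule continuous_on_compose2[OF real_polynomial_function_continuous_on[OF that, of UNIV]])
      (auto intro!: continuous_intros)
  have "\<forall>\<^sub>F \<epsilon> in at 0. \<forall>t\<in>{t0..T}. G (v + t *\<^sub>R a) + \<epsilon> * H (v + t *\<^sub>R a) \<noteq> 0"
    by (rule eventually_no_zero) (use t0 in \<open>auto intro!: cont G H dest!: Gpos[rotated]\<close>)
  then show ?thesis
  proof eventually_elim
    case (elim \<epsilon>)
    show ?case
    proof (intro allI impI)
      fix t assume t: "0 < t \<and> t \<le> T \<and> perturb G H \<epsilon> (v + t *\<^sub>R a) = 0"
      let ?p = "v + t *\<^sub>R a"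
      have "t < t0" using t elim by force
      then have n: "H ?p * H v > 0" "- sgn q * level_curvature (perturb G H (- G ?p / H ?p)) ?p > M"
        using near t by auto
      have \<epsilon>: "\<epsilon> = - G ?p / H ?p"
      proof -
        have "H ?p \<noteq> 0" "\<epsilon> * H ?p = - G ?p" using t n(1) by auto
        then show ?thesis by (metis nonzero_mult_div_cancel_right)
      qed
      have "\<epsilon> * H v = - G ?p * (H v / H ?p)" unfolding \<epsilon> by simp
      moreover have "H v / H ?p > 0" using n(1) by (auto simp: zero_less_mult_iff zero_less_divide_iff)
      moreover have "sgn (G ?p) = sgn q" using Gpos[of t] t by (auto simp: zero_less_mult_iff)
      ultimately have "sgn (\<epsilon> * H v) = - sgn q"
        by (metis mult.right_neutral sgn_minus sgn_mult sgn_pos)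
      then show "sgn (\<epsilon> * H v) * level_curvature (perturb G H \<epsilon>) ?p > M"
        using n(2) \<epsilon> by simp
    qed
  qed
qed

text \<open>
  As \<open>G\<close> is nearly homogeneous of degree two around \<open>v\<close>, Euler's identity gives
  \<open>(p - v) \<bullet> (H \<nabla>G - G \<nabla>H) = G (2 H + O(\<bar>p - v\<bar>))\<close>, which is not zero off the branches. On the curve, where \<open>\<epsilon> = - G / H\<close>,
  the vector \<open>H \<nabla>G - G \<nabla>H\<close> is a multiple of the gradient.
\<close>

lemma perturbation_regular_near_node:
  fixes v n m :: "real^2"
  assumes g: "real_polynomial_function g" and H: "real_polynomial_function H" and v: "g v \<noteq> 0" "H v \<noteq> 0"
    and G: "\<And>p. G p = (n \<bullet> (p - v)) * ((m \<bullet> (p - v)) * g p)"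
  shows "\<exists>\<rho>>0. \<forall>p\<in>ball v \<rho>. \<forall>\<epsilon>. \<epsilon> \<noteq> 0 \<longrightarrow> perturb G H \<epsilon> p = 0 \<longrightarrow> gradsq (perturb G H \<epsilon>) p > 0"
proof -
  have x: "real_polynomial_function (\<lambda>p::real^2. n \<bullet> (p - v))" for n
    by (intro real_polynomial_function_linear_offset)
  define R where "R = (\<lambda>f p. (p $ 1 - v $ 1) * pdx f p + (p $ 2 - v $ 2) * pdy f p)"
  have R: "real_polynomial_function (R f)" if "real_polynomial_function f" for f
    unfolding R_def using that by (intro real_polynomial_function_intros) auto
  define E where "E = (\<lambda>p. (2 * g p + R g p) * H p - g p * R H p)"
  have "real_polynomial_function (\<lambda>p. E p * H p)"
    unfolding E_def using g H by (intro real_polynomial_function_intros R)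
  then have "open {p. E p * H p \<noteq> 0}"
    by (intro open_Collect_neq real_polynomial_function_continuous_on continuous_intros)
  moreover have "E v * H v \<noteq> 0" using v by (simp add: E_def R_def)
  ultimately obtain \<rho> where \<rho>: "\<rho> > 0" "ball v \<rho> \<subseteq> {p. E p * H p \<noteq> 0}"
    using open_contains_ball by blast
  have G': "G = (\<lambda>p. (n \<bullet> (p - v)) * ((m \<bullet> (p - v)) * g p))" using G by blast
  have Gp: "real_polynomial_function G"
    unfolding G' using g by (intro real_polynomial_function_mult x)
  have RG: "R G p = (n \<bullet> (p - v)) * (m \<bullet> (p - v)) * (2 * g p + R g p)" for p
    unfolding G' R_def using g x[of n] x[of m]
    by (simp add: pd_mult real_polynomial_function_mult pd_linear_offset)
      (simp add: inner_vec_def sum_2 algebra_simps)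
  have "gradsq (perturb G H \<epsilon>) p > 0"
    if p: "p \<in> ball v \<rho>" and \<epsilon>: "\<epsilon> \<noteq> 0" and 0: "perturb G H \<epsilon> p = 0" for p \<epsilon>
  proof (rule ccontr)
    assume "\<not> gradsq (perturb G H \<epsilon>) p > 0"
    then have "pdx (perturb G H \<epsilon>) p = 0" "pdy (perturb G H \<epsilon>) p = 0"
      unfolding gradsq_def by (auto simp: sum_power2_gt_zero_iff)
    then have "pdx G p = - \<epsilon> * pdx H p" "pdy G p = - \<epsilon> * pdy H p"
      by (simp_all add: pd_add_cmult[OF Gp H])
    then have "R G p = - \<epsilon> * R H p" by (simp add: R_def algebra_simps)
    then have "H p * R G p = - \<epsilon> * H p * R H p" by simp
    also have "- \<epsilon> * H p = G p" using 0 by (simp add: eq_neg_iff_add_eq_0)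
    finally have "H p * ((n \<bullet> (p - v)) * (m \<bullet> (p - v)) * (2 * g p + R g p))
        = (n \<bullet> (p - v)) * ((m \<bullet> (p - v)) * g p) * R H p"
      by (simp only: RG[of p] G[of p])
    then have "(n \<bullet> (p - v)) * (m \<bullet> (p - v)) * E p = 0"
      unfolding E_def by algebra
    then have "G p = 0" using \<rho>(2) p by (auto simp: G)
    then show False using 0 \<epsilon> \<rho>(2) p by auto
  qed
  then show ?thesis using \<rho>(1) by blast
qed

text \<open>
  The maximum of the curvature over the part of the curve in \<open>B\<close> exists by compactness and lies in the open set \<open>U\<close>,
  because on the rest of \<open>B\<close> the curvature is below its value at \<open>c\<close>.
\<close>

lemma extremal_cusp_in_region:
  assumes F: "real_polynomial_function F" and B: "compact B" and U: "open U" "U \<subseteq> B"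
    and s: "s = 1 \<or> s = -1" and c: "c \<in> B" "F c = 0"
    and reg: "\<And>p. p \<in> B \<Longrightarrow> F p = 0 \<Longrightarrow> gradsq F p > 0"
    and bd: "\<And>p. p \<in> B - U \<Longrightarrow> F p = 0 \<Longrightarrow> s * level_curvature F p < s * level_curvature F c"
  shows "\<exists>p\<in>U. p \<in> evolute_cusps {q. F q = 0} \<and> s * level_curvature F p \<ge> s * level_curvature F c"
proof -
  let ?R = "B \<inter> {q. F q = 0}"
  have "closed {q. F q = 0}"
    by (intro closed_Collect_eq real_polynomial_function_continuous_on F continuous_intros)
  then have R: "compact ?R" using B by blast
  have "continuous_on ?R (\<lambda>q. s * level_curvature F q)"
    unfolding level_curvature_def using reg F
    by (intro continuous_intros real_polynomial_function_continuous_on) force+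
  from continuous_attains_sup[OF R _ this] c obtain p where p: "p \<in> ?R"
    and max: "\<And>q. q \<in> ?R \<Longrightarrow> s * level_curvature F q \<le> s * level_curvature F p"
    by blast
  have ge: "s * level_curvature F p \<ge> s * level_curvature F c" using max c by blast
  then have pU: "p \<in> U" using bd[of p] p by force
  have "p \<in> evolute_cusps {q. F q = 0}"
    by (rule level_curvature_extremum_cusp[OF F _ _ U(1) pU s]) (use p reg max U in auto)
  then show ?thesis using pU ge by blast
qed

section \<open>Line arrangements with normalised equations\<close>

lemma det2_solve:
  assumes "det2 n m \<noteq> 0"
  shows "\<exists>a. n \<bullet> a = \<alpha> \<and> m \<bullet> a = \<beta>"
proof (intro exI conjI)
  let ?a = "vector [(\<alpha> * m $ 2 - \<beta> * n $ 2) / det2 n m, (\<beta> * n $ 1 - \<alpha> * m $ 1) / det2 n m] :: real^2"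
  have 1: "n $ 1 * (\<alpha> * m $ 2 - \<beta> * n $ 2) + n $ 2 * (\<beta> * n $ 1 - \<alpha> * m $ 1) = \<alpha> * det2 n m"
    "m $ 1 * (\<alpha> * m $ 2 - \<beta> * n $ 2) + m $ 2 * (\<beta> * n $ 1 - \<alpha> * m $ 1) = \<beta> * det2 n m"
    by (simp_all add: det2_def algebra_simps)
  show "n \<bullet> ?a = \<alpha>" "m \<bullet> ?a = \<beta>"
    using 1 assms by (simp_all add: inner_real2 add_divide_distrib[symmetric])
qed

lemma det2_inner_eq_0:
  assumes "det2 n m \<noteq> 0" "n \<bullet> a = 0" "m \<bullet> a = 0"
  shows "a = 0"
proof -
  have "det2 n m * a $ 1 = 0" "det2 n m * a $ 2 = 0"
    using assms(2,3) unfolding det2_def inner_real2 by algebra+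
  then show ?thesis using assms(1) by (simp add: vec_eq_iff forall_2)
qed

lemma orthogonal_imp_parallel:
  fixes n a u :: "real^2"
  assumes "n \<noteq> 0" "u \<noteq> 0" "n \<bullet> a = 0" "n \<bullet> u = 0"
  shows "\<exists>t. a = t *\<^sub>R u"
proof -
  have "n $ 1 * (a $ 1 * u $ 2 - a $ 2 * u $ 1) = 0" "n $ 2 * (a $ 1 * u $ 2 - a $ 2 * u $ 1) = 0"
    using assms(3,4) unfolding inner_real2 by algebra+
  then have e: "a $ 1 * u $ 2 = a $ 2 * u $ 1" using assms(1) by (auto simp: vec_eq_iff forall_2)
  show ?thesis
  proof (cases "u $ 1 = 0")
    case True
    then have "u $ 2 \<noteq> 0" using assms(2) by (auto simp: vec_eq_iff forall_2)
    then show ?thesis using e True by (intro exI[of _ "a $ 2 / u $ 2"]) (auto simp: vec_eq_iff forall_2)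
  next
    case False
    then show ?thesis using e by (intro exI[of _ "a $ 1 / u $ 1"]) (auto simp: vec_eq_iff forall_2 field_simps)
  qed
qed

lemma affine_function_sign:
  fixes \<alpha> \<beta> T :: real
  assumes "\<And>t. 0 \<le> t \<Longrightarrow> t \<le> T \<Longrightarrow> \<alpha> + t * \<beta> \<noteq> 0" "0 \<le> t" "t \<le> T"
  shows "\<alpha> * (\<alpha> + t * \<beta>) > 0"
proof (rule ccontr)
  assume "\<not> ?thesis"
  moreover have "\<alpha> \<noteq> 0" "\<alpha> + t * \<beta> \<noteq> 0" using assms(1)[of 0] assms(1)[of t] assms by auto
  ultimately have neg: "\<alpha> * (\<alpha> + t * \<beta>) < 0" by (metis linorder_neqE_linordered_idom mult_eq_0_iff)
  have cont: "continuous_on {0..t} (\<lambda>x. \<alpha> + x * \<beta>)" by (intro continuous_intros)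
  have "\<exists>x\<ge>0. x \<le> t \<and> \<alpha> + x * \<beta> = 0"
  proof (cases "\<alpha> > 0")
    case True
    then show ?thesis using IVT2'[of "\<lambda>x. \<alpha> + x * \<beta>" t 0 0] neg assms(2) cont
      by (auto simp: mult_less_0_iff)
  next
    case False
    then show ?thesis using IVT'[of "\<lambda>x. \<alpha> + x * \<beta>" 0 0 t] neg assms(2) cont
      by (auto simp: mult_less_0_iff)
  qed
  then show False using assms by force
qed

text \<open>
  Unit normals make \<open>N l\<close> the signed distance from the line \<open>l\<close>, and the product \<open>G\<close> a function of the arrangement
  alone; every product of linear equations of the lines is a constant multiple of it.
\<close>

locale line_arrangement =
  fixes A :: "(real^2) set set" and n :: "(real^2) set \<Rightarrow> real^2" and b :: "(real^2) set \<Rightarrow> real"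
  assumes fin: "finite A"
    and unit: "l \<in> A \<Longrightarrow> norm (n l) = 1"
    and line: "l \<in> A \<Longrightarrow> l = {p. n l \<bullet> p = b l}"
    and transversal: "l \<in> A \<Longrightarrow> m \<in> A \<Longrightarrow> l \<noteq> m \<Longrightarrow> det2 (n l) (n m) \<noteq> 0"
    and no_triple: "l \<in> A \<Longrightarrow> m \<in> A \<Longrightarrow> k \<in> A \<Longrightarrow> l \<noteq> m \<Longrightarrow> m \<noteq> k \<Longrightarrow> l \<noteq> k \<Longrightarrow> l \<inter> m \<inter> k = {}"
begin

definition N :: "(real^2) set \<Rightarrow> real^2 \<Rightarrow> real" where "N l p = n l \<bullet> p - b l"

definition G :: "real^2 \<Rightarrow> real" where "G p = (\<Prod>l\<in>A. N l p)"

lemma mem_line: "l \<in> A \<Longrightarrow> p \<in> l \<longleftrightarrow> N l p = 0"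
  using line[of l] by (auto simp: N_def)

lemma N_add: "N l (p + a) = N l p + n l \<bullet> a"
  by (simp add: N_def inner_add_right)

lemma N_offset: "N l v = 0 \<Longrightarrow> N l p = n l \<bullet> (p - v)"
  by (simp add: N_def inner_diff_right)

lemma N_convex_combination: "N l ((1 - t) *\<^sub>R p + t *\<^sub>R q) = (1 - t) * N l p + t * N l q"
  by (simp add: N_def inner_add_right algebra_simps)

lemma N_lipschitz: "l \<in> A \<Longrightarrow> \<bar>N l p - N l q\<bar> \<le> dist p q"
  using Cauchy_Schwarz_ineq2[of "n l" "p - q"] unit[of l]
  by (simp add: N_def inner_diff_right dist_norm)

lemma N_poly: "real_polynomial_function (N l)"
  unfolding N_def[abs_def] inner_real2 by (intro real_polynomial_function_intros)

lemma pd_N: "pdx (N l) = (\<lambda>p. n l $ 1)" "pdy (N l) = (\<lambda>p. n l $ 2)"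
proof -
  have "(N l has_derivative (\<lambda>h. n l $ 1 * h $ 1 + n l $ 2 * h $ 2)) (at p)" for p
    unfolding N_def[abs_def]
    by (auto intro!: derivative_eq_intros bounded_linear_imp_has_derivative[OF bounded_linear_vec_nth]
        simp: inner_real2)
  then show "pdx (N l) = (\<lambda>p. n l $ 1)" "pdy (N l) = (\<lambda>p. n l $ 2)"
    by (rule partial_derivativesI)+
qed

lemma N_continuous [continuous_intros]: "continuous_on S f \<Longrightarrow> continuous_on S (\<lambda>x. N l (f x))"
  unfolding N_def by (intro continuous_intros)

lemma G_poly: "real_polynomial_function G"
  unfolding G_def[abs_def] using fin by (intro real_polynomial_function_prod N_poly)

lemma prod_N_poly: "finite S \<Longrightarrow> real_polynomial_function (\<lambda>p. \<Prod>k\<in>S. N k p)"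
  by (intro real_polynomial_function_prod N_poly)

lemma G_eq_0: "G p = 0 \<longleftrightarrow> (\<exists>l\<in>A. N l p = 0)"
  using fin by (simp add: G_def)

lemma G_eq_0_Union: "G p = 0 \<longleftrightarrow> p \<in> \<Union>A"
  using G_eq_0 mem_line by auto

lemma G_split1: "l \<in> A \<Longrightarrow> G p = N l p * (\<Prod>k\<in>A - {l}. N k p)"
  using fin by (simp add: G_def prod.remove)

lemma G_split2:
  assumes "l \<in> A" "m \<in> A" "l \<noteq> m"
  shows "G p = N l p * (N m p * (\<Prod>k\<in>A - {l, m}. N k p))"
proof -
  have "A - {l} - {m} = A - {l, m}" by blast
  then show ?thesis
    using assms fin by (simp add: G_split1 prod.remove[of "A - {l}" m])
qed

definition cofactor :: "(real^2) set \<Rightarrow> (real^2) set \<Rightarrow> real^2 \<Rightarrow> real" where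
  "cofactor l m p = (\<Prod>k\<in>A - {l, m}. N k p)"

lemma crunode_lines:
  assumes "v \<in> crunodes A"
  obtains l m where "l \<in> A" "m \<in> A" "l \<noteq> m" "v \<in> l" "v \<in> m"
  using assms unfolding crunodes_def by blast

lemma third_line_nonzero:
  assumes "l \<in> A" "m \<in> A" "l \<noteq> m" "v \<in> l" "v \<in> m" "k \<in> A" "k \<noteq> l" "k \<noteq> m"
  shows "N k v \<noteq> 0"
  using no_triple[of l m k] assms mem_line[of k v] by auto

lemma crunode_unique:
  assumes "l \<in> A" "m \<in> A" "l \<noteq> m" "v \<in> l" "v \<in> m" "w \<in> l" "w \<in> m"
  shows "v = w"
proof -
  have "n l \<bullet> (w - v) = 0" "n m \<bullet> (w - v) = 0"
    using assms mem_line N_offset by metis+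
  then have "w - v = 0" using det2_inner_eq_0 transversal assms by blast
  then show ?thesis by simp
qed

lemma crunode_exists:
  assumes "l \<in> A" "m \<in> A" "l \<noteq> m"
  obtains v where "v \<in> l" "v \<in> m"
proof -
  obtain v where "n l \<bullet> v = b l" "n m \<bullet> v = b m"
    using det2_solve[OF transversal[OF assms]] by blast
  then have "v \<in> l" "v \<in> m" using mem_line assms by (simp_all add: N_def)
  then show thesis by (rule that)
qed

lemma finite_crunodes: "finite (crunodes A)"
proof -
  have "crunodes A \<subseteq> (\<lambda>(l, m). THE v. v \<in> l \<and> v \<in> m) ` (A \<times> A)"
  proof
    fix v assume "v \<in> crunodes A"
    then obtain l m where lm: "l \<in> A" "m \<in> A" "l \<noteq> m" "v \<in> l" "v \<in> m" by (rule crunode_lines)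
    have "(THE v. v \<in> l \<and> v \<in> m) = v"
      using crunode_unique[OF lm(1-3)] lm by (intro the_equality) auto
    then show "v \<in> (\<lambda>(l, m). THE v. v \<in> l \<and> v \<in> m) ` (A \<times> A)" using lm by force
  qed
  then show ?thesis by (rule finite_surj[rotated]) (use fin in simp)
qed

section \<open>Maxima of the curvature at the crunodes\<close>

lemma node_hessian:
  assumes lm: "l \<in> A" "m \<in> A" "l \<noteq> m" and v: "v \<in> l" "v \<in> m"
  shows "G v = 0" "pdx G v = 0" "pdy G v = 0"
    "pdx (pdx G) v = 2 * cofactor l m v * n l $ 1 * n m $ 1"
    "pdy (pdy G) v = 2 * cofactor l m v * n l $ 2 * n m $ 2"
    "pdx (pdy G) v = cofactor l m v * (n l $ 1 * n m $ 2 + n l $ 2 * n m $ 1)"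
    "pdy (pdx G) v = cofactor l m v * (n l $ 1 * n m $ 2 + n l $ 2 * n m $ 1)"
    "cofactor l m v \<noteq> 0"
proof -
  define g where "g = cofactor l m"
  have g: "real_polynomial_function g" unfolding g_def cofactor_def[abs_def] using fin by (intro prod_N_poly) auto
  have 0: "N l v = 0" "N m v = 0" using lm v mem_line by blast+
  have G: "G = (\<lambda>p. N l p * (N m p * g p))"
    using G_split2[OF lm] by (auto simp: g_def cofactor_def)
  note rules = pd_mult pd_add pd_const pd_N g N_poly real_polynomial_function_pdx real_polynomial_function_pdy
     real_polynomial_function_mult real_polynomial_function_add real_polynomial_function_const
  have x: "pdx G = (\<lambda>p. n l $ 1 * (N m p * g p) + N l p * (n m $ 1 * g p + N m p * pdx g p))"
    and y: "pdy G = (\<lambda>p. n l $ 2 * (N m p * g p) + N l p * (n m $ 2 * g p + N m p * pdy g p))"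
    unfolding G by (simp_all add: rules)
  show "G v = 0" by (simp add: G 0)
  show "pdx G v = 0" "pdy G v = 0" by (simp_all add: x y 0)
  show "pdx (pdx G) v = 2 * cofactor l m v * n l $ 1 * n m $ 1"
    "pdy (pdy G) v = 2 * cofactor l m v * n l $ 2 * n m $ 2"
    "pdx (pdy G) v = cofactor l m v * (n l $ 1 * n m $ 2 + n l $ 2 * n m $ 1)"
    "pdy (pdx G) v = cofactor l m v * (n l $ 1 * n m $ 2 + n l $ 2 * n m $ 1)"
    unfolding x y g_def[symmetric] by (simp_all add: rules 0 algebra_simps)
  show "cofactor l m v \<noteq> 0" using third_line_nonzero[OF lm v] fin by (auto simp: cofactor_def)
qed

lemma smooth_point_gradient:
  assumes "G p = 0" "p \<notin> crunodes A"
  shows "gradsq G p > 0"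
proof -
  obtain l where l: "l \<in> A" "N l p = 0" using assms G_eq_0 by blast
  define g where "g = (\<lambda>p. \<Prod>k\<in>A - {l}. N k p)"
  have g: "real_polynomial_function g" unfolding g_def using fin by (intro prod_N_poly) auto
  have "N k p \<noteq> 0" if "k \<in> A - {l}" for k
    using assms(2) l that mem_line by (auto simp: crunodes_def)
  then have g0: "g p \<noteq> 0" using fin by (auto simp: g_def)
  have G: "G = (\<lambda>p. N l p * g p)" using G_split1[OF l(1)] by (auto simp: g_def)
  have "gradsq G p = ((n l $ 1)\<^sup>2 + (n l $ 2)\<^sup>2) * (g p)\<^sup>2"
    unfolding G gradsq_def by (simp add: pd_mult pd_N g N_poly l algebra_simps power_mult_distrib)
  also have "(n l $ 1)\<^sup>2 + (n l $ 2)\<^sup>2 = (norm (n l))\<^sup>2"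
    by (simp only: power2_norm_eq_inner inner_real2) (simp add: power2_eq_square)
  finally show ?thesis using g0 unit[OF l(1)] by simp
qed

lemma cofactor_sign_along_ray:
  assumes T: "\<And>k t. k \<in> A - {l, m} \<Longrightarrow> 0 \<le> t \<Longrightarrow> t \<le> T \<Longrightarrow> N k (v + t *\<^sub>R a) \<noteq> 0"
    and t: "0 \<le> t" "t \<le> T"
  shows "cofactor l m v * cofactor l m (v + t *\<^sub>R a) > 0"
proof -
  have "cofactor l m v * cofactor l m (v + t *\<^sub>R a) = (\<Prod>k\<in>A - {l, m}. N k v * N k (v + t *\<^sub>R a))"
    by (simp add: cofactor_def prod.distrib)
  moreover have "N k v * N k (v + t *\<^sub>R a) > 0" if k: "k \<in> A - {l, m}" for k
    using affine_function_sign[of T "N k v" "n k \<bullet> a" t] T[OF k] t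
    by (simp add: N_add)
  then have "(\<Prod>k\<in>A - {l, m}. N k v * N k (v + t *\<^sub>R a)) > 0" by (intro prod_pos) blast
  ultimately show ?thesis by simp
qed

text \<open>
  At the crunode the Hessian of \<open>G\<close> is, up to the factor \<open>cofactor l m v\<close>, the symmetrised product of the two normals.
  Its determinant is negative since the lines are transversal.
\<close>

lemma eventually_node_ray_curvature:
  assumes H: "real_polynomial_function H" "H v \<noteq> 0"
    and lm: "l \<in> A" "m \<in> A" "l \<noteq> m" and v: "v \<in> l" "v \<in> m"
    and a: "n l \<bullet> a \<noteq> 0" "n m \<bullet> a \<noteq> 0"
    and T: "\<And>k t. k \<in> A - {l, m} \<Longrightarrow> 0 \<le> t \<Longrightarrow> t \<le> T \<Longrightarrow> N k (v + t *\<^sub>R a) \<noteq> 0"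
  shows "\<forall>\<^sub>F \<epsilon> in at 0. \<forall>t. 0 < t \<and> t \<le> T \<and> perturb G H \<epsilon> (v + t *\<^sub>R a) = 0 \<longrightarrow>
    sgn (\<epsilon> * H v) * level_curvature (perturb G H \<epsilon>) (v + t *\<^sub>R a) > M"
proof -
  define g where "g = cofactor l m"
  note hess = node_hessian[OF lm v, folded g_def]
  define q where "q = 2 * g v * (n l \<bullet> a) * (n m \<bullet> a)"
  have q0: "q \<noteq> 0" using a hess(8) by (simp add: q_def)
  have gpos: "g v * g (v + t *\<^sub>R a) > 0" if "0 \<le> t" "t \<le> T" for t
    unfolding g_def by (rule cofactor_sign_along_ray[OF T that])
  show ?thesis
  proof (rule eventually_ray_curvature_large[OF G_poly H(1) hess(1-3) H(2) hess(6,7,4,5) _ _ q0])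
    have "(2 * g v * n l $ 1 * n m $ 1) * (2 * g v * n l $ 2 * n m $ 2)
        - (g v * (n l $ 1 * n m $ 2 + n l $ 2 * n m $ 1))\<^sup>2 = - ((g v)\<^sup>2 * (det2 (n l) (n m))\<^sup>2)"
      by (simp add: det2_def power2_eq_square algebra_simps)
    also have "\<dots> < 0" using hess(8) transversal[OF lm] by simp
    finally show "(2 * g v * n l $ 1 * n m $ 1) * (2 * g v * n l $ 2 * n m $ 2)
        - (g v * (n l $ 1 * n m $ 2 + n l $ 2 * n m $ 1))\<^sup>2 < 0" .
    show "q = 2 * g v * n l $ 1 * n m $ 1 * (a $ 1)\<^sup>2
        + 2 * (g v * (n l $ 1 * n m $ 2 + n l $ 2 * n m $ 1)) * a $ 1 * a $ 2
        + 2 * g v * n l $ 2 * n m $ 2 * (a $ 2)\<^sup>2"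
      by (simp add: q_def inner_real2 power2_eq_square algebra_simps)
    fix t :: real assume t: "0 < t" "t \<le> T"
    have 0: "N l v = 0" "N m v = 0" using lm v mem_line by blast+
    have "q * G (v + t *\<^sub>R a) = 2 * (t * (n l \<bullet> a) * (n m \<bullet> a))\<^sup>2 * (g v * g (v + t *\<^sub>R a))"
      by (simp add: q_def G_split2[OF lm, folded cofactor_def] N_add 0 g_def[symmetric] power2_eq_square algebra_simps)
    then show "q * G (v + t *\<^sub>R a) > 0" using gpos[of t] t a by simp
  qed
qed

text \<open>
  Near the crunodes this is \<open>perturbation_regular_near_node\<close>; the rest of \<open>Z\<close> is compact and contains only smooth
  points of the arrangement.
\<close>

lemma eventually_regular:
  assumes H: "real_polynomial_function H" "\<forall>v\<in>crunodes A. H v \<noteq> 0" and Z: "compact Z"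
  shows "\<forall>\<^sub>F \<epsilon> in at 0. \<forall>p\<in>Z. perturb G H \<epsilon> p = 0 \<longrightarrow> gradsq (perturb G H \<epsilon>) p > 0"
proof -
  have "\<forall>v\<in>crunodes A. \<exists>\<rho>>0. \<forall>p\<in>ball v \<rho>. \<forall>\<epsilon>. \<epsilon> \<noteq> 0 \<longrightarrow> perturb G H \<epsilon> p = 0 \<longrightarrow> gradsq (perturb G H \<epsilon>) p > 0"
  proof
    fix v assume v: "v \<in> crunodes A"
    then obtain l m where lm: "l \<in> A" "m \<in> A" "l \<noteq> m" "v \<in> l" "v \<in> m" by (rule crunode_lines)
    have 0: "N l v = 0" "N m v = 0" using lm mem_line by blast+
    show "\<exists>\<rho>>0. \<forall>p\<in>ball v \<rho>. \<forall>\<epsilon>. \<epsilon> \<noteq> 0 \<longrightarrow> perturb G H \<epsilon> p = 0 \<longrightarrow> gradsq (perturb G H \<epsilon>) p > 0"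
    proof (rule perturbation_regular_near_node[OF _ H(1)])
      show "real_polynomial_function (\<lambda>p. \<Prod>k\<in>A - {l, m}. N k p)"
        using fin by (intro prod_N_poly) auto
      show "(\<Prod>k\<in>A - {l, m}. N k v) \<noteq> 0" using node_hessian(8)[OF lm] by (simp add: cofactor_def)
      show "H v \<noteq> 0" using H v by blast
      show "G p = n l \<bullet> (p - v) * (n m \<bullet> (p - v) * (\<Prod>k\<in>A - {l, m}. N k p))" for p
        using G_split2[OF lm(1-3), of p] N_offset[OF 0(1), of p] N_offset[OF 0(2), of p] by simp
    qed
  qed
  from bchoice[OF this] obtain \<rho> where \<rho>': "\<forall>v\<in>crunodes A. \<rho> v > 0 \<and>
    (\<forall>p\<in>ball v (\<rho> v). \<forall>\<epsilon>. \<epsilon> \<noteq> 0 \<longrightarrow> perturb G H \<epsilon> p = 0 \<longrightarrow> gradsq (perturb G H \<epsilon>) p > 0)" ..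
  have \<rho>: "\<rho> v > 0" if "v \<in> crunodes A" for v using \<rho>' that by blast
  let ?Z = "Z - (\<Union>v\<in>crunodes A. ball v (\<rho> v))"
  have "compact ?Z" using Z by (intro compact_diff) auto
  moreover have "gradsq G p > 0" if "p \<in> ?Z" "G p = 0" for p
    using smooth_point_gradient[OF that(2)] that \<rho> by force
  ultimately have "\<exists>M. \<forall>\<^sub>F \<epsilon> in at 0. \<forall>p\<in>?Z. perturb G H \<epsilon> p = 0 \<longrightarrow>
     gradsq (perturb G H \<epsilon>) p > 0 \<and> \<bar>level_curvature (perturb G H \<epsilon>) p\<bar> \<le> M"
    by (rule eventually_regular_bounded_curvature[OF G_poly H(1)])
  then obtain M where "\<forall>\<^sub>F \<epsilon> in at 0. \<forall>p\<in>?Z. perturb G H \<epsilon> p = 0 \<longrightarrow>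
     gradsq (perturb G H \<epsilon>) p > 0 \<and> \<bar>level_curvature (perturb G H \<epsilon>) p\<bar> \<le> M" ..
  moreover have "\<forall>\<^sub>F \<epsilon> in at 0. \<epsilon> \<noteq> (0::real)" by (simp add: eventually_neq_at_within)
  ultimately show ?thesis
  proof eventually_elim
    case (elim \<epsilon>)
    then show ?case using \<rho>' by blast
  qed
qed

lemma eventually_bounded_curvature:
  assumes H: "real_polynomial_function H" and Z: "compact Z" "Z \<inter> crunodes A = {}"
  shows "\<exists>M. \<forall>\<^sub>F \<epsilon> in at 0. \<forall>p\<in>Z. perturb G H \<epsilon> p = 0 \<longrightarrow> \<bar>level_curvature (perturb G H \<epsilon>) p\<bar> \<le> M"
proof -
  have "gradsq G p > 0" if "p \<in> Z" "G p = 0" for p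
    using smooth_point_gradient[OF that(2)] that Z by blast
  then have "\<exists>M. \<forall>\<^sub>F \<epsilon> in at 0. \<forall>p\<in>Z. perturb G H \<epsilon> p = 0 \<longrightarrow>
     gradsq (perturb G H \<epsilon>) p > 0 \<and> \<bar>level_curvature (perturb G H \<epsilon>) p\<bar> \<le> M"
    by (rule eventually_regular_bounded_curvature[OF G_poly H Z(1)])
  then obtain M where "\<forall>\<^sub>F \<epsilon> in at 0. \<forall>p\<in>Z. perturb G H \<epsilon> p = 0 \<longrightarrow>
     gradsq (perturb G H \<epsilon>) p > 0 \<and> \<bar>level_curvature (perturb G H \<epsilon>) p\<bar> \<le> M" ..
  then show ?thesis by (intro exI[of _ M]) (auto elim: eventually_mono)
qed

text \<open>
  One of the two pairs of opposite sectors at the crunode \<open>v\<close> contains the two branches, and \<open>\<sigma>\<close> selects one of them.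
  The curve does not meet the lines bounding the sector, its curvature is bounded on the circle of radius \<open>s\<close>,
  and it is as large as desired on a ray in the sector. So it has an interior maximum.
\<close>

lemma eventually_cusp_on_node_branch:
  assumes H: "real_polynomial_function H" "\<forall>v\<in>crunodes A. H v \<noteq> 0"
    and lm: "l \<in> A" "m \<in> A" "l \<noteq> m" and v: "v \<in> l" "v \<in> m"
    and s: "s > 0" "\<And>k p. k \<in> A - {l, m} \<Longrightarrow> p \<in> cball v s \<Longrightarrow> N k p \<noteq> 0"
      "\<And>p. p \<in> cball v s \<Longrightarrow> H p \<noteq> 0"
    and \<sigma>: "\<sigma> = 1 \<or> \<sigma> = -1"
  shows "\<forall>\<^sub>F \<epsilon> in at 0. \<exists>p\<in>ball v s. \<sigma> * N l p > 0 \<and> p \<in> evolute_cusps {q. perturb G H \<epsilon> q = 0} \<and>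
     sgn (\<epsilon> * H v) * level_curvature (perturb G H \<epsilon>) p > M"
proof -
  define g where "g = cofactor l m"
  have g0: "g p \<noteq> 0" if "p \<in> cball v s" for p using s(2) that fin by (auto simp: g_def cofactor_def)
  have 0: "N l v = 0" "N m v = 0" using lm v mem_line by blast+
  have vc: "v \<in> crunodes A" using lm v by (auto simp: crunodes_def)
  \<comment> \<open>\<open>\<kappa>\<close> is the sign of \<open>N l * N m\<close> in the sectors with the branches.\<close>
  have one: "\<forall>\<^sub>F \<epsilon> in at 0. \<kappa> * \<epsilon> * H v * g v < 0 \<longrightarrow>
     (\<exists>p\<in>ball v s. \<sigma> * N l p > 0 \<and> p \<in> evolute_cusps {q. perturb G H \<epsilon> q = 0} \<and>
     sgn (\<epsilon> * H v) * level_curvature (perturb G H \<epsilon>) p > M)" if \<kappa>: "\<kappa> = 1 \<or> \<kappa> = -1" for \<kappa>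
  proof -
    obtain a where a: "n l \<bullet> a = \<sigma>" "n m \<bullet> a = \<kappa> * \<sigma>"
      using det2_solve[OF transversal[OF lm]] by blast
    have a0: "a \<noteq> 0" using a \<sigma> by auto
    define T where "T = s / (2 * norm a)"
    have T: "T > 0" using s a0 by (simp add: T_def)
    have ray: "v + t *\<^sub>R a \<in> ball v s" if "0 \<le> t" "t \<le> T" for t
    proof -
      have "norm (t *\<^sub>R a) \<le> T * norm a" using that by (simp add: mult_right_mono)
      also have "\<dots> = s / 2" using a0 by (simp add: T_def)
      finally show ?thesis using s(1) by (simp add: dist_norm)
    qed
    define B where "B = cball v s \<inter> {p. \<sigma> * N l p \<ge> 0} \<inter> {p. \<kappa> * \<sigma> * N m p \<ge> 0}"
    define U where "U = ball v s \<inter> {p. \<sigma> * N l p > 0} \<inter> {p. \<kappa> * \<sigma> * N m p > 0}"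
    have B: "compact B"
      unfolding B_def by (intro compact_Int_closed compact_cball closed_Collect_le continuous_intros)
    have U: "open U"
      unfolding U_def by (intro open_Int open_ball open_Collect_less continuous_intros)
    have UB: "U \<subseteq> B" unfolding U_def B_def by auto
    have sph: "sphere v s \<inter> crunodes A = {}"
    proof (rule ccontr)
      assume "sphere v s \<inter> crunodes A \<noteq> {}"
      then obtain w where w: "w \<in> sphere v s" "w \<in> crunodes A" by blast
      then obtain k k' where k: "k \<in> A" "k' \<in> A" "k \<noteq> k'" "w \<in> k" "w \<in> k'" using crunode_lines by metis
      have "w \<in> cball v s" using w by auto
      then have "k \<in> {l, m}" "k' \<in> {l, m}" using s(2) k mem_line by blast+
      then have "w = v" using crunode_unique[OF lm] k v by auto
      then show False using w s by simp
    qed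
    obtain M1 where M1: "\<forall>\<^sub>F \<epsilon> in at 0. \<forall>p\<in>sphere v s. perturb G H \<epsilon> p = 0 \<longrightarrow> \<bar>level_curvature (perturb G H \<epsilon>) p\<bar> \<le> M1"
      using eventually_bounded_curvature[OF H(1) compact_sphere sph] ..
    have rayK: "\<forall>\<^sub>F \<epsilon> in at 0. \<forall>t. 0 < t \<and> t \<le> T \<and> perturb G H \<epsilon> (v + t *\<^sub>R a) = 0 \<longrightarrow>
      sgn (\<epsilon> * H v) * level_curvature (perturb G H \<epsilon>) (v + t *\<^sub>R a) > max M M1"
    proof (rule eventually_node_ray_curvature[OF H(1) _ lm v])
      show "H v \<noteq> 0" using H(2) vc by blast
      show "n l \<bullet> a \<noteq> 0" "n m \<bullet> a \<noteq> 0" using a \<sigma> \<kappa> by auto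
      show "N k (v + t *\<^sub>R a) \<noteq> 0" if "k \<in> A - {l, m}" "0 \<le> t" "t \<le> T" for k t
        using s(2)[OF that(1)] ray[OF that(2,3)] by auto
    qed
    have GT: "G (v + t *\<^sub>R a) = \<kappa> * t\<^sup>2 * g (v + t *\<^sub>R a)" for t
      using \<sigma> by (auto simp: G_split2[OF lm, folded cofactor_def] g_def[symmetric] N_add 0 a power2_eq_square)
    have gT: "g v * g (v + T *\<^sub>R a) > 0"
      unfolding g_def
    proof (rule cofactor_sign_along_ray)
      show "N k (v + t *\<^sub>R a) \<noteq> 0" if "k \<in> A - {l, m}" "0 \<le> t" "t \<le> T" for k t
        using s(2)[OF that(1)] ray[OF that(2,3)] by auto
    qed (use T in auto)
    have "G (v + T *\<^sub>R a) \<noteq> 0" unfolding GT using gT T \<kappa> by auto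
    then have "\<forall>\<^sub>F \<epsilon> in at 0. \<forall>p\<in>{v + T *\<^sub>R a}. \<bar>\<epsilon> * H p\<bar> < \<bar>G p\<bar>"
      by (intro eventually_perturbation_smaller) auto
    moreover have "\<forall>\<^sub>F \<epsilon> in at 0. \<epsilon> \<noteq> (0::real)" by (simp add: eventually_neq_at_within)
    moreover note M1 rayK eventually_regular[OF H B]
    ultimately show ?thesis
    proof eventually_elim
      case (elim \<epsilon>)
      show ?case
      proof
        assume neg: "\<kappa> * \<epsilon> * H v * g v < 0"
        let ?F = "perturb G H \<epsilon>" and ?\<phi> = "\<lambda>t. perturb G H \<epsilon> (v + t *\<^sub>R a)"
        have cont: "continuous_on {0..T} ?\<phi>"
          using real_polynomial_function_perturb[OF G_poly H(1)]
          by (intro continuous_on_compose2[OF real_polynomial_function_continuous_on[of ?F UNIV]])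
            (auto intro!: continuous_intros)
        have \<phi>0: "?\<phi> 0 = \<epsilon> * H v" by (simp add: G_split1[OF lm(1)] 0)
        have "?\<phi> 0 * ?\<phi> T < 0"
        proof -
          have "\<epsilon> * H v * G (v + T *\<^sub>R a) * (g v)\<^sup>2 = (\<kappa> * \<epsilon> * H v * g v) * (T\<^sup>2 * (g v * g (v + T *\<^sub>R a)))"
            by (simp add: GT power2_eq_square)
          also have "\<dots> < 0" using neg gT T by (simp add: mult_neg_pos)
          finally have 1: "\<epsilon> * H v * G (v + T *\<^sub>R a) < 0" by (simp add: mult_less_0_iff not_less)
          have "\<bar>\<epsilon> * H (v + T *\<^sub>R a)\<bar> < \<bar>G (v + T *\<^sub>R a)\<bar>" using elim by blast
          then have "sgn (?\<phi> T) = sgn (G (v + T *\<^sub>R a))" by (auto simp: sgn_if abs_if split: if_splits)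
          then show ?thesis unfolding \<phi>0 using 1 by (auto simp: mult_less_0_iff sgn_if split: if_splits)
        qed
        then obtain t where t: "0 \<le> t" "t \<le> T" "?\<phi> t = 0"
          using IVT'[of ?\<phi> 0 0 T] IVT2'[of ?\<phi> T 0 0] cont T by (auto simp: mult_less_0_iff)
        have "t \<noteq> 0" using t(3) \<phi>0 neg by auto
        then have t0: "t > 0" using t by simp
        let ?c = "v + t *\<^sub>R a" and ?s = "sgn (\<epsilon> * H v)"
        have Kc: "?s * level_curvature ?F ?c > max M M1" using elim t t0 by blast
        have sgn: "?s = 1 \<or> ?s = -1" using neg by (auto simp: sgn_if)
        have cU: "?c \<in> U"
          using ray[OF t(1,2)] t0 \<sigma> \<kappa> by (auto simp: U_def N_add 0 a)
        have "\<exists>p\<in>U. p \<in> evolute_cusps {q. ?F q = 0} \<and> ?s * level_curvature ?F p \<ge> ?s * level_curvature ?F ?c"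
        proof (rule extremal_cusp_in_region[OF _ B U UB sgn])
          show "real_polynomial_function ?F" using G_poly H by blast
          show "?c \<in> B" using cU UB by blast
          show "?F ?c = 0" by (rule t(3))
          show "gradsq ?F p > 0" if "p \<in> B" "?F p = 0" for p using elim that by blast
          show "?s * level_curvature ?F p < ?s * level_curvature ?F ?c" if p: "p \<in> B - U" "?F p = 0" for p
          proof -
            have pc: "p \<in> cball v s" using p by (auto simp: B_def)
            have "G p \<noteq> 0" using p(2) s(3)[OF pc] elim by auto
            then have "N l p \<noteq> 0" "N m p \<noteq> 0" using G_eq_0 lm by auto
            then have "p \<in> sphere v s" using p \<sigma> \<kappa> unfolding B_def U_def by (auto simp: dist_commute)
            then have "\<bar>level_curvature ?F p\<bar> \<le> M1" using elim p by blast
            then have "?s * level_curvature ?F p \<le> M1" using sgn by auto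
            then show ?thesis using Kc by simp
          qed
        qed
        then show "\<exists>p\<in>ball v s. \<sigma> * N l p > 0 \<and> p \<in> evolute_cusps {q. ?F q = 0} \<and> ?s * level_curvature ?F p > M"
          using Kc unfolding U_def by fastforce
      qed
    qed
  qed
  have "\<forall>\<^sub>F \<epsilon> in at 0. \<epsilon> \<noteq> (0::real)" by (simp add: eventually_neq_at_within)
  with one[OF disjI1[OF refl]] one[OF disjI2[OF refl]] show ?thesis
  proof eventually_elim
    case (elim \<epsilon>)
    have "H v \<noteq> 0" using H(2) vc by blast
    then have "\<epsilon> * H v * g v \<noteq> 0" using elim(3) g0[of v] s(1) by simp
    then have "1 * \<epsilon> * H v * g v < 0 \<or> -1 * \<epsilon> * H v * g v < 0" by linarith
    then show ?case by (rule disjE) (erule mp[OF elim(1)], erule mp[OF elim(2)])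
  qed
qed

end

lemma eventually_cball_avoids:
  fixes v :: "'a::metric_space"
  assumes "closed C" "v \<notin> C"
  shows "\<forall>\<^sub>F s in at_right 0. cball v s \<inter> C = {}"
proof -
  obtain \<rho> where \<rho>: "\<rho> > 0" "ball v \<rho> \<subseteq> - C"
    using open_contains_ball[of "- C"] assms by auto
  have "\<forall>\<^sub>F s in at_right 0. s < \<rho>" using \<rho>(1) by (rule eventually_at_right_real[THEN eventually_mono]) auto
  then show ?thesis
  proof eventually_elim
    case (elim s)
    then have "cball v s \<subseteq> ball v \<rho>" by auto
    then show ?case using \<rho>(2) by blast
  qed
qed

lemma eventually_mult_less_at_right:
  fixes c C :: real
  assumes "c > 0"
  shows "\<forall>\<^sub>F h in at_right 0. h * C < c"
proof -
  have "((\<lambda>h. h * C) \<longlongrightarrow> 0 * C) (at_right 0)" by (intro tendsto_intros)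
  then show ?thesis using order_tendstoD(2)[of "\<lambda>h. h * C" "0 * C" "at_right 0" c] assms by simp
qed

lemma eventually_at_right_0_pos: "\<forall>\<^sub>F h in at_right 0. (h::real) > 0"
  by (simp add: eventually_at_right_less)

context line_arrangement begin

lemma closed_line: "l \<in> A \<Longrightarrow> closed l"
  using closed_hyperplane[of "n l" "b l"] line[of l] by metis

text \<open>
  The lines \<open>\<bar>N l\<bar> = \<bar>N m\<bar>\<close> are the two bisectors at \<open>v\<close>. They will bound the region around an edge on \<open>l\<close>.
\<close>

lemma eventually_diagonal_curvature_large:
  assumes H: "real_polynomial_function H" "H v \<noteq> 0"
    and lm: "l \<in> A" "m \<in> A" "l \<noteq> m" and v: "v \<in> l" "v \<in> m" and s: "s = 1 \<or> s = -1"
  shows "\<forall>\<^sub>F h in at_right 0. \<forall>M. \<forall>\<^sub>F \<epsilon> in at 0. \<forall>p.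
     perturb G H \<epsilon> p = 0 \<and> \<bar>N l p\<bar> \<le> h \<and> s * N m p = \<bar>N l p\<bar> \<longrightarrow>
     sgn (\<epsilon> * H v) * level_curvature (perturb G H \<epsilon>) p > M"
proof -
  have 0: "N l v = 0" "N m v = 0" using lm v mem_line by blast+
  have "\<exists>a. n l \<bullet> a = \<rho> \<and> n m \<bullet> a = s" for \<rho>
    using det2_solve[OF transversal[OF lm]] by blast
  \<comment> \<open>The directions of the two rays, one on either side of \<open>l\<close>.\<close>
  then obtain a where a: "\<And>\<rho>. n l \<bullet> a \<rho> = \<rho>" "\<And>\<rho>. n m \<bullet> a \<rho> = s" by metis
  have ev: "\<forall>\<^sub>F h in at_right 0. \<forall>k\<in>A - {l, m}. h * norm (a \<rho>) < \<bar>N k v\<bar>" for \<rho>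
    using third_line_nonzero[OF lm v] fin
    by (intro eventually_ball_finite ballI eventually_mult_less_at_right) auto
  from ev[of 1] ev[of "-1"] show ?thesis
  proof eventually_elim
    case (elim h)
    have ray: "\<forall>\<^sub>F \<epsilon> in at 0. \<forall>t. 0 < t \<and> t \<le> h \<and> perturb G H \<epsilon> (v + t *\<^sub>R a \<rho>) = 0 \<longrightarrow>
       sgn (\<epsilon> * H v) * level_curvature (perturb G H \<epsilon>) (v + t *\<^sub>R a \<rho>) > M"
      if \<rho>: "\<rho> = 1 \<or> \<rho> = -1" for M \<rho>
    proof (rule eventually_node_ray_curvature[OF H lm v])
      show "n l \<bullet> a \<rho> \<noteq> 0" "n m \<bullet> a \<rho> \<noteq> 0" using a \<rho> s by auto
      fix k t assume k: "k \<in> A - {l, m}" and t: "0 \<le> t" "t \<le> h"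
      have "\<bar>N k (v + t *\<^sub>R a \<rho>) - N k v\<bar> \<le> t * norm (a \<rho>)"
        using N_lipschitz[of k "v + t *\<^sub>R a \<rho>" v] k t by (simp add: dist_norm)
      also have "\<dots> \<le> h * norm (a \<rho>)" using t by (simp add: mult_right_mono)
      also have "\<dots> < \<bar>N k v\<bar>" using elim k \<rho> by blast
      finally show "N k (v + t *\<^sub>R a \<rho>) \<noteq> 0" by auto
    qed
    show ?case
    proof
      fix M
      have "\<forall>\<^sub>F \<epsilon> in at 0. \<epsilon> \<noteq> (0::real)" by (simp add: eventually_neq_at_within)
      with ray[OF disjI1[OF refl], of M] ray[OF disjI2[OF refl], of M]
      show "\<forall>\<^sub>F \<epsilon> in at 0. \<forall>p. perturb G H \<epsilon> p = 0 \<and> \<bar>N l p\<bar> \<le> h \<and> s * N m p = \<bar>N l p\<bar> \<longrightarrow>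
        sgn (\<epsilon> * H v) * level_curvature (perturb G H \<epsilon>) p > M"
      proof eventually_elim
        case (elim \<epsilon>)
        show ?case
        proof (intro allI impI, elim conjE)
          fix p assume p: "perturb G H \<epsilon> p = 0" "\<bar>N l p\<bar> \<le> h" "s * N m p = \<bar>N l p\<bar>"
          define t where "t = \<bar>N l p\<bar>"
          define \<rho> :: real where "\<rho> = (if N l p \<ge> 0 then 1 else -1)"
          have "n l \<bullet> (p - v) = \<rho> * t" using N_offset[OF 0(1), of p] by (auto simp: \<rho>_def t_def)
          moreover have "n m \<bullet> (p - v) = s * t" using N_offset[OF 0(2), of p] p(3) s by (auto simp: t_def)
          ultimately have "n l \<bullet> (p - v - t *\<^sub>R a \<rho>) = 0" "n m \<bullet> (p - v - t *\<^sub>R a \<rho>) = 0"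
            by (simp_all add: inner_diff_right a)
          then have "p - v - t *\<^sub>R a \<rho> = 0" using det2_inner_eq_0 transversal[OF lm] by blast
          then have pe: "p = v + t *\<^sub>R a \<rho>" by (simp add: algebra_simps)
          have "t \<noteq> 0"
          proof
            assume "t = 0"
            then have "p = v" using pe by simp
            then show False using p(1) G_split1[OF lm(1), of v] 0 H(2) elim(3) by simp
          qed
          then have "0 < t" "t \<le> h" using p(2) by (auto simp: t_def)
          moreover have "\<rho> = 1 \<or> \<rho> = -1" by (simp add: \<rho>_def)
          ultimately show "sgn (\<epsilon> * H v) * level_curvature (perturb G H \<epsilon>) p > M"
            using elim(1,2) p(1) unfolding pe by blast
        qed
      qed
    qed
  qed
qed

end

section \<open>Minima of the curvature along bounded edges\<close>

text \<open>
  The edge lies on \<open>l\<close> and joins \<open>v\<close>, where \<open>mv\<close> crosses \<open>l\<close>, to \<open>w\<close>, where \<open>mw\<close> does. The situation is symmetric in the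
  two ends, so that facts about \<open>v\<close> can be transferred to \<open>w\<close>.
\<close>

locale bounded_edge = line_arrangement +
  fixes l :: "(real^2) set" and v w :: "real^2" and mv mw :: "(real^2) set"
  assumes lines: "l \<in> A" "mv \<in> A" "mw \<in> A" "mv \<noteq> l" "mw \<noteq> l"
    and ends: "v \<in> l" "v \<in> mv" "w \<in> l" "w \<in> mw" "v \<noteq> w"
    and interior: "p \<in> open_segment v w \<Longrightarrow> p \<notin> crunodes A"
begin

lemma swap: "bounded_edge A n b l w v mw mv"
  using lines ends interior by unfold_locales (auto simp: open_segment_commute)

definition mid :: "real^2" where "mid = midpoint v w"

text \<open>
  Except for \<open>N l\<close>, the forms have no zero on the edge; \<open>sg k\<close> is the sign of \<open>N k\<close> on all of it.
\<close>

definition sg :: "(real^2) set \<Rightarrow> real" where "sg k = sgn (N k mid)"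

lemma mid_in: "mid \<in> open_segment v w"
  using ends by (simp add: mid_def midpoint_in_open_segment)

lemma N_at_ends: "N l v = 0" "N l w = 0" "N mv v = 0" "N mw w = 0"
  using lines ends mem_line by blast+

lemma N_l_segment: "p \<in> closed_segment v w \<Longrightarrow> N l p = 0"
  using N_convex_combination[of l _ v w] N_at_ends by (auto simp: in_segment)

lemma segment_on_line: "closed_segment v w \<subseteq> l"
  using N_l_segment lines(1) mem_line by blast

lemma N_nonzero_on_edge: "k \<in> A - {l} \<Longrightarrow> p \<in> open_segment v w \<Longrightarrow> N k p \<noteq> 0"
  using interior[of p] segment_on_line mem_line[of k p] lines(1) open_closed_segment[of p v w]
  unfolding crunodes_def by blast

lemma sg_pos_on_edge:
  assumes k: "k \<in> A - {l}" and p: "p \<in> open_segment v w"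
  shows "sg k * N k p > 0"
proof -
  have "N k mid + t * (N k p - N k mid) \<noteq> 0" if "0 \<le> t" "t \<le> 1" for t
  proof -
    have "(1 - t) *\<^sub>R mid + t *\<^sub>R p \<in> open_segment v w"
      using that p mid_in convex_open_segment[of v w] by (simp add: convex_alt)
    from N_nonzero_on_edge[OF k this, unfolded N_convex_combination] show ?thesis
      by (simp add: algebra_simps)
  qed
  from affine_function_sign[OF this, of 1 1] have "N k mid * N k p > 0" by simp
  then show ?thesis by (auto simp: sg_def sgn_if zero_less_mult_iff)
qed

lemma sg_cases: "k \<in> A - {l} \<Longrightarrow> sg k = 1 \<or> sg k = -1"
  using N_nonzero_on_edge[OF _ mid_in, of k] by (auto simp: sg_def sgn_if)

lemma sg_nonneg_on_segment:
  assumes k: "k \<in> A - {l}" and p: "p \<in> closed_segment v w"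
  shows "sg k * N k p \<ge> 0"
proof -
  have "closed {p. sg k * N k p \<ge> 0}" by (intro closed_Collect_le continuous_intros)
  moreover have "open_segment v w \<subseteq> {p. sg k * N k p \<ge> 0}"
    using sg_pos_on_edge[OF k] by force
  ultimately have "closure (open_segment v w) \<subseteq> {p. sg k * N k p \<ge> 0}" by (rule closure_minimal[rotated])
  then show ?thesis using p ends by (auto simp: closure_open_segment)
qed

lemma mv_neq_mw: "mv \<noteq> mw"
  using crunode_unique[of l mv v w] lines ends by blast

lemma sg_pos_at_v: "k \<in> A - {l, mv} \<Longrightarrow> sg k * N k v > 0"
  using sg_nonneg_on_segment[of k v] third_line_nonzero[of l mv v k] lines ends sg_cases[of k]
  by (fastforce simp: less_le)

lemma sg_pos_at_w: "k \<in> A - {l, mw} \<Longrightarrow> sg k * N k w > 0"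
  using sg_nonneg_on_segment[of k w] third_line_nonzero[of l mw w k] lines ends sg_cases[of k]
  by (fastforce simp: less_le)

lemma sg_mv_w: "sg mv * N mv w > 0" and sg_mw_v: "sg mw * N mw v > 0"
  using sg_pos_at_w[of mv] sg_pos_at_v[of mw] mv_neq_mw lines by auto

lemma sg_pos_on_segment:
  assumes "k \<in> A - {l, mv, mw}" "p \<in> closed_segment v w"
  shows "sg k * N k p > 0"
  using assms sg_pos_at_v[of k] sg_pos_at_w[of k] sg_pos_on_edge[of k p]
  by (auto simp: open_segment_def)

lemma on_line_param:
  assumes "N l p = 0"
  obtains \<tau> where "p = v + \<tau> *\<^sub>R (w - v)" "N mv p = \<tau> * N mv w" "N mw p = (1 - \<tau>) * N mw v"
proof -
  have "n l \<bullet> (p - v) = 0" "n l \<bullet> (w - v) = 0"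
    using N_offset[OF N_at_ends(1)] assms N_at_ends by metis+
  moreover have "n l \<noteq> 0" using unit[OF lines(1)] by auto
  ultimately obtain \<tau> where "p - v = \<tau> *\<^sub>R (w - v)"
    using orthogonal_imp_parallel[of "n l" "w - v" "p - v"] ends(5) by auto
  then have p: "p = (1 - \<tau>) *\<^sub>R v + \<tau> *\<^sub>R w" by (simp add: algebra_simps)
  show thesis
    by (rule that[of \<tau>]) (simp_all add: p N_convex_combination N_at_ends, simp add: algebra_simps)
qed

lemma in_edge:
  assumes "N l p = 0" "sg mv * N mv p > 0" "sg mw * N mw p > 0"
  shows "p \<in> open_segment v w"
proof -
  obtain \<tau> where \<tau>: "p = v + \<tau> *\<^sub>R (w - v)" "N mv p = \<tau> * N mv w" "N mw p = (1 - \<tau>) * N mw v"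
    using on_line_param[OF assms(1)] by blast
  have "\<tau> * (sg mv * N mv w) > 0" "(1 - \<tau>) * (sg mw * N mw v) > 0"
    using assms \<tau> by (simp_all add: mult.left_commute)
  then have "0 < \<tau>" "\<tau> < 1" using sg_mv_w sg_mw_v by (auto simp: zero_less_mult_iff)
  then show ?thesis using ends by (auto simp: in_segment \<tau>(1) algebra_simps intro!: exI[of _ \<tau>])
qed

lemma edge_eq: "open_segment v w = {p \<in> l. \<forall>k\<in>A - {l}. sg k * N k p > 0}"
proof
  show "open_segment v w \<subseteq> {p \<in> l. \<forall>k\<in>A - {l}. sg k * N k p > 0}"
    using sg_pos_on_edge segment_on_line open_closed_segment by blast
  show "{p \<in> l. \<forall>k\<in>A - {l}. sg k * N k p > 0} \<subseteq> open_segment v w"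
    using in_edge mem_line lines by auto
qed

text \<open>
  Projecting parallel to \<open>mv\<close> onto \<open>l\<close> moves a point by a multiple of \<open>N l\<close>. If the projection overshoots \<open>w\<close>, then the
  sign of \<open>N mw\<close> bounds the excess by another such multiple.
\<close>

lemma dist_edge_le:
  obtains C where "C > 0" "\<And>p. sg mv * N mv p \<ge> 0 \<Longrightarrow> sg mw * N mw p \<ge> 0 \<Longrightarrow>
    \<exists>z\<in>closed_segment v w. dist p z \<le> C * \<bar>N l p\<bar>"
proof -
  obtain c where c: "n l \<bullet> c = 1" "n mv \<bullet> c = 0"
    using det2_solve[OF transversal[OF lines(1,2)], of 1 0] lines by blast
  define C where "C = norm c * (1 + norm (w - v) / (sg mw * N mw v))"
  have c0: "norm c > 0" using c by auto
  have C: "C > 0" unfolding C_def using c0 sg_mw_v by (intro mult_pos_pos add_pos_nonneg) auto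
  show thesis
  proof (rule that[OF C])
    fix p assume p: "sg mv * N mv p \<ge> 0" "sg mw * N mw p \<ge> 0"
    define z where "z = p - N l p *\<^sub>R c"
    have z: "N l z = 0" "N mv z = N mv p" and pz: "dist p z = \<bar>N l p\<bar> * norm c"
      using N_add[of l z "N l p *\<^sub>R c"] N_add[of mv z "N l p *\<^sub>R c"] c by (simp_all add: z_def dist_norm)
    obtain \<tau> where \<tau>: "z = v + \<tau> *\<^sub>R (w - v)" "N mv z = \<tau> * N mv w" "N mw z = (1 - \<tau>) * N mw v"
      using on_line_param[OF z(1)] by blast
    have "\<tau> * (sg mv * N mv w) = sg mv * N mv z" unfolding \<tau>(2) by (rule mult.left_commute)
    also have "\<dots> \<ge> 0" using p(1) z(2) by simp
    finally have "\<tau> * (sg mv * N mv w) \<ge> 0" .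
    then have \<tau>0: "\<tau> \<ge> 0" using sg_mv_w by (simp add: zero_le_mult_iff)
    show "\<exists>z\<in>closed_segment v w. dist p z \<le> C * \<bar>N l p\<bar>"
    proof (cases "\<tau> \<le> 1")
      case True
      have "z \<in> closed_segment v w"
        using \<tau>0 True by (auto simp: in_segment \<tau>(1) algebra_simps intro!: exI[of _ \<tau>])
      moreover have "norm c \<le> C" unfolding C_def using c0 sg_mw_v by simp
      ultimately show ?thesis unfolding pz[symmetric]
        by (intro bexI[of _ z]) (simp_all add: pz mult.commute mult_right_mono)
    next
      case False
      have "(\<tau> - 1) * (sg mw * N mw v) = - sg mw * N mw z" by (simp add: \<tau>(3) algebra_simps)
      also have "\<dots> \<le> sg mw * N mw p - sg mw * N mw z" using p(2) by simp
      also have "\<dots> \<le> \<bar>N mw p - N mw z\<bar>"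
        using sg_cases[of mw] lines by auto
      also have "\<dots> \<le> \<bar>N l p\<bar> * norm c" using N_lipschitz[OF lines(3), of p z] pz by simp
      finally have "\<tau> - 1 \<le> \<bar>N l p\<bar> * norm c / (sg mw * N mw v)" using sg_mw_v by (simp add: pos_le_divide_eq)
      then have "dist z w \<le> \<bar>N l p\<bar> * norm c / (sg mw * N mw v) * norm (w - v)"
      proof -
        have "z - w = (\<tau> - 1) *\<^sub>R (w - v)" by (simp add: \<tau>(1) algebra_simps)
        then have "dist z w = (\<tau> - 1) * norm (w - v)" using False by (simp add: dist_norm)
        then show ?thesis using \<open>\<tau> - 1 \<le> _\<close> by (simp only: mult_right_mono norm_ge_zero)
      qed
      then have "dist p w \<le> \<bar>N l p\<bar> * norm c + \<bar>N l p\<bar> * norm c / (sg mw * N mw v) * norm (w - v)"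
        using dist_triangle[of p w z] pz by linarith
      also have "\<dots> = C * \<bar>N l p\<bar>" by (simp add: C_def algebra_simps)
      finally show ?thesis by (intro bexI[of _ w]) auto
    qed
  qed
qed

text \<open>
  The points at distance at most \<open>h\<close> from \<open>l\<close> that lie, for every other line, on the same side as the edge and not
  closer to it than to \<open>l\<close>. At the ends of the edge the region is bounded by the bisectors of \<open>l\<close> and the crossing line. A point in the interior
  determines \<open>l\<close> as its unique nearest line, and the edge by the signs of the other forms.
\<close>

definition region :: "real \<Rightarrow> (real^2) set" where
  "region h = {p. \<bar>N l p\<bar> \<le> h \<and> (\<forall>k\<in>A - {l}. \<bar>N l p\<bar> \<le> sg k * N k p)}"

definition inner_region :: "real \<Rightarrow> (real^2) set" where
  "inner_region h = {p. \<bar>N l p\<bar> < h \<and> (\<forall>k\<in>A - {l}. \<bar>N l p\<bar> < sg k * N k p)}"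

lemma inner_region_subset: "inner_region h \<subseteq> region h"
  by (auto simp: inner_region_def region_def intro: less_imp_le)

lemma open_inner_region: "open (inner_region h)"
proof -
  have "inner_region h = {p. \<bar>N l p\<bar> < h} \<inter> (\<Inter>k\<in>A - {l}. {p. \<bar>N l p\<bar> < sg k * N k p})"
    by (auto simp: inner_region_def)
  then show ?thesis using fin
    by (auto intro!: open_Int open_INT open_Collect_less continuous_intros)
qed

lemma compact_region: "compact (region h)"
proof -
  have "region h = {p. \<bar>N l p\<bar> \<le> h} \<inter> (\<Inter>k\<in>A - {l}. {p. \<bar>N l p\<bar> \<le> sg k * N k p})"
    by (auto simp: region_def)
  then have "closed (region h)"
    by (auto intro!: closed_Int closed_INT closed_Collect_le continuous_intros)
  moreover have "bounded (region h)"
  proof -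
    obtain C where C: "C > 0" "\<And>p. sg mv * N mv p \<ge> 0 \<Longrightarrow> sg mw * N mw p \<ge> 0 \<Longrightarrow>
        \<exists>z\<in>closed_segment v w. dist p z \<le> C * \<bar>N l p\<bar>" using dist_edge_le by blast
    have "region h \<subseteq> cball v (dist v w + C * h)"
    proof
      fix p assume p: "p \<in> region h"
      then have k: "\<bar>N l p\<bar> \<le> sg mv * N mv p" "\<bar>N l p\<bar> \<le> sg mw * N mw p" "\<bar>N l p\<bar> \<le> h"
        using lines by (auto simp: region_def)
      obtain z where z: "z \<in> closed_segment v w" "dist p z \<le> C * \<bar>N l p\<bar>"
        using C(2)[of p] k by force
      have "dist v p \<le> dist v z + dist p z" by (metis dist_commute dist_triangle)
      also have "dist v z \<le> dist v w" using z(1) by (metis dist_in_closed_segment dist_commute)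
      also have "dist p z \<le> C * h" using z(2) k(3) C(1) by (meson mult_left_mono less_imp_le order_trans)
      finally show "p \<in> cball v (dist v w + C * h)" by simp
    qed
    then show ?thesis using bounded_cball bounded_subset by blast
  qed
  ultimately show ?thesis by (simp add: compact_eq_bounded_closed)
qed

text \<open>
  For small \<open>h\<close> the region is close to the closed edge, where these forms are bounded away from zero. So only the bisectors at
  the two ends and the lines \<open>\<bar>N l\<bar> = h\<close> matter for its boundary.
\<close>

lemma eventually_region_avoids_other_lines:
  "\<forall>\<^sub>F h in at_right 0. \<forall>k\<in>A - {l, mv, mw}. \<forall>p\<in>region h. h < sg k * N k p"
proof (rule eventually_ball_finite)
  show "finite (A - {l, mv, mw})" using fin by simp
  show "\<forall>k\<in>A - {l, mv, mw}. \<forall>\<^sub>F h in at_right 0. \<forall>p\<in>region h. h < sg k * N k p"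
  proof
    fix k assume k: "k \<in> A - {l, mv, mw}"
    obtain C where C: "C > 0" "\<And>p. sg mv * N mv p \<ge> 0 \<Longrightarrow> sg mw * N mw p \<ge> 0 \<Longrightarrow>
        \<exists>z\<in>closed_segment v w. dist p z \<le> C * \<bar>N l p\<bar>" using dist_edge_le by blast
    have "continuous_on (closed_segment v w) (\<lambda>p. sg k * N k p)" by (intro continuous_intros)
    from continuous_attains_inf[OF compact_segment _ this] obtain z0 where
      z0: "z0 \<in> closed_segment v w" "\<And>z. z \<in> closed_segment v w \<Longrightarrow> sg k * N k z0 \<le> sg k * N k z" by auto
    have "sg k * N k z0 > 0" using sg_pos_on_segment[OF k z0(1)] .
    then have "\<forall>\<^sub>F h in at_right 0. h * (C + 1) < sg k * N k z0" by (rule eventually_mult_less_at_right)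
    then show "\<forall>\<^sub>F h in at_right 0. \<forall>p\<in>region h. h < sg k * N k p"
    proof eventually_elim
      case (elim h)
      show ?case
      proof
        fix p assume p: "p \<in> region h"
        then have q: "\<bar>N l p\<bar> \<le> sg mv * N mv p" "\<bar>N l p\<bar> \<le> sg mw * N mw p" "\<bar>N l p\<bar> \<le> h"
          using lines by (auto simp: region_def)
        obtain z where z: "z \<in> closed_segment v w" "dist p z \<le> C * \<bar>N l p\<bar>"
          using C(2)[of p] q by force
        have "dist p z \<le> C * h" using z(2) q(3) C(1) by (meson mult_left_mono less_imp_le order_trans)
        moreover have "sg k * N k z - sg k * N k p \<le> dist p z"
          using N_lipschitz[of k p z] k sg_cases[of k] by auto
        ultimately show "h < sg k * N k p" using z0(2)[OF z(1)] elim by (simp add: algebra_simps)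
      qed
    qed
  qed
qed

lemma crunodes_in_region:
  assumes "h > 0" "\<forall>k\<in>A - {l, mv, mw}. \<forall>p\<in>region h. h < sg k * N k p"
  shows "crunodes A \<inter> region h \<subseteq> {v, w}"
proof
  fix x assume "x \<in> crunodes A \<inter> region h"
  then have x: "x \<in> crunodes A" "x \<in> region h" by auto
  obtain k k' where k: "k \<in> A" "k' \<in> A" "k \<noteq> k'" "x \<in> k" "x \<in> k'" using crunode_lines[OF x(1)] by blast
  have sub: "j \<in> {l, mv, mw}" if "j \<in> A" "x \<in> j" for j
    using assms(2) x(2) that mem_line[of j x] assms(1) by force
  have xl: "x \<in> l"
  proof (rule ccontr)
    assume nl: "x \<notin> l"
    then have "k \<noteq> l" using k by auto
    then have "\<bar>N l x\<bar> \<le> sg k * N k x" using x(2) k by (auto simp: region_def)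
    then show False using nl k mem_line lines(1) by force
  qed
  obtain j where j: "j \<in> A" "j \<noteq> l" "x \<in> j" using k by blast
  then have "j = mv \<or> j = mw" using sub by blast
  then show "x \<in> {v, w}"
  proof
    assume "j = mv"
    then have "x = v" using crunode_unique[of l mv x v] xl j lines ends by blast
    then show ?thesis by simp
  next
    assume "j = mw"
    then have "x = w" using crunode_unique[of l mw x w] xl j lines ends by blast
    then show ?thesis by simp
  qed
qed

lemma N_l_normal: "N l (mid + y *\<^sub>R n l) = y"
proof -
  have "n l \<bullet> n l = 1" using unit[OF lines(1)] by (simp add: dot_square_norm)
  then show ?thesis using N_l_segment[OF open_closed_segment[OF mid_in]] by (simp add: N_add)
qed

lemma N_near_mid:
  assumes k: "k \<in> A - {l}" and d: "dist p mid \<le> r"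
  shows "sg k * N k mid - r \<le> sg k * N k p"
  using N_lipschitz[of k p mid] k d sg_cases[OF k] by auto

text \<open>
  \<open>G\<close> changes sign across the edge, and small perturbations inherit this.
\<close>

lemma eventually_zero_across_edge:
  assumes H: "real_polynomial_function H" and y0: "y0 > 0" "\<And>k. k \<in> A - {l} \<Longrightarrow> y0 < sg k * N k mid"
  shows "\<forall>\<^sub>F \<epsilon> in at 0. \<exists>y. - y0 \<le> y \<and> y \<le> y0 \<and> perturb G H \<epsilon> (mid + y *\<^sub>R n l) = 0"
proof -
  define q where "q = (\<lambda>y. mid + y *\<^sub>R n l)"
  have pos: "sg k * N k (q y) > 0" if "\<bar>y\<bar> \<le> y0" "k \<in> A - {l}" for y k
    using N_near_mid[OF that(2), of "q y" y0] y0(2)[OF that(2)] that(1) unit[OF lines(1)]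
    by (simp add: q_def dist_norm)
  have GG: "G (q y0) * G (q (- y0)) < 0"
  proof -
    have "G (q y0) * G (q (- y0)) = - (y0 * y0) * (\<Prod>k\<in>A - {l}. N k (q y0) * N k (q (- y0)))"
      using N_l_normal[of y0] N_l_normal[of "- y0"]
      by (simp add: G_split1[OF lines(1)] prod.distrib q_def)
    moreover have "N k (q y0) * N k (q (- y0)) > 0" if k: "k \<in> A - {l}" for k
    proof -
      have "sg k * N k (q y0) > 0" "sg k * N k (q (- y0)) > 0"
        using pos[of y0 k] pos[of "- y0" k] k y0(1) by auto
      then show ?thesis using sg_cases[OF k] by (auto simp: mult_neg_neg)
    qed
    then have "(\<Prod>k\<in>A - {l}. N k (q y0) * N k (q (- y0))) > 0" by (intro prod_pos) blast
    ultimately show ?thesis using y0(1) by (simp add: mult_neg_pos)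
  qed
  have "\<forall>\<^sub>F \<epsilon> in at 0. \<forall>p\<in>{q y0, q (- y0)}. \<bar>\<epsilon> * H p\<bar> < \<bar>G p\<bar>"
    by (rule eventually_perturbation_smaller)
      (use GG in \<open>auto intro!: real_polynomial_function_continuous_on G_poly H\<close>)
  then show ?thesis
  proof eventually_elim
    case (elim \<epsilon>)
    let ?F = "perturb G H \<epsilon>" and ?\<phi> = "\<lambda>y. perturb G H \<epsilon> (q y)"
    have cont: "continuous_on {-y0..y0} ?\<phi>"
      using real_polynomial_function_perturb[OF G_poly H] unfolding q_def
      by (intro continuous_on_compose2[OF real_polynomial_function_continuous_on[of ?F UNIV]])
        (auto intro!: continuous_intros)
    have "sgn (?\<phi> y0) = sgn (G (q y0))" "sgn (?\<phi> (- y0)) = sgn (G (q (- y0)))"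
      using elim by (auto simp: sgn_if abs_if split: if_splits)
    then have "?\<phi> y0 * ?\<phi> (- y0) < 0" using GG by (auto simp: mult_less_0_iff sgn_if split: if_splits)
    then have "\<exists>y. - y0 \<le> y \<and> y \<le> y0 \<and> ?\<phi> y = 0"
      using IVT'[of ?\<phi> "- y0" 0 y0] IVT2'[of ?\<phi> y0 0 "- y0"] cont y0(1) by (auto simp: mult_less_0_iff)
    then show ?case unfolding q_def .
  qed
qed

text \<open>
  On the bisectors at both ends the curvature is large, with the sign of \<open>\<epsilon> H v\<close> and of \<open>\<epsilon> H w\<close>, and these agree. In the middle
  of the edge it is bounded. So there is an interior minimum.
\<close>

lemma eventually_cusp_along_edge:
  assumes H: "real_polynomial_function H" "\<forall>c\<in>crunodes A. H c \<noteq> 0" and HH: "H v * H w > 0"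
  shows "\<forall>\<^sub>F h in at_right 0. \<exists>M. \<forall>\<^sub>F \<epsilon> in at 0. \<exists>p\<in>inner_region h.
     p \<in> evolute_cusps {q. perturb G H \<epsilon> q = 0} \<and> sgn (\<epsilon> * H v) * level_curvature (perturb G H \<epsilon>) p \<le> M"
proof -
  have Hv: "H v \<noteq> 0" "H w \<noteq> 0" using HH by auto
  have sgs: "sg mv = 1 \<or> sg mv = -1" "sg mw = 1 \<or> sg mw = -1" using sg_cases lines by auto
  have neqs: "l \<noteq> mv" "l \<noteq> mw" using lines by auto
  note diag_v = eventually_diagonal_curvature_large[OF H(1) Hv(1) lines(1,2) neqs(1) ends(1,2) sgs(1)]
  note diag_w = eventually_diagonal_curvature_large[OF H(1) Hv(2) lines(1,3) neqs(2) ends(3,4) sgs(2)]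
  show ?thesis
    using diag_v diag_w eventually_region_avoids_other_lines eventually_at_right_0_pos
  proof eventually_elim
    case (elim h)
    note dv = elim(1) and dw = elim(2) and avoid = elim(3) and h = elim(4)
    \<comment> \<open>The curve crosses the short segment \<open>Z\<close> across the edge, where its curvature is bounded.\<close>
    define q where "q = (\<lambda>y. mid + y *\<^sub>R n l)"
    have Nl: "N l (q y) = y" for y unfolding q_def by (rule N_l_normal)
    have "\<forall>\<^sub>F y in at_right 0. (\<forall>k\<in>A - {l}. y * 2 < sg k * N k mid) \<and> y * 1 < h"
      using fin h sg_pos_on_edge[OF _ mid_in]
      by (intro eventually_conj eventually_ball_finite ballI eventually_mult_less_at_right) auto
    then have "\<forall>\<^sub>F y in at_right 0. (\<forall>k\<in>A - {l}. y * 2 < sg k * N k mid) \<and> y < h \<and> y > 0"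
      using eventually_at_right_0_pos by eventually_elim auto
    from eventually_happens'[OF trivial_limit_at_right_real this]
    obtain y0 where y0': "(\<forall>k\<in>A - {l}. y0 * 2 < sg k * N k mid) \<and> y0 < h \<and> y0 > 0" ..
    then have y0: "\<And>k. k \<in> A - {l} \<Longrightarrow> y0 * 2 < sg k * N k mid" "y0 < h" "y0 > 0" by blast+
    have qin: "q y \<in> inner_region h" if "\<bar>y\<bar> \<le> y0" for y
    proof -
      have "\<bar>y\<bar> < sg k * N k (q y)" if "k \<in> A - {l}" for k
        using y0(1)[OF that] N_near_mid[OF that, of "q y" "\<bar>y\<bar>"] \<open>\<bar>y\<bar> \<le> y0\<close> unit[OF lines(1)]
        by (simp add: q_def dist_norm)
      then show ?thesis using y0 that by (auto simp: inner_region_def Nl)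
    qed
    define Z where "Z = q ` {-y0..y0}"
    have Z: "compact Z" unfolding Z_def q_def by (intro compact_continuous_image continuous_intros) auto
    have Zc: "Z \<inter> crunodes A = {}"
    proof (rule ccontr)
      assume "Z \<inter> crunodes A \<noteq> {}"
      then obtain y where "y \<in> {-y0..y0}" "q y \<in> crunodes A" unfolding Z_def by blast
      then have y: "\<bar>y\<bar> \<le> y0" "q y \<in> crunodes A" by auto
      obtain k k' where k: "k \<in> A" "k' \<in> A" "k \<noteq> k'" "q y \<in> k" "q y \<in> k'" using crunode_lines[OF y(2)] by blast
      then obtain j where j: "j \<in> A - {l}" "N j (q y) = 0" using mem_line by blast
      then have "\<bar>N l (q y)\<bar> < sg j * N j (q y)" using qin[OF y(1)] unfolding inner_region_def by blast
      then show False using j by simp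
    qed
    obtain M where M: "\<forall>\<^sub>F \<epsilon> in at 0. \<forall>p\<in>Z. perturb G H \<epsilon> p = 0 \<longrightarrow> \<bar>level_curvature (perturb G H \<epsilon>) p\<bar> \<le> M"
      using eventually_bounded_curvature[OF H(1) Z Zc] ..
    have zero: "\<forall>\<^sub>F \<epsilon> in at 0. \<exists>y. - y0 \<le> y \<and> y \<le> y0 \<and> perturb G H \<epsilon> (q y) = 0"
      unfolding q_def
      by (rule eventually_zero_across_edge[OF H(1) y0(3)]) (use y0 in force)
    \<comment> \<open>The curve does not meet the sides of the region that are parallel to the edge.\<close>
    define Y where "Y = region h \<inter> {p. \<bar>N l p\<bar> = h}"
    have Y: "compact Y" unfolding Y_def
      by (intro compact_Int_closed compact_region closed_Collect_eq continuous_intros)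
    have YG: "\<forall>\<^sub>F \<epsilon> in at 0. \<forall>p\<in>Y. G p + \<epsilon> * H p \<noteq> 0"
    proof (rule eventually_no_zero[OF Y])
      show "G p \<noteq> 0" if "p \<in> Y" for p
      proof
        assume "G p = 0"
        then obtain j where j: "j \<in> A" "N j p = 0" using G_eq_0 by blast
        have "\<bar>N l p\<bar> = h" "p \<in> region h" using that by (auto simp: Y_def)
        moreover have "j \<noteq> l" using j(2) calculation(1) h by auto
        ultimately have "h \<le> sg j * N j p" using j(1) by (auto simp: region_def)
        then show False using j(2) h by simp
      qed
    qed (intro real_polynomial_function_continuous_on G_poly H)+
    have nz: "\<forall>\<^sub>F \<epsilon> in at 0. \<epsilon> \<noteq> (0::real)" by (simp add: eventually_neq_at_within)
    have "\<forall>\<^sub>F \<epsilon> in at 0. \<exists>p\<in>inner_region h.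
     p \<in> evolute_cusps {q. perturb G H \<epsilon> q = 0} \<and> sgn (\<epsilon> * H v) * level_curvature (perturb G H \<epsilon>) p \<le> M"
      using M zero YG nz spec[OF dv, of M] spec[OF dw, of M] eventually_regular[OF H compact_region[of h]]
    proof eventually_elim
      case (elim \<epsilon>)
      let ?F = "perturb G H \<epsilon>" and ?\<phi> = "\<lambda>y. perturb G H \<epsilon> (q y)" and ?s = "sgn (\<epsilon> * H v)"
      have sgn: "?s = 1 \<or> ?s = -1" using elim(4) Hv by (auto simp: sgn_if)
      have sw: "sgn (\<epsilon> * H w) = ?s" using HH by (auto simp: sgn_mult zero_less_mult_iff)
      obtain y where y: "- y0 \<le> y" "y \<le> y0" "?\<phi> y = 0" using elim(2) by blast
      have yZ: "q y \<in> Z" using y by (auto simp: Z_def)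
      have qy: "q y \<in> inner_region h" using qin y by (simp add: abs_le_iff)
      have "\<bar>level_curvature ?F (q y)\<bar> \<le> M" using elim(1) yZ y(3) by blast
      then have low: "?s * level_curvature ?F (q y) \<le> M" using sgn by auto
      have "\<exists>p\<in>inner_region h. p \<in> evolute_cusps {q. ?F q = 0} \<and>
         (- ?s) * level_curvature ?F p \<ge> (- ?s) * level_curvature ?F (q y)"
      proof (rule extremal_cusp_in_region[OF _ compact_region[of h] open_inner_region inner_region_subset])
        show "real_polynomial_function ?F" using G_poly H by blast
        show "- ?s = 1 \<or> - ?s = -1" using sgn by auto
        show "q y \<in> region h" using qy inner_region_subset by blast
        show "?F (q y) = 0" by (rule y(3))
        show "gradsq ?F p > 0" if "p \<in> region h" "?F p = 0" for p using elim(7) that by blast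
        show "(- ?s) * level_curvature ?F p < (- ?s) * level_curvature ?F (q y)"
          if p: "p \<in> region h - inner_region h" "?F p = 0" for p
        proof -
          have pr: "p \<in> region h" "\<bar>N l p\<bar> \<le> h" using p by (auto simp: region_def)
          have "\<bar>N l p\<bar> \<noteq> h" using elim(3) p by (auto simp: Y_def)
          then obtain k where k: "k \<in> A - {l}" "\<bar>N l p\<bar> = sg k * N k p"
            using p(1) by (force simp: region_def inner_region_def)
          have "k \<in> {mv, mw}"
          proof (rule ccontr)
            assume "k \<notin> {mv, mw}"
            then have "h < sg k * N k p" using avoid k(1) pr(1) by blast
            then show False using k(2) pr(2) by simp
          qed
          then have "?s * level_curvature ?F p > M"
          proof
            assume "k = mv"
            then show ?thesis using elim(5) p(2) pr(2) k(2) by simp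
          next
            assume "k \<in> {mw}"
            then show ?thesis using elim(6) p(2) pr(2) k(2) sw by simp
          qed
          then show ?thesis using low by simp
        qed
      qed
      then show ?case using low by force
    qed
    then show ?case ..
  qed
qed

end

context line_arrangement begin

section \<open>Counting the extrema of the curvature\<close>

lemma closed_Union_lines: "S \<subseteq> A \<Longrightarrow> closed (\<Union>S)"
  using closed_line fin by (meson closed_Union finite_subset subsetD)

text \<open>
  Off the crunodes the lines are disjoint closed sets.
\<close>

lemma connected_stays_on_line:
  assumes D: "connected D" "D \<subseteq> \<Union>A - crunodes A" and l: "l \<in> A" "D \<inter> l \<noteq> {}"
  shows "D \<subseteq> l"
proof (rule ccontr)
  assume "\<not> D \<subseteq> l"
  then have ne: "\<Union>(A - {l}) \<inter> D \<noteq> {}" using D(2) by blast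
  have "l \<inter> \<Union>(A - {l}) \<inter> D = {}" using D(2) l(1) unfolding crunodes_def by blast
  moreover have "D \<subseteq> l \<union> \<Union>(A - {l})" using D(2) by blast
  moreover have "l \<inter> D \<noteq> {}" using l(2) by blast
  ultimately show False
    using D(1) ne closed_line[OF l(1)] closed_Union_lines[of "A - {l}"]
    unfolding connected_closed by blast
qed

lemma bounded_edge_of_component:
  assumes e: "open_segment v w \<in> edges A" and vw: "v \<in> crunodes A" "w \<in> crunodes A"
  obtains l mv mw where "bounded_edge A n b l v w mv mw"
proof -
  have comp: "open_segment v w \<noteq> {}" "connected (open_segment v w)" "open_segment v w \<subseteq> \<Union>A - crunodes A"
    using e in_components_nonempty in_components_connected in_components_subset
    unfolding edges_def by blast+
  have vnw: "v \<noteq> w" using comp(1) by auto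
  obtain p l where p: "p \<in> open_segment v w" "l \<in> A" "p \<in> l" using comp(1,3) by blast
  have sub: "open_segment v w \<subseteq> l"
    by (rule connected_stays_on_line[OF comp(2,3) p(2)]) (use p in blast)
  have "closure (open_segment v w) \<subseteq> l"
    using sub closed_line[OF p(2)] by (rule closure_minimal)
  then have "closed_segment v w \<subseteq> l" using vnw by (simp add: closure_open_segment)
  then have l: "v \<in> l" "w \<in> l" by auto
  have other: "\<exists>m\<in>A. m \<noteq> l \<and> x \<in> m" if "x \<in> crunodes A" for x
    using crunode_lines[OF that] by metis
  obtain mv mw where m: "mv \<in> A" "mv \<noteq> l" "v \<in> mv" "mw \<in> A" "mw \<noteq> l" "w \<in> mw"
    using other[OF vw(1)] other[OF vw(2)] by blast
  have "bounded_edge A n b l v w mv mw"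
    using p(2) l m vnw comp(3) by unfold_locales auto
  then show thesis by (rule that)
qed

lemma finite_bounded_edges: "finite (bounded_edges A)"
proof -
  have "bounded_edges A \<subseteq> (\<lambda>(v, w). open_segment v w) ` (crunodes A \<times> crunodes A)"
    unfolding bounded_edges_def by auto
  then show ?thesis by (rule finite_surj[rotated]) (simp add: finite_crunodes)
qed

text \<open>
  Both \<open>l\<close> and \<open>l'\<close> are the unique nearest line of \<open>p\<close>, and both edges are described by the signs at \<open>p\<close>.
\<close>

lemma inner_region_determines_edge:
  assumes e: "bounded_edge A n b l v w mv mw" and e': "bounded_edge A n b l' v' w' mv' mw'"
    and p: "p \<in> bounded_edge.inner_region A n b l v w h" "p \<in> bounded_edge.inner_region A n b l' v' w' h'"
  shows "open_segment v w = open_segment v' w'"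
proof -
  interpret e: bounded_edge A n b l v w mv mw by fact
  interpret e': bounded_edge A n b l' v' w' mv' mw' by fact
  have 1: "\<And>k. k \<in> A - {l} \<Longrightarrow> \<bar>N l p\<bar> < e.sg k * N k p"
    and 2: "\<And>k. k \<in> A - {l'} \<Longrightarrow> \<bar>N l' p\<bar> < e'.sg k * N k p"
    using p by (auto simp: e.inner_region_def e'.inner_region_def)
  have ll: "l = l'"
  proof (rule ccontr)
    assume ne: "l \<noteq> l'"
    have "\<bar>N l p\<bar> < \<bar>N l' p\<bar>"
      using 1[of l'] e'.lines(1) ne e.sg_cases[of l'] by auto
    moreover have "\<bar>N l' p\<bar> < \<bar>N l p\<bar>"
      using 2[of l] e.lines(1) ne e'.sg_cases[of l] by auto
    ultimately show False by simp
  qed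
  have "e.sg k = e'.sg k" if k: "k \<in> A - {l}" for k
  proof -
    have k': "k \<in> A - {l'}" using k ll by simp
    have "e.sg k * N k p > 0" "e'.sg k * N k p > 0" using 1[OF k] 2[OF k'] by linarith+
    then show ?thesis using e.sg_cases[OF k] e'.sg_cases[OF k'] by (auto simp: zero_less_mult_iff)
  qed
  then show ?thesis unfolding e.edge_eq e'.edge_eq ll[symmetric] by auto
qed

lemma eventually_cusp_on_edge:
  assumes H: "real_polynomial_function H" "\<forall>c\<in>crunodes A. H c \<noteq> 0"
    and e: "bounded_edge A n b l v w mv mw" and HH: "H v * H w > 0"
  shows "\<exists>h M. compact (bounded_edge.region A n b l v w h) \<and>
    bounded_edge.inner_region A n b l v w h \<subseteq> bounded_edge.region A n b l v w h \<and>
    crunodes A \<inter> bounded_edge.region A n b l v w h \<subseteq> {v, w} \<and>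
    (\<forall>\<^sub>F \<epsilon> in at 0. \<exists>p\<in>bounded_edge.inner_region A n b l v w h.
       p \<in> evolute_cusps {q. perturb G H \<epsilon> q = 0} \<and> sgn (\<epsilon> * H v) * level_curvature (perturb G H \<epsilon>) p \<le> M)"
proof -
  interpret e: bounded_edge A n b l v w mv mw by fact
  have "\<forall>\<^sub>F h in at_right 0. crunodes A \<inter> e.region h \<subseteq> {v, w} \<and> (\<exists>M. \<forall>\<^sub>F \<epsilon> in at 0. \<exists>p\<in>e.inner_region h.
     p \<in> evolute_cusps {q. perturb G H \<epsilon> q = 0} \<and> sgn (\<epsilon> * H v) * level_curvature (perturb G H \<epsilon>) p \<le> M)"
    using e.eventually_cusp_along_edge[OF H HH] e.eventually_region_avoids_other_lines eventually_at_right_0_pos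
  proof eventually_elim
    case (elim h)
    from elim(1) e.crunodes_in_region[OF elim(3,2)] show ?case by (intro conjI)
  qed
  from eventually_happens'[OF trivial_limit_at_right_real this]
  obtain h where h: "crunodes A \<inter> e.region h \<subseteq> {v, w} \<and> (\<exists>M. \<forall>\<^sub>F \<epsilon> in at 0. \<exists>p\<in>e.inner_region h.
     p \<in> evolute_cusps {q. perturb G H \<epsilon> q = 0} \<and> sgn (\<epsilon> * H v) * level_curvature (perturb G H \<epsilon>) p \<le> M)" ..
  from conjunct2[OF h] obtain M where M: "\<forall>\<^sub>F \<epsilon> in at 0. \<exists>p\<in>e.inner_region h.
     p \<in> evolute_cusps {q. perturb G H \<epsilon> q = 0} \<and> sgn (\<epsilon> * H v) * level_curvature (perturb G H \<epsilon>) p \<le> M" ..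
  show ?thesis
    by (rule exI[of _ h], rule exI[of _ M])
      (intro conjI M conjunct1[OF h] e.compact_region e.inner_region_subset)
qed

text \<open>
  At the ends of such an edge the two nodes are resolved so that the branches on the edge lie on the same side of it.
\<close>

definition same_side_edges :: "(real^2 \<Rightarrow> real) \<Rightarrow> (real^2) set set" where
  "same_side_edges H = {e \<in> bounded_edges A. \<exists>v\<in>crunodes A. \<exists>w\<in>crunodes A. e = open_segment v w \<and> H v * H w > 0}"

lemma finite_same_side_edges: "finite (same_side_edges H)"
  using finite_subset[OF _ finite_bounded_edges] unfolding same_side_edges_def by simp

text \<open>
  The maxima lie in disjoint balls and in opposite sectors, the minima in disjoint inner regions. A maximum near a crunode \<open>x\<close>
  cannot coincide with a minimum along an edge \<open>e\<close>: if \<open>x\<close> is an end of \<open>e\<close>, then the same sign enters for both, and the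
  curvature at the maximum exceeds that at the minimum; otherwise the ball around \<open>x\<close> does not meet the region of \<open>e\<close>.
\<close>

lemma eventually_many_cusps:
  assumes H: "real_polynomial_function H" "\<forall>c\<in>crunodes A. H c \<noteq> 0"
  shows "\<forall>\<^sub>F \<epsilon> in at 0.
    enat (2 * card (crunodes A) + card (same_side_edges H)) \<le> num_evolute_cusps {q. perturb G H \<epsilon> q = 0}"
proof -
  let ?S = "same_side_edges H" and ?X = "crunodes A"
  define good where "good = (\<lambda>e v w B U M. open_segment v w = e \<and> H v * H w > 0 \<and> compact B \<and> U \<subseteq> B \<and>
     ?X \<inter> B \<subseteq> {v, w} \<and> (\<exists>l mv mw h. bounded_edge A n b l v w mv mw \<and> U = bounded_edge.inner_region A n b l v w h) \<and>
     (\<forall>\<^sub>F \<epsilon> in at 0. \<exists>p\<in>U. p \<in> evolute_cusps {q. perturb G H \<epsilon> q = 0} \<and>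
        sgn (\<epsilon> * H v) * level_curvature (perturb G H \<epsilon>) p \<le> M))"
  have "\<forall>e\<in>?S. \<exists>v w B U M. good e v w B U M"
  proof
    fix e assume "e \<in> ?S"
    then obtain v w where e: "e \<in> bounded_edges A" "v \<in> ?X" "w \<in> ?X" "e = open_segment v w" "H v * H w > 0"
      unfolding same_side_edges_def by blast
    then have "open_segment v w \<in> edges A" by (simp add: bounded_edges_def)
    then obtain l mv mw where be: "bounded_edge A n b l v w mv mw"
      using bounded_edge_of_component e(2,3) by blast
    obtain h M where "compact (bounded_edge.region A n b l v w h)"
      "bounded_edge.inner_region A n b l v w h \<subseteq> bounded_edge.region A n b l v w h"
      "?X \<inter> bounded_edge.region A n b l v w h \<subseteq> {v, w}"
      "\<forall>\<^sub>F \<epsilon> in at 0. \<exists>p\<in>bounded_edge.inner_region A n b l v w h.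
       p \<in> evolute_cusps {q. perturb G H \<epsilon> q = 0} \<and> sgn (\<epsilon> * H v) * level_curvature (perturb G H \<epsilon>) p \<le> M"
      using eventually_cusp_on_edge[OF H be e(5)] by (elim exE conjE)
    then have "good e v w (bounded_edge.region A n b l v w h) (bounded_edge.inner_region A n b l v w h) M"
      unfolding good_def using be e(4,5) by (intro conjI exI) auto
    then show "\<exists>v w B U M. good e v w B U M" by blast
  qed
  then obtain v w B U M where good: "\<And>e. e \<in> ?S \<Longrightarrow> good e (v e) (w e) (B e) (U e) (M e)" by metis
  \<comment> \<open>One bound for the curvature at all the minima; the maxima are chosen above it.\<close>
  define M0 where "M0 = (\<Sum>e\<in>?S. \<bar>M e\<bar>)"
  have M0: "M e \<le> M0" if "e \<in> ?S" for e
    using member_le_sum[of e ?S "\<lambda>e. \<bar>M e\<bar>"] that finite_same_side_edges by (auto simp: M0_def)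
  have "\<forall>x\<in>?X. \<exists>l m. l \<in> A \<and> m \<in> A \<and> l \<noteq> m \<and> x \<in> l \<and> x \<in> m"
    unfolding crunodes_def by blast
  then obtain la lb where ln: "\<And>x. x \<in> ?X \<Longrightarrow> la x \<in> A \<and> lb x \<in> A \<and> la x \<noteq> lb x \<and> x \<in> la x \<and> x \<in> lb x" by metis
  have "\<forall>\<^sub>F s in at_right 0. s > 0 \<and> (\<forall>x\<in>?X. (\<forall>k\<in>A - {la x, lb x}. cball x s \<inter> k = {}) \<and>
      cball x s \<inter> {p. H p = 0} = {} \<and> (\<forall>y\<in>?X - {x}. s * 2 < dist x y) \<and> (\<forall>e\<in>?S. x \<notin> {v e, w e} \<longrightarrow> cball x s \<inter> B e = {}))"
  proof (intro eventually_conj eventually_ball_finite ballI finite_crunodes finite_same_side_edges eventually_at_right_0_pos)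
    fix x assume x: "x \<in> ?X"
    show "finite (A - {la x, lb x})" using fin by simp
    show "finite (?X - {x})" using finite_crunodes by simp
    show "\<forall>\<^sub>F s in at_right 0. cball x s \<inter> {p. H p = 0} = {}"
      using H x by (intro eventually_cball_avoids closed_Collect_eq real_polynomial_function_continuous_on continuous_intros) auto
    show "\<forall>\<^sub>F s in at_right 0. cball x s \<inter> k = {}" if "k \<in> A - {la x, lb x}" for k
      using that ln[OF x] third_line_nonzero[of "la x" "lb x" x k] mem_line
      by (intro eventually_cball_avoids closed_line) auto
    show "\<forall>\<^sub>F s in at_right 0. s * 2 < dist x y" if "y \<in> ?X - {x}" for y
      using that by (intro eventually_mult_less_at_right) auto
    show "\<forall>\<^sub>F s in at_right 0. x \<notin> {v e, w e} \<longrightarrow> cball x s \<inter> B e = {}" if e: "e \<in> ?S" for e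
    proof (cases "x \<in> {v e, w e}")
      case False
      have "?X \<inter> B e \<subseteq> {v e, w e}" "compact (B e)" using good[OF e] unfolding good_def by blast+
      then have "\<forall>\<^sub>F s in at_right 0. cball x s \<inter> B e = {}"
        using x False by (intro eventually_cball_avoids compact_imp_closed) auto
      then show ?thesis by eventually_elim simp
    qed simp
  qed
  from eventually_happens'[OF trivial_limit_at_right_real this] obtain s where
    s_all: "s > 0 \<and> (\<forall>x\<in>?X. (\<forall>k\<in>A - {la x, lb x}. cball x s \<inter> k = {}) \<and>
      cball x s \<inter> {p. H p = 0} = {} \<and> (\<forall>y\<in>?X - {x}. s * 2 < dist x y) \<and>
      (\<forall>e\<in>?S. x \<notin> {v e, w e} \<longrightarrow> cball x s \<inter> B e = {}))" ..
  then have s: "s > 0" by (rule conjunct1)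
  note s_x = bspec[OF conjunct2[OF s_all]]
  have s_lines: "cball x s \<inter> k = {}" if "x \<in> ?X" "k \<in> A - {la x, lb x}" for x k
    using bspec[OF conjunct1[OF s_x[OF that(1)]] that(2)] .
  have s_H: "cball x s \<inter> {p. H p = 0} = {}" if "x \<in> ?X" for x
    using conjunct1[OF conjunct2[OF s_x[OF that]]] .
  have s_dist: "s * 2 < dist x y" if "x \<in> ?X" "y \<in> ?X - {x}" for x y
    using bspec[OF conjunct1[OF conjunct2[OF conjunct2[OF s_x[OF that(1)]]]] that(2)] .
  have s_B: "cball x s \<inter> B e = {}" if "x \<in> ?X" "e \<in> ?S" "x \<notin> {v e, w e}" for x e
    using mp[OF bspec[OF conjunct2[OF conjunct2[OF conjunct2[OF s_x[OF that(1)]]]] that(2)] that(3)] .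
  have ev1: "\<forall>\<^sub>F \<epsilon> in at 0. \<forall>x\<in>?X. \<forall>\<sigma>\<in>{1, -1::real}. \<exists>p\<in>ball x s. \<sigma> * N (la x) p > 0 \<and>
     p \<in> evolute_cusps {q. perturb G H \<epsilon> q = 0} \<and> sgn (\<epsilon> * H x) * level_curvature (perturb G H \<epsilon>) p > M0"
  proof (intro eventually_ball_finite ballI finite_crunodes)
    fix x :: "real^2" and \<sigma> :: real assume x: "x \<in> ?X" and \<sigma>: "\<sigma> \<in> {1, -1}"
    show "\<forall>\<^sub>F \<epsilon> in at 0. \<exists>p\<in>ball x s. \<sigma> * N (la x) p > 0 \<and>
     p \<in> evolute_cusps {q. perturb G H \<epsilon> q = 0} \<and> sgn (\<epsilon> * H x) * level_curvature (perturb G H \<epsilon>) p > M0"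
    proof (rule eventually_cusp_on_node_branch[OF H _ _ _ _ _ s])
      show "la x \<in> A" "lb x \<in> A" "la x \<noteq> lb x" "x \<in> la x" "x \<in> lb x" using ln[OF x] by auto
      show "N k p \<noteq> 0" if "k \<in> A - {la x, lb x}" "p \<in> cball x s" for k p
        using s_lines[OF x that(1)] that mem_line[of k p] by blast
      show "H p \<noteq> 0" if "p \<in> cball x s" for p using s_H[OF x] that by blast
      show "\<sigma> = 1 \<or> \<sigma> = -1" using \<sigma> by blast
    qed
  qed simp
  have ev2: "\<forall>\<^sub>F \<epsilon> in at 0. \<forall>e\<in>?S. \<exists>p\<in>U e. p \<in> evolute_cusps {q. perturb G H \<epsilon> q = 0} \<and>
        sgn (\<epsilon> * H (v e)) * level_curvature (perturb G H \<epsilon>) p \<le> M e"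
  proof (intro eventually_ball_finite finite_same_side_edges ballI)
    fix e assume "e \<in> ?S"
    from good[OF this] show "\<forall>\<^sub>F \<epsilon> in at 0. \<exists>p\<in>U e. p \<in> evolute_cusps {q. perturb G H \<epsilon> q = 0} \<and>
        sgn (\<epsilon> * H (v e)) * level_curvature (perturb G H \<epsilon>) p \<le> M e"
      unfolding good_def by (elim conjE)
  qed
  from ev1 ev2 show ?thesis
  proof eventually_elim
    case (elim \<epsilon>)
    let ?R = "{q. perturb G H \<epsilon> q = 0}" and ?K = "level_curvature (perturb G H \<epsilon>)"
    let ?I = "?X \<times> {1, -1::real}"
    have "\<forall>i\<in>?I. \<exists>p. p \<in> ball (fst i) s \<and> snd i * N (la (fst i)) p > 0 \<and>
       p \<in> evolute_cusps ?R \<and> sgn (\<epsilon> * H (fst i)) * ?K p > M0"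
    proof
      fix i assume "i \<in> ?I"
      then have "fst i \<in> ?X" "snd i \<in> {1, -1}" by auto
      from bspec[OF bspec[OF elim(1) this(1)] this(2)]
      show "\<exists>p. p \<in> ball (fst i) s \<and> snd i * N (la (fst i)) p > 0 \<and>
       p \<in> evolute_cusps ?R \<and> sgn (\<epsilon> * H (fst i)) * ?K p > M0" unfolding Bex_def .
    qed
    from bchoice[OF this] obtain f where f: "\<And>i. i \<in> ?I \<Longrightarrow> f i \<in> ball (fst i) s \<and> snd i * N (la (fst i)) (f i) > 0 \<and>
       f i \<in> evolute_cusps ?R \<and> sgn (\<epsilon> * H (fst i)) * ?K (f i) > M0" by blast
    from elim(2) have "\<forall>e\<in>?S. \<exists>p. p \<in> U e \<and> p \<in> evolute_cusps ?R \<and> sgn (\<epsilon> * H (v e)) * ?K p \<le> M e" by blast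
    from bchoice[OF this] obtain g where g: "\<And>e. e \<in> ?S \<Longrightarrow> g e \<in> U e \<and> g e \<in> evolute_cusps ?R \<and> sgn (\<epsilon> * H (v e)) * ?K (g e) \<le> M e" by blast
    have inj_f: "inj_on f ?I"
    proof (rule inj_onI)
      fix i j assume i: "i \<in> ?I" and j: "j \<in> ?I" and eq: "f i = f j"
      have "fst i = fst j"
      proof (rule ccontr)
        assume ne: "fst i \<noteq> fst j"
        then have "s * 2 < dist (fst i) (fst j)" using i j by (intro s_dist) auto
        also have "\<dots> \<le> dist (fst i) (f i) + dist (fst j) (f j)"
          unfolding eq by (metis dist_commute dist_triangle)
        also have "\<dots> < s + s" using f[OF i] f[OF j] by (intro add_strict_mono) auto
        finally show False by simp
      qed
      moreover have "snd i = snd j"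
        using f[OF i] f[OF j] eq \<open>fst i = fst j\<close> i j by (auto simp: zero_less_mult_iff)
      ultimately show "i = j" by (rule prod_eqI)
    qed
    have inj_g: "inj_on g ?S"
    proof (rule inj_onI)
      fix e e' assume e: "e \<in> ?S" and e': "e' \<in> ?S" and eq: "g e = g e'"
      from good[OF e] obtain l mv mw h where 1: "bounded_edge A n b l (v e) (w e) mv mw"
        "U e = bounded_edge.inner_region A n b l (v e) (w e) h" "open_segment (v e) (w e) = e"
        unfolding good_def by blast
      from good[OF e'] obtain l' mv' mw' h' where 2: "bounded_edge A n b l' (v e') (w e') mv' mw'"
        "U e' = bounded_edge.inner_region A n b l' (v e') (w e') h'" "open_segment (v e') (w e') = e'"
        unfolding good_def by blast
      show "e = e'"
        using inner_region_determines_edge[OF 1(1) 2(1)] g[OF e] g[OF e'] eq 1(2,3) 2(2,3) by metis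
    qed
    have disj: "f ` ?I \<inter> g ` ?S = {}"
    proof (rule ccontr)
      assume "f ` ?I \<inter> g ` ?S \<noteq> {}"
      then obtain i e where i: "i \<in> ?I" and e: "e \<in> ?S" and eq: "f i = g e" by auto
      have ge: "U e \<subseteq> B e" "H (v e) * H (w e) > 0" using good[OF e] unfolding good_def by blast+
      have "fst i \<in> {v e, w e}"
      proof (rule ccontr)
        assume "fst i \<notin> {v e, w e}"
        moreover have "fst i \<in> ?X" using i by auto
        ultimately have "cball (fst i) s \<inter> B e = {}" by (intro s_B e)
        moreover have "f i \<in> cball (fst i) s" using f[OF i] by auto
        moreover have "f i \<in> B e" using g[OF e] ge eq by auto
        ultimately show False by blast
      qed
      then have "sgn (H (fst i)) = sgn (H (v e))" using ge(2) by (auto simp: zero_less_mult_iff)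
      then have "sgn (\<epsilon> * H (fst i)) = sgn (\<epsilon> * H (v e))" by (simp add: sgn_mult)
      then show False using f[OF i] g[OF e] eq M0[OF e] by auto
    qed
    have sub: "f ` ?I \<union> g ` ?S \<subseteq> evolute_cusps ?R" using f g by blast
    have "card (f ` ?I \<union> g ` ?S) = 2 * card ?X + card ?S"
      using disj finite_crunodes finite_same_side_edges inj_f inj_g
      by (simp add: card_Un_disjoint card_image card_cartesian_product)
    then show ?case
      unfolding num_evolute_cusps_def using sub card_mono[OF _ sub] by auto
  qed
qed

end

section \<open>Respected edges are resolved to one side\<close>

lemma mem_tube: "p \<in> tube \<eta> e \<longleftrightarrow> (\<exists>x\<in>e. dist x p < \<eta>)"
  by (simp add: tube_def)

lemma open_tube: "open (tube \<eta> e)"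
  by (simp add: tube_def open_UN)

lemma convex_tube:
  assumes "convex e"
  shows "convex (tube \<eta> e)"
proof -
  have "tube \<eta> e = (\<Union>x\<in>e. \<Union>y\<in>ball 0 \<eta>. {x + y})"
  proof -
    have "p \<in> tube \<eta> e \<longleftrightarrow> (\<exists>x\<in>e. \<exists>y\<in>ball 0 \<eta>. p = x + y)" for p
    proof
      assume "p \<in> tube \<eta> e"
      then obtain x where "x \<in> e" "dist x p < \<eta>" by (auto simp: mem_tube)
      then show "\<exists>x\<in>e. \<exists>y\<in>ball 0 \<eta>. p = x + y"
        by (intro bexI[of _ x] bexI[of _ "p - x"]) (auto simp: dist_norm norm_minus_commute)
    next
      assume "\<exists>x\<in>e. \<exists>y\<in>ball 0 \<eta>. p = x + y"
      then show "p \<in> tube \<eta> e" by (force simp: mem_tube dist_norm)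
    qed
    then show ?thesis by blast
  qed
  then show ?thesis using convex_sums[OF assms convex_ball[of 0 \<eta>]] by metis
qed

lemma tube_closure:
  assumes "z \<in> closure e" "dist z p < \<eta>"
  shows "p \<in> tube \<eta> e"
proof -
  obtain x where x: "x \<in> e" "dist x z < \<eta> - dist z p"
    using closure_approachable assms by (metis diff_gt_0_iff_gt)
  then have "dist x p < \<eta>" using dist_triangle[of x p z] by linarith
  then show ?thesis using x(1) by (auto simp: mem_tube)
qed

lemma connected_opposite_signs:
  fixes f :: "'a::topological_space \<Rightarrow> real"
  assumes "connected C" "continuous_on C f" "x \<in> C" "y \<in> C" "f x \<le> 0" "0 \<le> f y"
  shows "\<exists>z\<in>C. f z = 0"
proof -
  have conn: "connected (f ` C)" using assms(2,1) by (rule connected_continuous_image)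
  have "0 \<in> f ` C" by (rule connectedD_interval[OF conn imageI imageI]) (rule assms)+
  then obtain z where "z \<in> C" "0 = f z" by (rule imageE)
  then show ?thesis by (intro bexI[of _ z]) simp_all
qed

lemma connected_constant_sign:
  fixes f :: "'a::topological_space \<Rightarrow> real"
  assumes "connected C" "continuous_on C f" "\<And>z. z \<in> C \<Longrightarrow> f z \<noteq> 0" "x \<in> C" "f x > 0" "y \<in> C"
  shows "f y > 0"
  using connected_opposite_signs[OF assms(1,2,6,4)] assms(3,5) by force

context bounded_edge begin

abbreviation T :: "real \<Rightarrow> (real^2) set" where "T \<eta> \<equiv> tube \<eta> (open_segment v w)"

lemma closure_edge: "closure (open_segment v w) = closed_segment v w"
  using ends by (simp add: closure_open_segment)

lemma segment_in_tube: "z \<in> closed_segment v w \<Longrightarrow> dist z p < \<eta> \<Longrightarrow> p \<in> T \<eta>"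
  using tube_closure[of z] closure_edge by simp

lemma convex_T: "convex (T \<eta>)" by (simp add: convex_tube)

lemma N_l_tube: "p \<in> T \<eta> \<Longrightarrow> \<bar>N l p\<bar> < \<eta>"
proof -
  assume "p \<in> T \<eta>"
  then obtain x where x: "x \<in> open_segment v w" "dist x p < \<eta>" by (auto simp: mem_tube)
  then show ?thesis
    using N_lipschitz[OF lines(1), of x p] N_l_segment[OF open_closed_segment[OF x(1)]] by simp
qed

text \<open>
  The sign on the edge of the product of all forms but \<open>N l\<close>. So \<open>G\<close> has the sign \<open>S * \<tau>\<close> next to the edge on the side
  where \<open>N l\<close> has the sign \<open>\<tau>\<close>.
\<close>

definition S :: real where "S = (\<Prod>k\<in>A - {l}. sg k)"

lemma S_cases: "S = 1 \<or> S = -1"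
proof -
  have "(\<Prod>k\<in>B. sg k) = 1 \<or> (\<Prod>k\<in>B. sg k) = -1" if "finite B" "B \<subseteq> A - {l}" for B
    using that
  proof (induction B)
    case (insert k B)
    then have "k \<in> A - {l}" "B \<subseteq> A - {l}" by blast+
    with insert show ?case using sg_cases[of k] by (auto simp del: Diff_iff)
  qed simp
  from this[of "A - {l}"] show ?thesis using fin by (simp add: S_def)
qed

definition middle_cell :: "real \<Rightarrow> real \<Rightarrow> (real^2) set" where
  "middle_cell \<tau> \<eta> = {q \<in> T \<eta>. \<tau> * N l q > 0 \<and> (\<forall>k\<in>A - {l}. sg k * N k q > 0)}"

lemma convex_positive_side: "convex {q. c * N k q > 0}"
proof -
  have "{q. c * N k q > 0} = {q. (c *\<^sub>R n k) \<bullet> q > c * b k}"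
    by (auto simp: N_def algebra_simps)
  then show ?thesis by (simp only: convex_halfspace_gt)
qed

lemma convex_middle_cell: "convex (middle_cell \<tau> \<eta>)"
proof -
  have "middle_cell \<tau> \<eta> = T \<eta> \<inter> {q. \<tau> * N l q > 0} \<inter> (\<Inter>k\<in>A - {l}. {q. sg k * N k q > 0})"
    by (auto simp: middle_cell_def)
  then show ?thesis
    by (auto intro!: convex_Int convex_T convex_positive_side convex_INT)
qed

lemma middle_cell_avoids: "middle_cell \<tau> \<eta> \<subseteq> T \<eta> - \<Union>A"
proof
  fix q assume q: "q \<in> middle_cell \<tau> \<eta>"
  have "N k q \<noteq> 0" if "k \<in> A" for k
  proof (cases "k = l")
    case False
    then have "sg k * N k q > 0" using q that unfolding middle_cell_def by blast
    then show ?thesis by auto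
  qed (use q in \<open>auto simp: middle_cell_def\<close>)
  then show "q \<in> T \<eta> - \<Union>A" using q mem_line by (auto simp: middle_cell_def)
qed

lemma component_sign:
  assumes D: "D \<in> components (T \<eta> - \<Union>A)" and k: "k \<in> A" and q: "q \<in> D" "s * N k q > 0" and q': "q' \<in> D"
  shows "s * N k q' > 0"
proof (rule connected_constant_sign[where f = "\<lambda>q. s * N k q" and C = D and x = q])
  show "connected D" by (rule in_components_connected[OF D])
  show "continuous_on D (\<lambda>q. s * N k q)" by (intro continuous_intros)
  show "s * N k z \<noteq> 0" if "z \<in> D" for z
    using that in_components_subset[OF D] k mem_line[of k z] q(2) by auto
qed (use q q' in auto)

text \<open>
  Close to the middle of the edge only \<open>l\<close> is near, so that a domain there is determined by its side of \<open>l\<close>.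
\<close>

lemma component_near_mid:
  assumes D: "D \<in> components (T \<eta> - \<Union>A)" and q: "q \<in> frontier D" "dist q mid < 2 * \<delta>"
    and \<delta>: "\<And>k. k \<in> A - {l} \<Longrightarrow> 2 * \<delta> < sg k * N k mid"
  obtains \<tau> where "\<tau> = 1 \<or> \<tau> = -1" "D = middle_cell \<tau> \<eta>"
proof -
  have "q \<in> closure D" using q(1) by (auto simp: frontier_def)
  then obtain q' where q': "q' \<in> D" "dist q' q < 2 * \<delta> - dist q mid"
    using closure_approachable q(2) by (metis diff_gt_0_iff_gt)
  have dq: "dist q' mid \<le> 2 * \<delta>" using q'(2) dist_triangle[of q' mid q] by linarith
  have pos: "sg k * N k q' > 0" if "k \<in> A - {l}" for k
    using N_near_mid[OF that dq] \<delta>[OF that] by linarith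
  have "N l q' \<noteq> 0" using q'(1) in_components_subset[OF D] lines(1) mem_line[of l q'] by auto
  then obtain \<tau> :: real where \<tau>: "\<tau> = 1 \<or> \<tau> = -1" "\<tau> * N l q' > 0"
    by (metis linorder_neqE_linordered_idom mult_1 mult_minus1 neg_0_less_iff_less)
  have sub: "D \<subseteq> middle_cell \<tau> \<eta>"
  proof
    fix x assume x: "x \<in> D"
    have "\<tau> * N l x > 0" by (rule component_sign[OF D lines(1) q'(1) \<tau>(2) x])
    moreover have "sg k * N k x > 0" if "k \<in> A - {l}" for k
      using component_sign[OF D _ q'(1) pos[OF that] x] that by blast
    ultimately show "x \<in> middle_cell \<tau> \<eta>"
      using x in_components_subset[OF D] by (auto simp: middle_cell_def)
  qed
  have "middle_cell \<tau> \<eta> \<subseteq> D"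
    using components_maximal[OF D convex_connected[OF convex_middle_cell] middle_cell_avoids] q'(1) sub by blast
  with sub have "D = middle_cell \<tau> \<eta>" by blast
  with \<tau>(1) show thesis by (rule that)
qed

text \<open>
  The points with \<open>\<tau> * N l = sg mv * N mv\<close> form the line through \<open>v\<close> that crosses the middle cell \<open>\<tau>\<close> and the opposite sector. On
  it \<open>G\<close> has the sign \<open>S * \<tau>\<close> of the cell, and so has the perturbation near \<open>v\<close>.
\<close>

lemma eventually_barrier:
  assumes H: "real_polynomial_function H" "H v \<noteq> 0" and \<tau>: "\<tau> = 1 \<or> \<tau> = -1"
    and a: "n l \<bullet> a = \<tau>" "n mv \<bullet> a = sg mv"
    and \<eta>: "\<And>k. k \<in> A - {l, mv} \<Longrightarrow> \<eta> * norm a < sg k * N k v"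
  shows "\<forall>\<^sub>F \<epsilon> in at 0. S * \<tau> * \<epsilon> * H v > 0 \<longrightarrow>
    (\<forall>p\<in>T \<eta>. \<tau> * N l p = sg mv * N mv p \<longrightarrow> perturb G H \<epsilon> p \<noteq> 0)"
proof -
  define Z where "Z = (\<lambda>t. v + t *\<^sub>R a) ` {- \<eta>..\<eta>}"
  have Z: "compact Z" unfolding Z_def by (intro compact_continuous_image continuous_intros) auto
  have mv: "sg mv = 1 \<or> sg mv = -1" using sg_cases lines by blast
  have pos: "S * \<tau> * G p > 0" if pZ: "p \<in> Z" and pv: "p \<noteq> v" for p
  proof -
    obtain t where t': "t \<in> {- \<eta>..\<eta>}" "p = v + t *\<^sub>R a" using pZ unfolding Z_def by blast
    have t: "\<bar>t\<bar> \<le> \<eta>" "p = v + t *\<^sub>R a" "t \<noteq> 0" using t' pv by auto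
    have "sg k * N k p > 0" if k: "k \<in> A - {l, mv}" for k
    proof -
      have "\<bar>N k p - N k v\<bar> \<le> \<bar>t\<bar> * norm a"
        using N_lipschitz[of k p v] k by (simp add: t(2) dist_norm)
      also have "\<dots> \<le> \<eta> * norm a" using t(1) by (simp add: mult_right_mono)
      also have "\<dots> < sg k * N k v" by (rule \<eta>[OF k])
      finally show ?thesis using sg_cases[of k] k by auto
    qed
    then have "(\<Prod>k\<in>A - {l, mv}. sg k * N k p) > 0" by (intro prod_pos) blast
    moreover have "N l p = t * \<tau>" "N mv p = t * sg mv"
      by (simp_all add: t(2) N_add N_at_ends a)
    moreover have "S = sg mv * (\<Prod>k\<in>A - {l, mv}. sg k)"
    proof -
      have "A - {l} - {mv} = A - {l, mv}" by blast
      then show ?thesis using fin lines prod.remove[of "A - {l}" mv sg] by (simp add: S_def)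
    qed
    moreover have "G p = N l p * (N mv p * (\<Prod>k\<in>A - {l, mv}. N k p))"
      using G_split2[of l mv p] lines by blast
    ultimately have "S * \<tau> * G p = (t * \<tau>)\<^sup>2 * (sg mv)\<^sup>2 * (\<Prod>k\<in>A - {l, mv}. sg k * N k p)"
      by (simp add: prod.distrib power2_eq_square)
    then show ?thesis using \<open>(\<Prod>k\<in>A - {l, mv}. sg k * N k p) > 0\<close> t(3) \<tau> mv by auto
  qed
  have G0: "G v = 0" using N_at_ends lines by (auto simp: G_eq_0)
  have "\<forall>\<^sub>F \<epsilon> in at 0. S * \<tau> * \<epsilon> * H v > 0 \<longrightarrow> (\<forall>p\<in>Z. G p + \<epsilon> * H p \<noteq> 0)"
  proof (rule eventually_no_zero_barrier[OF Z])
    show "continuous_on UNIV G" "continuous_on UNIV H"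
      by (intro real_polynomial_function_continuous_on G_poly H)+
  qed (use H(2) G0 pos in auto)
  then show ?thesis
  proof eventually_elim
    case (elim \<epsilon>)
    show ?case
    proof (intro impI ballI)
      fix p assume "S * \<tau> * \<epsilon> * H v > 0" and p: "p \<in> T \<eta>" "\<tau> * N l p = sg mv * N mv p"
      have "N l p = n l \<bullet> (p - v)" "N mv p = n mv \<bullet> (p - v)" using N_offset N_at_ends by blast+
      then have "n l \<bullet> (p - v - (\<tau> * N l p) *\<^sub>R a) = 0" "n mv \<bullet> (p - v - (\<tau> * N l p) *\<^sub>R a) = 0"
        using \<tau> mv p(2) by (auto simp: inner_diff_right a)
      then have "p - v - (\<tau> * N l p) *\<^sub>R a = 0"
        using det2_inner_eq_0[OF transversal[OF lines(1,2)]] lines by blast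
      then have "p = v + (\<tau> * N l p) *\<^sub>R a" by (simp add: algebra_simps)
      moreover have "\<tau> * N l p \<in> {- \<eta>..\<eta>}" using N_l_tube[OF p(1)] \<tau> by auto
      ultimately have "p \<in> Z" unfolding Z_def by blast
      then show "perturb G H \<epsilon> p \<noteq> 0" using elim \<open>S * \<tau> * \<epsilon> * H v > 0\<close> by blast
    qed
  qed
qed

text \<open>
  A component that is close to the frontier of the middle cell \<open>\<tau>\<close> contains points near the middle of the edge and points near
  the stub of \<open>mv\<close> in this frontier. The barrier separates them, so that it has to meet the component.
\<close>

lemma eventually_branch_side:
  "\<forall>\<^sub>F \<eta> in at_right 0. \<forall>\<^sub>F \<delta> in at_right 0. \<forall>H. real_polynomial_function H \<longrightarrow> H v \<noteq> 0 \<longrightarrow>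
    (\<forall>\<^sub>F \<epsilon> in at 0. \<forall>C \<tau>. C \<in> components ({q. perturb G H \<epsilon> q = 0} \<inter> T \<eta>) \<longrightarrow> (\<tau> = 1 \<or> \<tau> = -1) \<longrightarrow>
       hausdorff_close \<delta> C (frontier (middle_cell \<tau> \<eta>) \<inter> T \<eta>) \<longrightarrow> (\<exists>p\<in>C. dist p mid < \<delta>) \<longrightarrow>
       S * \<tau> * \<epsilon> * H v \<le> 0)"
proof -
  have lm: "l \<noteq> mv" using lines by blast
  have mv: "sg mv = 1 \<or> sg mv = -1" "mv \<in> A - {l}" using sg_cases lines by auto
  have "\<exists>a. n l \<bullet> a = \<tau> \<and> n mv \<bullet> a = sg mv" for \<tau>
    using det2_solve[OF transversal[OF lines(1,2) lm]] by blast
  then obtain a where a: "\<And>\<tau>. n l \<bullet> a \<tau> = \<tau>" "\<And>\<tau>. n mv \<bullet> a \<tau> = sg mv" by metis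
  obtain c where c: "n l \<bullet> c = 1" "n mv \<bullet> c = 0"
    using det2_solve[OF transversal[OF lines(1,2) lm], of 1 0] by blast
  have c0: "norm c > 0" using c by auto
  have 1: "\<forall>\<^sub>F \<eta> in at_right 0. \<forall>k\<in>A - {l, mv}. \<eta> * norm (a \<tau>) < sg k * N k v" for \<tau>
    using fin sg_pos_at_v by (intro eventually_ball_finite ballI eventually_mult_less_at_right) auto
  have 2: "\<forall>\<^sub>F \<eta> in at_right 0. \<forall>k\<in>A - {l, mv}. \<eta> * 1 < sg k * N k v"
    using fin sg_pos_at_v by (intro eventually_ball_finite ballI eventually_mult_less_at_right) auto
  show ?thesis
    using 1[of 1] 1[of "-1"] 2 eventually_at_right_0_pos
  proof eventually_elim
    case (elim \<eta>)
    note \<eta>1 = elim(1,2) and \<eta>2 = elim(3) and \<eta> = elim(4)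
    define r where "r = \<eta> / (2 * norm c)"
    have r: "r > 0" using \<eta> c0 by (simp add: r_def)
    have "\<forall>\<^sub>F \<delta> in at_right 0. (\<forall>k\<in>A - {l}. \<delta> * 2 < sg k * N k mid) \<and> \<delta> * 2 < r"
      using fin r sg_pos_on_edge[OF _ mid_in]
      by (intro eventually_conj eventually_ball_finite ballI eventually_mult_less_at_right) auto
    then show ?case using eventually_at_right_0_pos
    proof eventually_elim
      case (elim \<delta>)
      note \<delta> = this
      have stub: "\<exists>u\<in>frontier (middle_cell \<tau> \<eta>) \<inter> T \<eta>. \<tau> * N l u = r \<and> N mv u = 0"
        if \<tau>: "\<tau> = 1 \<or> \<tau> = -1" for \<tau>
      proof -
        \<comment> \<open>A point of \<open>mv\<close> at distance \<open>\<eta> / 2\<close> from \<open>v\<close>, on the side of the cell.\<close>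
        define u where "u = v + (\<tau> * r) *\<^sub>R c"
        have du: "dist v u = \<eta> / 2" using \<tau> c0 \<eta> by (auto simp: u_def dist_norm r_def)
        have Nu: "\<tau> * N l u = r" "N mv u = 0" using \<tau> by (auto simp: u_def N_add N_at_ends c)
        have uT: "u \<in> T \<eta>" by (rule segment_in_tube[of v]) (use du \<eta> in auto)
        have midT: "mid \<in> T \<eta>"
          by (rule segment_in_tube[of mid]) (use \<eta> open_closed_segment[OF mid_in] in auto)
        have Nk: "sg k * N k u > 0" if k: "k \<in> A - {l, mv}" for k
        proof -
          have "\<bar>N k u - N k v\<bar> \<le> \<eta> / 2" using N_lipschitz[of k u v] k du by (simp add: dist_commute)
          then show ?thesis using \<eta>2 k sg_cases[of k] \<eta> by force
        qed
        have cell: "(1 - t) *\<^sub>R u + t *\<^sub>R mid \<in> middle_cell \<tau> \<eta>" if t: "0 < t" "t < 1" for t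
        proof -
          have "(1 - t) *\<^sub>R u + t *\<^sub>R mid \<in> T \<eta>"
            using convex_T[of \<eta>] uT midT t by (simp add: convex_alt)
          moreover have "N l mid = 0" using N_l_segment open_closed_segment[OF mid_in] by blast
          then have "\<tau> * N l ((1 - t) *\<^sub>R u + t *\<^sub>R mid) = (1 - t) * r"
            unfolding N_convex_combination using Nu(1) by (simp add: algebra_simps)
          then have "\<tau> * N l ((1 - t) *\<^sub>R u + t *\<^sub>R mid) > 0" using t r by simp
          moreover have "sg k * N k ((1 - t) *\<^sub>R u + t *\<^sub>R mid) > 0" if k: "k \<in> A - {l}" for k
          proof -
            have "sg k * N k u \<ge> 0" using Nk[of k] Nu(2) k by (cases "k = mv") (auto intro: less_imp_le)
            moreover have "sg k * N k mid > 0" using sg_pos_on_edge[OF k mid_in] .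
            ultimately have "(1 - t) * (sg k * N k u) + t * (sg k * N k mid) > 0"
              using t by (intro add_nonneg_pos) auto
            then show ?thesis unfolding N_convex_combination by (simp add: algebra_simps)
          qed
          ultimately show ?thesis by (simp add: middle_cell_def)
        qed
        have "u \<in> closure (middle_cell \<tau> \<eta>)"
        proof (rule Lim_in_closed_set[OF closed_closure])
          show "\<forall>\<^sub>F t in at_right 0. (1 - t) *\<^sub>R u + t *\<^sub>R mid \<in> closure (middle_cell \<tau> \<eta>)"
            using eventually_at_right_real[of 0 1, OF zero_less_one]
            by eventually_elim (use cell closure_subset in auto)
          have "((\<lambda>t. (1 - t) *\<^sub>R u + t *\<^sub>R mid) \<longlongrightarrow> (1 - 0) *\<^sub>R u + 0 *\<^sub>R mid) (at_right 0)"
            by (intro tendsto_intros)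
          then show "((\<lambda>t. (1 - t) *\<^sub>R u + t *\<^sub>R mid) \<longlongrightarrow> u) (at_right 0)" by simp
        qed (rule trivial_limit_at_right_real)
        moreover have "u \<notin> interior (middle_cell \<tau> \<eta>)"
          using interior_subset[of "middle_cell \<tau> \<eta>"] Nu(2) mv(2) by (force simp: middle_cell_def)
        ultimately show ?thesis using Nu uT by (auto simp: frontier_def)
      qed
      show ?case
      proof (intro allI impI)
        fix H assume H: "real_polynomial_function H" "H v \<noteq> 0"
        have bar: "\<forall>\<^sub>F \<epsilon> in at 0. S * \<tau> * \<epsilon> * H v > 0 \<longrightarrow>
           (\<forall>p\<in>T \<eta>. \<tau> * N l p = sg mv * N mv p \<longrightarrow> perturb G H \<epsilon> p \<noteq> 0)" if "\<tau> = 1 \<or> \<tau> = -1" for \<tau>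
          by (rule eventually_barrier[OF H that a]) (use \<eta>1 that in blast)
        show "\<forall>\<^sub>F \<epsilon> in at 0. \<forall>C \<tau>. C \<in> components ({q. perturb G H \<epsilon> q = 0} \<inter> T \<eta>) \<longrightarrow> (\<tau> = 1 \<or> \<tau> = -1) \<longrightarrow>
           hausdorff_close \<delta> C (frontier (middle_cell \<tau> \<eta>) \<inter> T \<eta>) \<longrightarrow> (\<exists>p\<in>C. dist p mid < \<delta>) \<longrightarrow>
           S * \<tau> * \<epsilon> * H v \<le> 0"
          using bar[OF disjI1[OF refl]] bar[OF disjI2[OF refl]]
        proof eventually_elim
          case (elim \<epsilon>)
          show ?case
          proof (intro allI impI)
            fix C and \<tau> :: real
            assume C: "C \<in> components ({q. perturb G H \<epsilon> q = 0} \<inter> T \<eta>)" and \<tau>: "\<tau> = 1 \<or> \<tau> = -1"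
              and close: "hausdorff_close \<delta> C (frontier (middle_cell \<tau> \<eta>) \<inter> T \<eta>)"
              and "\<exists>p\<in>C. dist p mid < \<delta>"
            then obtain p where p: "p \<in> C" "dist p mid < \<delta>" by blast
            \<comment> \<open>The barrier is the zero set of \<open>f\<close>.\<close>
            define f where "f = (\<lambda>q. \<tau> * N l q - sg mv * N mv q)"
            have bar': "S * \<tau> * \<epsilon> * H v > 0 \<longrightarrow>
              (\<forall>p\<in>T \<eta>. \<tau> * N l p = sg mv * N mv p \<longrightarrow> perturb G H \<epsilon> p \<noteq> 0)"
              using elim \<tau> by auto
            obtain u where u: "u \<in> frontier (middle_cell \<tau> \<eta>) \<inter> T \<eta>" "\<tau> * N l u = r" "N mv u = 0"
              using stub[OF \<tau>] by blast
            obtain x where x: "x \<in> C" "dist x u < \<delta>" using close u(1) unfolding hausdorff_close_def by blast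
            have "f p \<le> 0"
            proof -
              have "\<bar>N l p\<bar> \<le> dist p mid"
                using N_lipschitz[OF lines(1), of p mid] N_l_segment open_closed_segment[OF mid_in] by fastforce
              moreover have "sg mv * N mv mid - \<delta> \<le> sg mv * N mv p"
                using N_near_mid[OF mv(2)] p(2) by simp
              moreover have "\<delta> * 2 < sg mv * N mv mid" using \<delta>(1) mv(2) by blast
              ultimately show ?thesis using p(2) \<tau> by (auto simp: f_def)
            qed
            moreover have "0 \<le> f x"
            proof -
              have "\<bar>N l x - N l u\<bar> \<le> dist x u" "\<bar>N mv x - N mv u\<bar> \<le> dist x u"
                using N_lipschitz lines by blast+
              then show ?thesis using x(2) u(2,3) \<delta>(1) \<tau> mv(1) by (auto simp: f_def)
            qed
            moreover have "continuous_on C f" unfolding f_def by (intro continuous_intros)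
            ultimately obtain z where z: "z \<in> C" "f z = 0"
              using connected_opposite_signs[OF in_components_connected[OF C] _ p(1) x(1)] by blast
            then have "z \<in> T \<eta>" "perturb G H \<epsilon> z = 0" using in_components_subset[OF C] by auto
            then show "S * \<tau> * \<epsilon> * H v \<le> 0"
              using bar' z(2) unfolding f_def by (metis eq_iff_diff_eq_0 not_le)
          qed
        qed
      qed
    qed
  qed
qed

end

lemma (in bounded_edge) swap_simps:
  "bounded_edge.mid w v = mid" "bounded_edge.sg n b w v = sg" "bounded_edge.S A n b l w v = S"
  "bounded_edge.middle_cell A n b l w v = middle_cell" "open_segment w v = open_segment v w"
proof -
  interpret sw: bounded_edge A n b l w v mw mv by (rule swap)
  show 1: "sw.mid = mid" by (simp add: sw.mid_def mid_def midpoint_sym)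
  show 2: "sw.sg = sg" by (simp add: sw.sg_def sg_def fun_eq_iff 1)
  show "sw.S = S" by (simp add: sw.S_def S_def 2)
  show 3: "open_segment w v = open_segment v w" by (rule open_segment_commute)
  show "sw.middle_cell = middle_cell"
    by (simp add: sw.middle_cell_def middle_cell_def fun_eq_iff 2 3)
qed

text \<open>
  The component through a point near the middle of the edge is close to the frontier of one middle cell, and
  \<open>eventually_branch_side\<close> at both ends shows that \<open>\<epsilon> H v\<close> and \<open>\<epsilon> H w\<close> have the sign opposite to that of \<open>G\<close> in this cell.
\<close>

lemma (in bounded_edge) eventually_respected_imp_same_side:
  "\<forall>\<^sub>F \<eta> in at_right 0. \<forall>\<^sub>F \<delta> in at_right 0. \<forall>H. real_polynomial_function H \<longrightarrow> (\<forall>c\<in>crunodes A. H c \<noteq> 0) \<longrightarrow>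
    (\<forall>\<^sub>F \<epsilon> in at 0. respects_edge \<eta> \<delta> A {q. perturb G H \<epsilon> q = 0} (open_segment v w) \<longrightarrow> H v * H w > 0)"
proof -
  interpret sw: bounded_edge A n b l w v mw mv by (rule swap)
  show ?thesis
    using eventually_branch_side sw.eventually_branch_side[unfolded swap_simps] eventually_at_right_0_pos
  proof eventually_elim
    case (elim \<eta>)
    note \<eta> = elim(3)
    have "\<forall>\<^sub>F \<delta> in at_right 0. (\<forall>k\<in>A - {l}. \<delta> * 2 < sg k * N k mid) \<and> \<delta> * 1 < \<eta>"
      using fin \<eta> sg_pos_on_edge[OF _ mid_in]
      by (intro eventually_conj eventually_ball_finite ballI eventually_mult_less_at_right) auto
    from elim(1,2) this eventually_at_right_0_pos show ?case
    proof eventually_elim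
      case (elim \<delta>)
      note side_v = elim(1) and side_w = elim(2) and \<delta> = elim(3,4)
      show ?case
      proof (intro allI impI)
        fix H assume H: "real_polynomial_function H" "\<forall>c\<in>crunodes A. H c \<noteq> 0"
        have "v \<in> crunodes A" "w \<in> crunodes A" using lines ends unfolding crunodes_def by blast+
        then have Hvw: "H v \<noteq> 0" "H w \<noteq> 0" using H(2) by blast+
        have zero: "\<forall>\<^sub>F \<epsilon> in at 0. \<exists>y. - (\<delta> / 2) \<le> y \<and> y \<le> \<delta> / 2 \<and> perturb G H \<epsilon> (mid + y *\<^sub>R n l) = 0"
        proof (rule eventually_zero_across_edge[OF H(1)])
          show "\<delta> / 2 < sg k * N k mid" if "k \<in> A - {l}" for k
            using bspec[OF conjunct1[OF \<delta>(1)] that] \<delta>(2) by linarith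
        qed (use \<delta> in simp)
        have nz: "\<forall>\<^sub>F \<epsilon> in at 0. \<epsilon> \<noteq> (0::real)" by (simp add: eventually_neq_at_within)
        from mp[OF mp[OF spec[OF side_v] H(1)] Hvw(1)] mp[OF mp[OF spec[OF side_w] H(1)] Hvw(2)] zero nz
        show "\<forall>\<^sub>F \<epsilon> in at 0. respects_edge \<eta> \<delta> A {q. perturb G H \<epsilon> q = 0} (open_segment v w) \<longrightarrow> H v * H w > 0"
        proof eventually_elim
          case (elim \<epsilon>)
          show ?case
          proof
            let ?R = "{q. perturb G H \<epsilon> q = 0}"
            assume resp: "respects_edge \<eta> \<delta> A ?R (open_segment v w)"
            obtain y where "- (\<delta> / 2) \<le> y \<and> y \<le> \<delta> / 2 \<and> perturb G H \<epsilon> (mid + y *\<^sub>R n l) = 0"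
              using elim(3) ..
            then have y: "\<bar>y\<bar> \<le> \<delta> / 2" "perturb G H \<epsilon> (mid + y *\<^sub>R n l) = 0" by auto
            let ?p = "mid + y *\<^sub>R n l"
            have dp: "dist ?p mid < \<delta>" using y(1) \<delta> unit[OF lines(1)] by (simp add: dist_norm)
            have "dist mid ?p < \<eta>" using dp \<delta>(1) by (simp add: dist_commute)
            then have "?p \<in> ?R \<inter> T \<eta>"
              using segment_in_tube[OF open_closed_segment[OF mid_in]] y(2) by auto
            then obtain C where C: "C \<in> components (?R \<inter> T \<eta>)" "?p \<in> C"
              using Union_components[of "?R \<inter> T \<eta>"] by blast
            obtain D where D: "D \<in> components (T \<eta> - \<Union>A)" "hausdorff_close \<delta> C (frontier D \<inter> T \<eta>)"
              using resp C(1) unfolding respects_edge_def by blast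
            obtain q where q: "q \<in> frontier D" "dist ?p q < \<delta>" using D(2) C(2) unfolding hausdorff_close_def by blast
            have "dist q mid < 2 * \<delta>" using q(2) dp dist_triangle[of q mid ?p] by (simp add: dist_commute)
            then obtain \<tau> where \<tau>: "\<tau> = 1 \<or> \<tau> = -1" "D = middle_cell \<tau> \<eta>"
              using component_near_mid[OF D(1) q(1)] \<delta>(1) by (metis mult.commute)
            have near: "\<exists>p\<in>C. dist p mid < \<delta>" using C(2) dp by blast
            have "S * \<tau> * \<epsilon> * H v \<le> 0" "S * \<tau> * \<epsilon> * H w \<le> 0"
              using elim(1,2) C(1) \<tau>(1) D(2)[unfolded \<tau>(2)] near by blast+
            moreover have "S * \<tau> * \<epsilon> \<noteq> 0" using S_cases \<tau>(1) elim(4) by auto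
            ultimately have "(S * \<tau> * \<epsilon>)\<^sup>2 * (H v * H w) \<ge> 0"
              using mult_nonpos_nonpos[of "S * \<tau> * \<epsilon> * H v" "S * \<tau> * \<epsilon> * H w"]
              by (simp add: power2_eq_square algebra_simps)
            moreover have "(S * \<tau> * \<epsilon>)\<^sup>2 > 0" using \<open>S * \<tau> * \<epsilon> \<noteq> 0\<close> by simp
            ultimately have "H v * H w \<ge> 0" by (simp add: zero_le_mult_iff)
            then show "H v * H w > 0" using Hvw by (simp add: less_le)
          qed
        qed
      qed
    qed
  qed
qed

section \<open>Level curves of a product of linear forms\<close>

lemma prod_le_exp_sum:
  fixes r :: "'a \<Rightarrow> real"
  assumes "finite I" "\<And>i. i \<in> I \<Longrightarrow> r i \<ge> 0"
  shows "(\<Prod>i\<in>I. r i) \<le> exp ((\<Sum>i\<in>I. r i) - real (card I))"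
proof -
  have "(\<Prod>i\<in>I. r i) \<le> (\<Prod>i\<in>I. exp (r i - 1))"
    using assms(2) exp_ge_add_one_self[of "r _ - 1"] by (intro prod_mono) auto
  also have "\<dots> = exp ((\<Sum>i\<in>I. r i) - real (card I))"
    using assms(1) by (simp add: exp_sum[symmetric] sum_subtractf)
  finally show ?thesis .
qed

lemma eventually_at_0_abs:
  assumes "\<forall>\<^sub>F e in at_right 0. P (e::real)"
  shows "\<forall>\<^sub>F \<epsilon> in at 0. P \<bar>\<epsilon>\<bar>"
proof -
  obtain b where "b > 0" "\<And>e. 0 < e \<Longrightarrow> e < b \<Longrightarrow> P e"
    using assms by (auto simp: eventually_at_right_field)
  then show ?thesis by (auto simp: eventually_at dist_norm intro!: exI[of _ b])
qed

text \<open>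
  Used with sets \<open>C\<close> that are segments from the points of \<open>X\<close> to \<open>Y\<close>.
\<close>

lemma connected_star_over:
  assumes Y: "connected Y" and C: "\<And>p. p \<in> X \<Longrightarrow> \<exists>C. connected C \<and> p \<in> C \<and> C \<subseteq> X \<union> Y \<and> C \<inter> Y \<noteq> {}"
  shows "connected (X \<union> Y)"
proof (cases "Y = {}")
  case True
  then have "X = {}" using C by blast
  then show ?thesis using True by simp
next
  case False
  then obtain y where y: "y \<in> Y" by blast
  have Ycomp: "Y \<subseteq> connected_component_set (X \<union> Y) y"
    using Y y by (intro connected_component_maximal) auto
  have "X \<union> Y \<subseteq> connected_component_set (X \<union> Y) y"
  proof
    fix p assume "p \<in> X \<union> Y"
    then show "p \<in> connected_component_set (X \<union> Y) y"
    proof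
      assume "p \<in> X"
      from C[OF this] obtain D where D: "connected D" "p \<in> D" "D \<subseteq> X \<union> Y" "D \<inter> Y \<noteq> {}" by blast
      then have "connected (D \<union> Y)" using Y by (intro connected_Un) auto
      then have "D \<union> Y \<subseteq> connected_component_set (X \<union> Y) y"
        using D y by (intro connected_component_maximal) auto
      then show ?thesis using D(2) by blast
    qed (use Ycomp in blast)
  qed
  with connected_component_subset have eq: "connected_component_set (X \<union> Y) y = X \<union> Y"
    by (rule subset_antisym)
  have "connected (connected_component_set (X \<union> Y) y)" by (rule connected_connected_component)
  then show ?thesis unfolding eq .
qed

context line_arrangement begin

definition cell :: "(real^2) set \<Rightarrow> ((real^2) set \<Rightarrow> real) \<Rightarrow> (real^2) set" where
  "cell U \<sigma> = {q \<in> U. \<forall>k\<in>A. \<sigma> k * N k q > 0}"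

lemma open_cell: "open U \<Longrightarrow> open (cell U \<sigma>)"
proof -
  assume "open U"
  moreover have "cell U \<sigma> = U \<inter> (\<Inter>k\<in>A. {q. \<sigma> k * N k q > 0})" by (auto simp: cell_def)
  ultimately show ?thesis using fin by (auto intro!: open_Int open_INT open_Collect_less continuous_intros)
qed

lemma cell_segment:
  assumes U: "convex U" "y \<in> U" and y: "\<And>k. k \<in> A \<Longrightarrow> \<sigma> k * N k y \<ge> 0" and a: "a \<in> cell U \<sigma>"
    and s: "0 < s" "s \<le> 1"
  shows "(1 - s) *\<^sub>R y + s *\<^sub>R a \<in> cell U \<sigma>"
proof -
  have "(1 - s) *\<^sub>R y + s *\<^sub>R a \<in> U" using U a s by (simp add: cell_def convex_alt)
  moreover have "\<sigma> k * N k ((1 - s) *\<^sub>R y + s *\<^sub>R a) > 0" if k: "k \<in> A" for k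
  proof -
    have "(1 - s) * (\<sigma> k * N k y) + s * (\<sigma> k * N k a) > 0"
      using y[OF k] a s k by (intro add_nonneg_pos) (auto simp: cell_def)
    then show ?thesis unfolding N_convex_combination by (simp add: algebra_simps)
  qed
  ultimately show ?thesis by (simp add: cell_def)
qed

lemma convex_cell: "convex U \<Longrightarrow> convex (cell U \<sigma>)"
  unfolding convex_alt
proof (intro ballI allI impI, elim conjE)
  fix x y and s :: real assume U: "\<forall>x\<in>U. \<forall>y\<in>U. \<forall>u. 0 \<le> u \<and> u \<le> 1 \<longrightarrow> (1 - u) *\<^sub>R x + u *\<^sub>R y \<in> U"
    and x: "x \<in> cell U \<sigma>" and y: "y \<in> cell U \<sigma>" and s: "0 \<le> s" "s \<le> 1"
  show "(1 - s) *\<^sub>R x + s *\<^sub>R y \<in> cell U \<sigma>"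
  proof (cases "s = 0")
    case False
    have "convex U" using U by (simp add: convex_alt)
    then show ?thesis using cell_segment[of U x \<sigma> y s] x y s False by (force simp: cell_def)
  qed (use x in simp)
qed

lemma cell_closure:
  assumes "x \<in> closure (cell U \<sigma>)" "k \<in> A"
  shows "\<sigma> k * N k x \<ge> 0"
proof -
  have "closed {q. \<sigma> k * N k q \<ge> 0}" by (intro closed_Collect_le continuous_intros)
  moreover have "cell U \<sigma> \<subseteq> {q. \<sigma> k * N k q \<ge> 0}" using assms(2) by (auto simp: cell_def intro: less_imp_le)
  ultimately show ?thesis using closure_minimal assms(1) by blast
qed

lemma mem_closure_cell:
  assumes U: "convex U" "y \<in> U" and y: "\<And>k. k \<in> A \<Longrightarrow> \<sigma> k * N k y \<ge> 0" and a: "a \<in> cell U \<sigma>"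
  shows "y \<in> closure (cell U \<sigma>)"
proof (rule Lim_in_closed_set[OF closed_closure])
  show "\<forall>\<^sub>F s in at_right 0. (1 - s) *\<^sub>R y + s *\<^sub>R a \<in> closure (cell U \<sigma>)"
    using eventually_at_right_real[of 0 1, OF zero_less_one]
  proof eventually_elim
    case (elim s)
    then have "(1 - s) *\<^sub>R y + s *\<^sub>R a \<in> cell U \<sigma>" by (intro cell_segment U y a) auto
    then show ?case using closure_subset by blast
  qed
  have "((\<lambda>s. (1 - s) *\<^sub>R y + s *\<^sub>R a) \<longlongrightarrow> (1 - 0) *\<^sub>R y + 0 *\<^sub>R a) (at_right 0)" by (intro tendsto_intros)
  then show "((\<lambda>s. (1 - s) *\<^sub>R y + s *\<^sub>R a) \<longlongrightarrow> y) (at_right 0)" by simp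
qed (rule trivial_limit_at_right_real)

lemma cell_is_component:
  assumes "C = {p \<in> X. \<forall>k\<in>A. \<sigma> k * N k p > 0}" "connected C" "C \<noteq> {}" "X \<inter> \<Union>A = {}"
  shows "C \<in> components X"
proof -
  have max: "D = C" if D: "C \<subseteq> D" "D \<subseteq> X" "connected D" for D
  proof -
  obtain c where c: "c \<in> C" using assms(3) by blast
  have "d \<in> C" if d: "d \<in> D" for d
  proof -
    have "\<sigma> k * N k d > 0" if k: "k \<in> A" for k
    proof (rule connected_constant_sign[where f = "\<lambda>q. \<sigma> k * N k q" and C = D and x = c])
      have \<sigma>k: "\<sigma> k * N k c > 0" using c k assms(1) by blast
      then show "\<sigma> k * N k c > 0" .
      show "\<sigma> k * N k z \<noteq> 0" if "z \<in> D" for z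
        using that D(2) assms(4) k mem_line[of k z] \<sigma>k by auto
    qed (use D c d in \<open>auto intro!: continuous_intros\<close>)
    then show ?thesis using d D(2) assms(1) by blast
  qed
  then show "D = C" using D by blast
  qed
  show ?thesis unfolding in_components_maximal using assms max by auto
qed

text \<open>
  By \<open>\<Prod>r \<le> exp (\<Sum>(r - 1))\<close>, applied to the quotients of the values of the forms, \<open>\<bar>G\<bar>\<close> is nowhere on the segment larger than
  at \<open>p\<close> if the mean of the quotients \<open>N k z / N k p\<close> is at most one. This covers points \<open>z\<close> on the boundary of the cell.
\<close>

lemma abs_G_decreasing:
  assumes p: "\<And>k. k \<in> A \<Longrightarrow> N k p \<noteq> 0" and z: "\<And>k. k \<in> A \<Longrightarrow> N k z / N k p \<ge> 0"
    and sum: "(\<Sum>k\<in>A. N k z / N k p) \<le> real (card A)" and s: "0 \<le> s" "s \<le> 1"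
  shows "\<bar>G ((1 - s) *\<^sub>R z + s *\<^sub>R p)\<bar> \<le> \<bar>G p\<bar>"
proof -
  define q where "q = (1 - s) *\<^sub>R z + s *\<^sub>R p"
  have r: "N k q / N k p = (1 - s) * (N k z / N k p) + s" if "k \<in> A" for k
    using p[OF that] unfolding q_def N_convex_combination by (simp add: add_divide_distrib)
  have "(\<Sum>k\<in>A. N k q / N k p) = (1 - s) * (\<Sum>k\<in>A. N k z / N k p) + real (card A) * s"
    by (simp add: r sum.distrib sum_distrib_left)
  also have "\<dots> \<le> (1 - s) * real (card A) + real (card A) * s"
    using sum s by (intro add_right_mono mult_left_mono) auto
  finally have le: "(\<Sum>k\<in>A. N k q / N k p) \<le> real (card A)" by (simp add: algebra_simps)
  have nn: "N k q / N k p \<ge> 0" if "k \<in> A" for k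
    unfolding r[OF that] using z[OF that] s by (intro add_nonneg_nonneg mult_nonneg_nonneg) auto
  have "(\<Prod>k\<in>A. N k q / N k p) \<le> exp ((\<Sum>k\<in>A. N k q / N k p) - real (card A))"
    by (rule prod_le_exp_sum[OF fin nn])
  also have "\<dots> \<le> exp 0" using le by simp
  finally have "(\<Prod>k\<in>A. N k q / N k p) \<le> 1" by simp
  moreover have "(\<Prod>k\<in>A. N k q / N k p) \<ge> 0" by (intro prod_nonneg) (use nn in blast)
  moreover have "(\<Prod>k\<in>A. N k q / N k p) = G q / G p" by (simp add: G_def prod_dividef)
  ultimately have "\<bar>G q / G p\<bar> \<le> 1" by simp
  moreover have "G p \<noteq> 0" using p by (auto simp: G_eq_0)
  ultimately show ?thesis by (simp add: q_def abs_divide)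
qed

text \<open>
  On the cell \<open>\<bar>G\<bar>\<close> is logarithmically concave, so that between \<open>p\<close> and \<open>a\<close> it exceeds the smaller of its values there. This
  follows from the same inequality: the quotients of the values of a form at \<open>p\<close> and at \<open>a\<close> by its value at \<open>q\<close> have
  the weighted mean one.
\<close>

lemma abs_G_level_unique:
  assumes p: "\<And>k. k \<in> A \<Longrightarrow> \<sigma> k * N k p > 0" and a: "\<And>k. k \<in> A \<Longrightarrow> \<sigma> k * N k a > 0"
    and t: "0 < t" "t < 1" and less: "\<bar>G p\<bar> < \<bar>G a\<bar>"
  shows "\<bar>G ((1 - t) *\<^sub>R p + t *\<^sub>R a)\<bar> > \<bar>G p\<bar>"
proof (rule ccontr)
  define q where "q = (1 - t) *\<^sub>R p + t *\<^sub>R a"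
  assume "\<not> \<bar>G ((1 - t) *\<^sub>R p + t *\<^sub>R a)\<bar> > \<bar>G p\<bar>"
  then have le: "\<bar>G q\<bar> \<le> \<bar>G p\<bar>" by (simp add: q_def)
  have q: "\<sigma> k * N k q > 0" if k: "k \<in> A" for k
  proof -
    have "(1 - t) * (\<sigma> k * N k p) + t * (\<sigma> k * N k a) > 0"
      using p[OF k] a[OF k] t by (intro add_pos_pos) auto
    then show ?thesis unfolding q_def N_convex_combination by (simp add: algebra_simps)
  qed
  have q0: "N k q \<noteq> 0" if "k \<in> A" for k using q[OF that] by auto
  then have G0: "\<bar>G q\<bar> > 0" by (auto simp: G_eq_0)
  have quot: "\<bar>G x\<bar> / \<bar>G q\<bar> \<le> exp ((\<Sum>k\<in>A. N k x / N k q) - real (card A))"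
    if x: "\<And>k. k \<in> A \<Longrightarrow> \<sigma> k * N k x > 0" for x
  proof -
    have nn: "N k x / N k q \<ge> 0" if k: "k \<in> A" for k
      using x[OF k] q[OF k] by (auto simp: zero_less_mult_iff zero_le_divide_iff)
    have "(\<Prod>k\<in>A. N k x / N k q) \<ge> 0" by (intro prod_nonneg) (use nn in blast)
    moreover have "(\<Prod>k\<in>A. N k x / N k q) = G x / G q" by (simp add: G_def prod_dividef)
    ultimately have "\<bar>G x\<bar> / \<bar>G q\<bar> = (\<Prod>k\<in>A. N k x / N k q)" by (simp flip: abs_divide)
    then show ?thesis using prod_le_exp_sum[OF fin nn] by simp
  qed
  have "1 \<le> \<bar>G p\<bar> / \<bar>G q\<bar>" using le G0 by simp
  also have "\<dots> \<le> exp ((\<Sum>k\<in>A. N k p / N k q) - real (card A))" by (rule quot[OF p])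
  finally have 1: "(\<Sum>k\<in>A. N k p / N k q) \<ge> real (card A)" by simp
  have "1 < \<bar>G a\<bar> / \<bar>G q\<bar>" using le less G0 by simp
  also have "\<dots> \<le> exp ((\<Sum>k\<in>A. N k a / N k q) - real (card A))" by (rule quot[OF a])
  finally have 2: "(\<Sum>k\<in>A. N k a / N k q) > real (card A)" by simp
  have "(1 - t) * (\<Sum>k\<in>A. N k p / N k q) + t * (\<Sum>k\<in>A. N k a / N k q) = (\<Sum>k\<in>A. 1)"
  proof -
    have "(1 - t) * (N k p / N k q) + t * (N k a / N k q) = 1" if "k \<in> A" for k
    proof -
      have "(1 - t) * N k p + t * N k a = N k q" by (simp add: q_def N_convex_combination)
      then show ?thesis using q0[OF that] by (simp add: add_divide_distrib[symmetric])
    qed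
    then show ?thesis by (simp add: sum_distrib_left sum.distrib[symmetric])
  qed
  moreover have "(1 - t) * (\<Sum>k\<in>A. N k p / N k q) \<ge> (1 - t) * real (card A)"
    using 1 t by (intro mult_left_mono) auto
  moreover have "t * (\<Sum>k\<in>A. N k a / N k q) > t * real (card A)" using 2 t by simp
  ultimately show False by (simp add: algebra_simps)
qed

text \<open>
  Let \<open>X\<close> be the part of the cell where \<open>\<bar>G\<bar> \<le> e\<close>. Every segment from a point of \<open>X \<union> Y\<close> to \<open>a\<close> meets the level \<open>e\<close> exactly once, and
  the point where it does depends continuously on the starting point, by the closed graph theorem. So the level curve is a
  continuous image of \<open>X \<union> Y\<close>. The hypothesis on \<open>Y\<close> makes the segments from the points of \<open>X\<close> to suitable points of \<open>Y\<close> stay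
  in \<open>X \<union> Y\<close>, which is thus connected.
\<close>

lemma connected_level_in_cell:
  assumes U: "convex U" and a: "a \<in> cell U \<sigma>" "\<bar>G a\<bar> > e" and e: "e > 0"
    and Y: "connected Y" "Y \<noteq> {}" "Y \<subseteq> U" "\<And>y k. y \<in> Y \<Longrightarrow> k \<in> A \<Longrightarrow> \<sigma> k * N k y \<ge> 0" "\<And>y. y \<in> Y \<Longrightarrow> G y = 0"
    and star: "\<And>p. p \<in> cell U \<sigma> \<Longrightarrow> \<exists>z\<in>Y. (\<Sum>k\<in>A. N k z / N k p) \<le> real (card A)"
  shows "connected {q \<in> cell U \<sigma>. \<bar>G q\<bar> = e}" "{q \<in> cell U \<sigma>. \<bar>G q\<bar> = e} \<noteq> {}"
proof -
  define X where "X = {p \<in> cell U \<sigma>. \<bar>G p\<bar> \<le> e}"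
  have cell_pos: "\<sigma> k * N k p > 0" if "p \<in> cell U \<sigma>" "k \<in> A" for p k using that by (simp add: cell_def)
  have XY: "connected (X \<union> Y)"
  proof (rule connected_star_over[OF Y(1)])
    fix p assume p: "p \<in> X"
    then have pc: "p \<in> cell U \<sigma>" "\<bar>G p\<bar> \<le> e" by (auto simp: X_def)
    obtain z where z: "z \<in> Y" "(\<Sum>k\<in>A. N k z / N k p) \<le> real (card A)" using star[OF pc(1)] by blast
    have "closed_segment z p \<subseteq> X \<union> Y"
    proof
      fix q assume "q \<in> closed_segment z p"
      then obtain s where s: "0 \<le> s" "s \<le> 1" "q = (1 - s) *\<^sub>R z + s *\<^sub>R p" by (auto simp: in_segment)
      show "q \<in> X \<union> Y"
      proof (cases "s = 0")
        case True then show ?thesis using s z by simp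
      next
        case False
        have "q \<in> cell U \<sigma>"
          unfolding s(3) using False s z Y by (intro cell_segment U pc) auto
        moreover have "\<bar>G q\<bar> \<le> \<bar>G p\<bar>"
          unfolding s(3)
        proof (rule abs_G_decreasing[OF _ _ z(2) s(1,2)])
          fix k assume k: "k \<in> A"
          show "N k p \<noteq> 0" using cell_pos[OF pc(1) k] by auto
          show "N k z / N k p \<ge> 0" using cell_pos[OF pc(1) k] Y(4)[OF z(1) k]
            by (auto simp: zero_less_mult_iff zero_le_mult_iff zero_le_divide_iff)
        qed
        ultimately show ?thesis using pc(2) by (simp add: X_def)
      qed
    qed
    then show "\<exists>C. connected C \<and> p \<in> C \<and> C \<subseteq> X \<union> Y \<and> C \<inter> Y \<noteq> {}"
      using z(1) by (intro exI[of _ "closed_segment z p"]) auto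
  qed
  define pt where "pt = (\<lambda>p s. (1 - s) *\<^sub>R p + s *\<^sub>R a)"
  have XYU: "p \<in> U" "\<And>k. k \<in> A \<Longrightarrow> \<sigma> k * N k p \<ge> 0" if "p \<in> X \<union> Y" for p
  proof -
    have pc: "p \<in> cell U \<sigma> \<or> p \<in> Y" using that by (auto simp: X_def)
    then show "p \<in> U" using Y(3) by (auto simp: cell_def)
    show "\<sigma> k * N k p \<ge> 0" if "k \<in> A" for k
      using pc cell_pos[OF _ that, of p] Y(4)[OF _ that, of p] by linarith
  qed
  have low: "\<bar>G p\<bar> \<le> e" if "p \<in> X \<union> Y" for p using that Y(5) e by (auto simp: X_def)
  have cont: "continuous_on S (\<lambda>x. \<bar>G (pt (fst x) (snd x))\<bar>)" for S
    unfolding pt_def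
    by (intro continuous_on_rabs continuous_on_compose2[OF real_polynomial_function_continuous_on[OF G_poly, of UNIV]])
      (auto intro!: continuous_intros)
  have ptcell: "pt p s \<in> cell U \<sigma>" if p: "p \<in> X \<union> Y" and s: "0 \<le> s" "s \<le> 1" and G: "\<bar>G (pt p s)\<bar> = e" for p s
  proof (cases "s = 0")
    case True
    then have "\<bar>G p\<bar> = e" "pt p s = p" using G by (simp_all add: pt_def)
    then show ?thesis using p Y(5) e by (auto simp: X_def)
  next
    case False
    then show ?thesis unfolding pt_def using s XYU[OF p] by (intro cell_segment U a) auto
  qed
  have ex: "\<exists>s. 0 \<le> s \<and> s \<le> 1 \<and> \<bar>G (pt p s)\<bar> = e" if p: "p \<in> X \<union> Y" for p
  proof (rule IVT')
    show "\<bar>G (pt p 0)\<bar> \<le> e" using low[OF p] by (simp add: pt_def)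
    show "e \<le> \<bar>G (pt p 1)\<bar>" using a by (simp add: pt_def)
    show "continuous_on {0..1} (\<lambda>s. \<bar>G (pt p s)\<bar>)"
      using continuous_on_compose2[OF cont[of UNIV], of "{0..1}" "\<lambda>s. (p, s)"]
      by (simp add: continuous_on_Pair continuous_on_const continuous_on_id)
  qed simp
  have uniq: "s = s'" if p: "p \<in> X \<union> Y" and s: "0 \<le> s" "s \<le> 1" "\<bar>G (pt p s)\<bar> = e"
      and s': "0 \<le> s'" "s' \<le> 1" "\<bar>G (pt p s')\<bar> = e" for p s s'
  proof -
    have no: "\<not> s < s'" if s: "0 \<le> s" "s \<le> 1" "\<bar>G (pt p s)\<bar> = e" and s': "0 \<le> s'" "s' \<le> 1" "\<bar>G (pt p s')\<bar> = e" for s s'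
    proof
      assume lt: "s < s'"
      have "s' \<noteq> 1" using s'(3) a by (auto simp: pt_def)
      define t where "t = (s' - s) / (1 - s)"
      have t: "0 < t" "t < 1" using lt s' \<open>s' \<noteq> 1\<close> by (auto simp: t_def divide_less_eq)
      have ts: "t * (1 - s) = s' - s" using lt s' by (simp add: t_def)
      have "pt p s' = (1 - t) *\<^sub>R pt p s + t *\<^sub>R a"
      proof -
        have "(1 - t) * (1 - s) = 1 - s'" "(1 - t) * s + t = s'" using ts by (simp_all add: algebra_simps)
        then have "(1 - t) *\<^sub>R pt p s + t *\<^sub>R a = (1 - s') *\<^sub>R p + s' *\<^sub>R a"
          by (simp add: pt_def scaleR_add_right scaleR_add_left[symmetric])
        then show ?thesis by (simp add: pt_def)
      qed
      moreover have "\<bar>G ((1 - t) *\<^sub>R pt p s + t *\<^sub>R a)\<bar> > \<bar>G (pt p s)\<bar>"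
        using cell_pos[OF ptcell[OF p s]] cell_pos[OF a(1)] t s(3) a(2)
        by (intro abs_G_level_unique) auto
      ultimately show False using s(3) s'(3) by simp
    qed
    show ?thesis using no[OF s s'] no[OF s' s] by simp
  qed
  define h where "h = (\<lambda>p. THE s. 0 \<le> s \<and> s \<le> 1 \<and> \<bar>G (pt p s)\<bar> = e)"
  have h: "0 \<le> h p \<and> h p \<le> 1 \<and> \<bar>G (pt p (h p))\<bar> = e" if "p \<in> X \<union> Y" for p
    unfolding h_def by (rule theI') (use ex[OF that] uniq[OF that] in blast)
  have "continuous_on (X \<union> Y) h"
  proof (subst continuous_closed_graph_eq[of "{0..1}"])
    show "h \<in> X \<union> Y \<rightarrow> {0..1}" using h by auto
    have "(\<lambda>x. (x, h x)) ` (X \<union> Y) = {x \<in> (X \<union> Y) \<times> {0..1}. \<bar>G (pt (fst x) (snd x))\<bar> = e}"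
    proof (intro equalityI subsetI)
      fix x assume "x \<in> {x \<in> (X \<union> Y) \<times> {0..1}. \<bar>G (pt (fst x) (snd x))\<bar> = e}"
      then have x: "fst x \<in> X \<union> Y" "0 \<le> snd x" "snd x \<le> 1" "\<bar>G (pt (fst x) (snd x))\<bar> = e" by auto
      then have "snd x = h (fst x)" using uniq[OF x] h[OF x(1)] by blast
      then show "x \<in> (\<lambda>x. (x, h x)) ` (X \<union> Y)" using x(1) by (intro image_eqI[of _ _ "fst x"]) (auto simp: prod_eq_iff)
    qed (use h in force)
    then show "closedin (top_of_set ((X \<union> Y) \<times> {0..1})) ((\<lambda>x. (x, h x)) ` (X \<union> Y))"
      using continuous_closedin_preimage_constant[OF cont] by simp
  qed simp
  then have "continuous_on (X \<union> Y) (\<lambda>p. pt p (h p))"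
    unfolding pt_def by (intro continuous_intros)
  then have "connected ((\<lambda>p. pt p (h p)) ` (X \<union> Y))" using XY by (rule connected_continuous_image)
  moreover have img: "(\<lambda>p. pt p (h p)) ` (X \<union> Y) = {q \<in> cell U \<sigma>. \<bar>G q\<bar> = e}"
  proof (intro equalityI subsetI)
    fix q assume "q \<in> (\<lambda>p. pt p (h p)) ` (X \<union> Y)"
    then obtain p where p: "p \<in> X \<union> Y" "q = pt p (h p)" by blast
    from h[OF p(1)] ptcell[OF p(1)] show "q \<in> {q \<in> cell U \<sigma>. \<bar>G q\<bar> = e}" unfolding p(2) by blast
  next
    fix q assume q: "q \<in> {q \<in> cell U \<sigma>. \<bar>G q\<bar> = e}"
    then have qX: "q \<in> X \<union> Y" by (auto simp: X_def)
    have "h q = 0"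
    proof (rule uniq[OF qX])
      show "\<bar>G (pt q 0)\<bar> = e" using q by (simp add: pt_def)
    qed (use h[OF qX] in auto)
    then have "q = pt q (h q)" by (simp add: pt_def)
    then show "q \<in> (\<lambda>p. pt p (h p)) ` (X \<union> Y)" using qX by (rule image_eqI)
  qed
  ultimately show "connected {q \<in> cell U \<sigma>. \<bar>G q\<bar> = e}" by simp
  show "{q \<in> cell U \<sigma>. \<bar>G q\<bar> = e} \<noteq> {}" unfolding img[symmetric] using Y(2) by blast
qed

lemma frontier_cell:
  assumes "open U"
  shows "frontier (cell U \<sigma>) = closure (cell U \<sigma>) - cell U \<sigma>"
  using open_cell[OF assms] by (simp add: frontier_def interior_open)

lemma frontier_cell_G:
  assumes "open U" "y \<in> frontier (cell U \<sigma>) \<inter> U"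
  shows "G y = 0"
proof -
  have y: "y \<in> closure (cell U \<sigma>)" "y \<notin> cell U \<sigma>" "y \<in> U" using assms by (auto simp: frontier_cell)
  then obtain k where k: "k \<in> A" "\<not> \<sigma> k * N k y > 0" by (auto simp: cell_def)
  then have "\<sigma> k * N k y = 0" using cell_closure[OF y(1) k(1)] by simp
  moreover obtain q where "q \<in> cell U \<sigma>" using y(1) by (metis closure_empty empty_iff equals0I)
  then have "\<sigma> k \<noteq> 0" using k(1) by (auto simp: cell_def)
  ultimately show ?thesis using k(1) G_eq_0 by auto
qed

text \<open>
  On the points of the closed cell that are far from the frontier in \<open>U\<close>, \<open>\<bar>G\<bar>\<close> is bounded below by compactness. This needs that a
  boundary point of \<open>U\<close> on one of the lines is a limit of frontier points inside \<open>U\<close>, which is what the last hypothesis provides.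
  Conversely, a short step from a frontier point towards \<open>a\<close> raises \<open>\<bar>G\<bar>\<close> above a level that does not depend on the point.
\<close>

lemma eventually_level_hausdorff_close:
  assumes U: "convex U" "open U" "bounded U" and a: "a \<in> cell U \<sigma>" and \<delta>: "\<delta> > 0"
    and ends: "\<And>k x. k \<in> A \<Longrightarrow> x \<in> closure (cell U \<sigma>) \<Longrightarrow> N k x = 0 \<Longrightarrow>
      \<exists>y\<in>U. N k y = 0 \<and> y \<in> closure (cell U \<sigma>)"
  shows "\<forall>\<^sub>F e in at_right 0. hausdorff_close \<delta> {q \<in> cell U \<sigma>. \<bar>G q\<bar> = e} (frontier (cell U \<sigma>) \<inter> U)"
proof -
  let ?D = "cell U \<sigma>" and ?Y = "frontier (cell U \<sigma>) \<inter> U"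
  have cell_pos: "\<sigma> k * N k p > 0" if "p \<in> ?D" "k \<in> A" for p k using that by (simp add: cell_def)
  have DU: "?D \<subseteq> U" by (auto simp: cell_def)
  have Dc: "compact (closure ?D)" using U(3) DU bounded_subset by (simp add: compact_closure) blast
  \<comment> \<open>The part of the closed cell that is far from the frontier inside \<open>U\<close>.\<close>
  define Z where "Z = closure ?D - (\<Union>y\<in>?Y. ball y \<delta>)"
  have Z: "compact Z" unfolding Z_def by (intro compact_diff Dc) auto
  have ZG: "G x \<noteq> 0" if x: "x \<in> Z" for x
  proof
    assume "G x = 0"
    then obtain k where k: "k \<in> A" "N k x = 0" using G_eq_0 by blast
    have xD: "x \<in> closure ?D" using x by (simp add: Z_def)
    obtain y where y: "y \<in> U" "N k y = 0" "y \<in> closure ?D" using ends[OF k(1) xD k(2)] by blast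
    obtain s where s: "0 < s" "s \<le> 1" "s * dist x y < \<delta>"
    proof -
      have "\<forall>\<^sub>F s in at_right 0. s * dist x y < \<delta>" using \<delta> by (rule eventually_mult_less_at_right)
      then have "\<forall>\<^sub>F s in at_right 0. s * dist x y < \<delta> \<and> s \<in> {0<..<1}"
        using eventually_at_right_real[of 0 1, OF zero_less_one] by eventually_elim simp
      from eventually_happens'[OF trivial_limit_at_right_real this] show thesis using that by force
    qed
    define z where "z = (1 - s) *\<^sub>R x + s *\<^sub>R y"
    have "z \<in> U"
    proof -
      have "y \<in> interior U" using y(1) U(2) by (simp add: interior_open)
      moreover have "x \<in> closure U" using xD closure_mono[OF DU] by blast
      ultimately have "x - s *\<^sub>R (x - y) \<in> interior U"
        using s by (intro mem_interior_closure_convex_shrink[OF U(1)]) auto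
      then show ?thesis using U(2) by (simp add: z_def interior_open algebra_simps)
    qed
    moreover have "z \<in> closure ?D"
      using convex_closure[OF convex_cell[OF U(1)]] xD y(3) s by (simp add: z_def convex_alt)
    moreover have "N k z = 0" by (simp add: z_def N_convex_combination k y)
    then have "z \<notin> ?D" using cell_pos k(1) by force
    ultimately have "z \<in> ?Y" by (simp add: frontier_cell[OF U(2)])
    moreover have "dist z x < \<delta>"
    proof -
      have "z - x = s *\<^sub>R (y - x)" by (simp add: z_def algebra_simps)
      then have "dist z x = s * dist x y" using s by (simp add: dist_norm norm_minus_commute)
      then show ?thesis using s by simp
    qed
    ultimately show False using x by (auto simp: Z_def)
  qed
  have part1: "\<forall>\<^sub>F e in at_right 0. \<forall>x\<in>Z. \<bar>G x\<bar> \<noteq> e"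
  proof (cases "Z = {}")
    case False
    have "continuous_on Z (\<lambda>x. \<bar>G x\<bar>)"
      by (intro continuous_on_rabs real_polynomial_function_continuous_on G_poly)
    from continuous_attains_inf[OF Z False this] obtain x0 where
      x0: "x0 \<in> Z" "\<And>x. x \<in> Z \<Longrightarrow> \<bar>G x0\<bar> \<le> \<bar>G x\<bar>" by blast
    have "\<bar>G x0\<bar> > 0" using ZG[OF x0(1)] by simp
    then have "\<forall>\<^sub>F e in at_right 0. e * 1 < \<bar>G x0\<bar>" by (rule eventually_mult_less_at_right)
    then show ?thesis by eventually_elim (use x0(2) in fastforce)
  qed simp
  obtain B where B: "B > 0" "\<And>y. y \<in> U \<Longrightarrow> dist y a < B"
  proof -
    obtain r where r: "U \<subseteq> ball a r" "r > 0" using U(3) bounded_subset_ballD by blast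
    show thesis by (rule that[of r]) (use r in \<open>auto simp: dist_commute\<close>)
  qed
  obtain s0 where s0: "0 < s0" "s0 < 1" "s0 * B < \<delta>"
  proof -
    have "\<forall>\<^sub>F s in at_right 0. s * B < \<delta>" using \<delta> by (rule eventually_mult_less_at_right)
    then have "\<forall>\<^sub>F s in at_right 0. s * B < \<delta> \<and> s \<in> {0<..<1}"
      using eventually_at_right_real[of 0 1, OF zero_less_one] by eventually_elim simp
    from eventually_happens'[OF trivial_limit_at_right_real this] show thesis using that by force
  qed
  have "\<bar>G a\<bar> > 0" using cell_pos[OF a] by (force simp: G_eq_0)
  then have "s0 ^ card A * \<bar>G a\<bar> > 0" using s0 by simp
  then have "\<forall>\<^sub>F e in at_right 0. e * 1 < s0 ^ card A * \<bar>G a\<bar>" by (rule eventually_mult_less_at_right)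
  with part1 eventually_at_right_0_pos show ?thesis
  proof eventually_elim
    case (elim e)
    note e = elim(2,3)
    show ?case unfolding hausdorff_close_def
    proof (intro conjI ballI)
      fix x assume x: "x \<in> {q \<in> ?D. \<bar>G q\<bar> = e}"
      then have "x \<notin> Z" using elim(1) by blast
      moreover have "x \<in> closure ?D" using x closure_subset by blast
      ultimately show "\<exists>y\<in>?Y. dist x y < \<delta>" by (auto simp: Z_def dist_commute)
    next
      fix y assume y: "y \<in> ?Y"
      then have yc: "y \<in> closure ?D" "y \<in> U" by (auto simp: frontier_def)
      define pt where "pt = (\<lambda>s. (1 - s) *\<^sub>R y + s *\<^sub>R a)"
      have y0: "\<And>k. k \<in> A \<Longrightarrow> \<sigma> k * N k y \<ge> 0" using cell_closure[OF yc(1)] by blast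
      have "\<exists>s\<ge>0. s \<le> s0 \<and> \<bar>G (pt s)\<bar> = e"
      proof (rule IVT')
        show "\<bar>G (pt 0)\<bar> \<le> e" using frontier_cell_G[OF U(2) y] e by (simp add: pt_def)
        have "s0 ^ card A * \<bar>G a\<bar> = (\<Prod>k\<in>A. s0 * \<bar>N k a\<bar>)"
          by (simp add: prod.distrib G_def abs_prod)
        also have "\<dots> \<le> (\<Prod>k\<in>A. \<bar>N k (pt s0)\<bar>)"
        proof (intro prod_mono conjI)
          fix k assume k: "k \<in> A"
          have \<sigma>0: "\<bar>\<sigma> k\<bar> > 0" using cell_pos[OF a k] by auto
          have "\<bar>\<sigma> k\<bar> * (s0 * \<bar>N k a\<bar>) = s0 * (\<sigma> k * N k a)"
            using cell_pos[OF a k] by (simp add: abs_mult[symmetric] mult.left_commute)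
          also have "\<dots> \<le> (1 - s0) * (\<sigma> k * N k y) + s0 * (\<sigma> k * N k a)" using y0[OF k] s0 by simp
          also have "\<dots> = \<sigma> k * N k (pt s0)"
            unfolding pt_def N_convex_combination by (simp add: algebra_simps)
          also have "\<dots> \<le> \<bar>\<sigma> k\<bar> * \<bar>N k (pt s0)\<bar>" by (simp add: abs_mult[symmetric])
          finally show "s0 * \<bar>N k a\<bar> \<le> \<bar>N k (pt s0)\<bar>" using \<sigma>0 by simp
        qed (use s0 in auto)
        also have "\<dots> = \<bar>G (pt s0)\<bar>" by (simp add: G_def abs_prod)
        finally show "e \<le> \<bar>G (pt s0)\<bar>" using e by simp
        show "continuous_on {0..s0} (\<lambda>s. \<bar>G (pt s)\<bar>)"
          unfolding pt_def
          by (intro continuous_on_rabs continuous_on_compose2[OF real_polynomial_function_continuous_on[OF G_poly, of UNIV]])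
            (auto intro!: continuous_intros)
      qed (use s0 in simp)
      then obtain s where s: "0 \<le> s" "s \<le> s0" "\<bar>G (pt s)\<bar> = e" by blast
      have "s \<noteq> 0" using s(3) frontier_cell_G[OF U(2) y] e by (auto simp: pt_def)
      then have "pt s \<in> ?D" unfolding pt_def using s s0 by (intro cell_segment U yc(2) y0 a) auto
      moreover have "dist (pt s) y < \<delta>"
      proof -
        have "pt s - y = s *\<^sub>R (a - y)" by (simp add: pt_def algebra_simps)
        then have "dist (pt s) y = s * dist y a" using s by (simp add: dist_norm norm_minus_commute)
        also have "\<dots> \<le> s0 * B" using s s0 B(2)[OF yc(2)] by (intro mult_mono) auto
        finally show ?thesis using s0 by simp
      qed
      ultimately show "\<exists>x\<in>{q \<in> ?D. \<bar>G q\<bar> = e}. dist x y < \<delta>" using s(3) by blast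
    qed
  qed
qed

end

context bounded_edge begin

section \<open>The deformation by a constant respects every bounded edge\<close>

lemma sg_lipschitz: "k \<in> A - {l} \<Longrightarrow> sg k * N k x - dist x p \<le> sg k * N k p"
  using N_lipschitz[of k x p] sg_cases[of k] by auto

text \<open>
  In a thin tube all forms but \<open>N l\<close> are bounded away from zero, except that \<open>N mv\<close> may be small near \<open>v\<close>, and \<open>N mw\<close> near \<open>w\<close>.
\<close>

lemma tube_bounds:
  obtains c C where "c > 0" "C > 0" "\<forall>\<^sub>F \<eta> in at_right 0. \<forall>p\<in>T \<eta>. (\<forall>k\<in>A - {l, mv, mw}. c \<le> sg k * N k p) \<and>
    (c \<le> sg mv * N mv p \<or> c \<le> sg mw * N mw p) \<and> (sg mv * N mv p \<le> 0 \<longrightarrow> dist p v \<le> C * \<eta>)"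
proof -
  have "\<forall>\<^sub>F c in at_right 0. \<forall>k\<in>A - {l, mv, mw}. \<forall>z\<in>closed_segment v w. c \<le> sg k * N k z"
  proof (rule eventually_ball_finite, use fin in simp, rule ballI)
    fix k assume k: "k \<in> A - {l, mv, mw}"
    have "continuous_on (closed_segment v w) (\<lambda>p. sg k * N k p)" by (intro continuous_intros)
    from continuous_attains_inf[OF compact_segment _ this] obtain z0 where
      z0: "z0 \<in> closed_segment v w" "\<And>z. z \<in> closed_segment v w \<Longrightarrow> sg k * N k z0 \<le> sg k * N k z" by auto
    have "\<forall>\<^sub>F c in at_right 0. c * 1 < sg k * N k z0"
      using sg_pos_on_segment[OF k z0(1)] by (rule eventually_mult_less_at_right)
    then show "\<forall>\<^sub>F c in at_right 0. \<forall>z\<in>closed_segment v w. c \<le> sg k * N k z"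
      by eventually_elim (use z0(2) in fastforce)
  qed
  with eventually_mult_less_at_right[OF sg_mv_w, of 2] eventually_mult_less_at_right[OF sg_mw_v, of 2] eventually_at_right_0_pos
  have "\<forall>\<^sub>F c in at_right 0. c > 0 \<and> c * 2 < sg mv * N mv w \<and> c * 2 < sg mw * N mw v \<and>
     (\<forall>k\<in>A - {l, mv, mw}. \<forall>z\<in>closed_segment v w. c \<le> sg k * N k z)"
    by eventually_elim blast
  from eventually_happens'[OF trivial_limit_at_right_real this] obtain c where
    c: "c > 0" "c * 2 < sg mv * N mv w" "c * 2 < sg mw * N mw v"
     "\<And>k z. k \<in> A - {l, mv, mw} \<Longrightarrow> z \<in> closed_segment v w \<Longrightarrow> c \<le> sg k * N k z" by blast
  define C where "C = 1 + norm (w - v) / (sg mv * N mv w)"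
  have C: "C > 0" unfolding C_def using sg_mv_w by (intro add_pos_nonneg) auto
  note lip = sg_lipschitz
  show thesis
  proof (rule that[of "c / 2" C])
    show "c / 2 > 0" "C > 0" using c C by auto
    have "\<forall>\<^sub>F \<eta> in at_right 0. \<eta> * 2 < c" using c(1) by (rule eventually_mult_less_at_right)
    then show "\<forall>\<^sub>F \<eta> in at_right 0. \<forall>p\<in>T \<eta>. (\<forall>k\<in>A - {l, mv, mw}. c / 2 \<le> sg k * N k p) \<and>
      (c / 2 \<le> sg mv * N mv p \<or> c / 2 \<le> sg mw * N mw p) \<and> (sg mv * N mv p \<le> 0 \<longrightarrow> dist p v \<le> C * \<eta>)"
    proof eventually_elim
      case (elim \<eta>)
      show ?case
      proof (intro ballI conjI impI)
        fix p assume "p \<in> T \<eta>"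
        then obtain x where x: "x \<in> open_segment v w" "dist x p < \<eta>" by (auto simp: mem_tube)
        have xc: "x \<in> closed_segment v w" using x(1) open_closed_segment by blast
        show "c / 2 \<le> sg k * N k p" if k: "k \<in> A - {l, mv, mw}" for k
          using c(4)[OF k xc] lip[of k x p] k x(2) elim by auto
        obtain \<tau> where \<tau>: "x = v + \<tau> *\<^sub>R (w - v)" "N mv x = \<tau> * N mv w" "N mw x = (1 - \<tau>) * N mw v"
          using on_line_param[OF N_l_segment[OF xc]] by blast
        have \<tau>mv: "sg mv * N mv x = \<tau> * (sg mv * N mv w)" unfolding \<tau>(2) by (rule mult.left_commute)
        have \<tau>mw: "sg mw * N mw x = (1 - \<tau>) * (sg mw * N mw v)" unfolding \<tau>(3) by (rule mult.left_commute)
        have lipv: "sg mv * N mv x - dist x p \<le> sg mv * N mv p" and lipw: "sg mw * N mw x - dist x p \<le> sg mw * N mw p"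
          using lip lines by blast+
        show "c / 2 \<le> sg mv * N mv p \<or> c / 2 \<le> sg mw * N mw p"
        proof (cases "\<tau> \<ge> 1 / 2")
          case True
          then have "1 / 2 * (sg mv * N mv w) \<le> sg mv * N mv x"
            unfolding \<tau>mv using sg_mv_w by (intro mult_right_mono) auto
          then show ?thesis using c(2) lipv x(2) elim by linarith
        next
          case False
          then have "1 / 2 * (sg mw * N mw v) \<le> sg mw * N mw x"
            unfolding \<tau>mw using sg_mw_v by (intro mult_right_mono) auto
          then show ?thesis using c(3) lipw x(2) elim by linarith
        qed
        assume neg: "sg mv * N mv p \<le> 0"
        have "sg mv * N mv x > 0" using sg_pos_on_edge[OF _ x(1), of mv] lines by blast
        then have \<tau>0: "\<tau> > 0" unfolding \<tau>mv using sg_mv_w by (simp add: zero_less_mult_iff)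
        have "\<tau> * (sg mv * N mv w) \<le> \<eta>" using neg lipv x(2) unfolding \<tau>mv by linarith
        then have "\<tau> \<le> \<eta> / (sg mv * N mv w)" using sg_mv_w by (simp add: pos_le_divide_eq)
        then have "\<tau> * norm (w - v) \<le> \<eta> / (sg mv * N mv w) * norm (w - v)" by (intro mult_right_mono) auto
        moreover have "dist x v = \<tau> * norm (w - v)" using \<tau>0 by (simp add: \<tau>(1) dist_norm)
        moreover have "dist p v \<le> dist x p + dist x v" by (metis dist_commute dist_triangle)
        ultimately show "dist p v \<le> C * \<eta>" using x(2) by (simp add: C_def algebra_simps)
      qed
    qed
  qed
qed

text \<open>
  The summand of \<open>l\<close> is zero, which leaves room for the others to exceed one a little.
\<close>

lemma sum_quotients_le:
  assumes l0: "N l z = 0" and p: "\<And>k. k \<in> A - {l} \<Longrightarrow> N k z / N k p \<le> 1 + 1 / real (card A)"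
  shows "(\<Sum>k\<in>A. N k z / N k p) \<le> real (card A)"
proof -
  have d: "card A > 0" using fin lines by (auto simp: card_gt_0_iff)
  have "(\<Sum>k\<in>A. N k z / N k p) = (\<Sum>k\<in>A - {l}. N k z / N k p)"
    using fin lines l0 by (simp add: sum.remove[of A l])
  also have "\<dots> \<le> (\<Sum>k\<in>A - {l}. 1 + 1 / real (card A))" using p by (rule sum_mono)
  also have "\<dots> = (real (card A) - 1) * (1 + 1 / real (card A))"
    using fin lines d by (simp add: of_nat_diff Suc_leI)
  also have "\<dots> \<le> real (card A)" using d by (simp add: field_simps)
  finally show ?thesis .
qed

lemma quotient_le:
  assumes k: "k \<in> A - {l}" and c: "c > 0" "c \<le> sg k * N k p" and d: "dist z p \<le> r" "r * (real (card A) + 1) \<le> c"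
  shows "N k z / N k p \<le> 1 + 1 / real (card A)"
proof -
  have A: "card A > 0" using fin lines by (auto simp: card_gt_0_iff)
  have s: "sg k * sg k = 1" using sg_cases[OF k] by auto
  have pos: "sg k * N k p > 0" using c by linarith
  have "r * real (card A) \<le> c"
    using d(2) order_trans[OF zero_le_dist d(1)] by (simp add: algebra_simps)
  then have "r \<le> c / real (card A)" using A by (simp add: pos_le_divide_eq)
  also have "\<dots> \<le> sg k * N k p / real (card A)" using c A by (simp add: divide_right_mono)
  finally have r: "r \<le> sg k * N k p * (1 / real (card A))" by simp
  have "sg k * N k z \<le> sg k * N k p + dist z p"
    using N_lipschitz[of k z p] sg_cases[OF k] k by auto
  also have "\<dots> \<le> sg k * N k p * (1 + 1 / real (card A))" using d(1) r by (simp add: algebra_simps)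
  finally have "(sg k * N k z) / (sg k * N k p) \<le> 1 + 1 / real (card A)"
    by (subst pos_divide_le_eq[OF pos]) (simp only: mult.commute)
  moreover have "sg k \<noteq> 0" using s by auto
  then have "(sg k * N k z) / (sg k * N k p) = N k z / N k p" by (rule mult_divide_mult_cancel_left)
  ultimately show ?thesis by simp
qed

text \<open>
  Moving parallel to \<open>mv\<close> to the edge keeps \<open>N mv\<close> fixed and makes \<open>N l\<close> vanish, while the other forms hardly change if they
  are not small. So the mean of the quotients is at most one.
\<close>

lemma star_towards_edge:
  obtains K where "K > 0" "\<And>p \<eta> c. c > 0 \<Longrightarrow> \<eta> * K \<le> c \<Longrightarrow> \<bar>N l p\<bar> \<le> \<eta> \<Longrightarrow>
    (\<forall>k\<in>A - {l}. sg k * N k p > 0) \<Longrightarrow> (\<forall>k\<in>A - {l, mv}. c \<le> sg k * N k p) \<Longrightarrow>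
    \<exists>z\<in>open_segment v w. (\<Sum>k\<in>A. N k z / N k p) \<le> real (card A)"
proof -
  have "l \<noteq> mv" using lines by blast
  then obtain b where b: "n l \<bullet> b = 1" "n mv \<bullet> b = 0"
    using det2_solve[OF transversal[OF lines(1,2)], of 1 0] by blast
  have b0: "norm b > 0" using b by auto
  show thesis
  proof (rule that[of "norm b * (real (card A) + 1)"])
    show "norm b * (real (card A) + 1) > 0" using b0 by (intro mult_pos_pos) auto
    fix p and \<eta> c :: real
    assume c: "c > 0" "\<eta> * (norm b * (real (card A) + 1)) \<le> c" and p: "\<bar>N l p\<bar> \<le> \<eta>"
      and pos: "\<forall>k\<in>A - {l}. sg k * N k p > 0" and big: "\<forall>k\<in>A - {l, mv}. c \<le> sg k * N k p"
    define z where "z = p - N l p *\<^sub>R b"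
    have z: "N l z = 0" "N mv z = N mv p"
      using N_add[of l z "N l p *\<^sub>R b"] N_add[of mv z "N l p *\<^sub>R b"] b by (simp_all add: z_def)
    have dz: "dist z p \<le> \<eta> * norm b" using p b0 by (simp add: z_def dist_norm mult_right_mono)
    have A: "card A > 0" using fin lines by (auto simp: card_gt_0_iff)
    have \<eta>b: "\<eta> * norm b < c"
    proof (cases "\<eta> * norm b = 0")
      case False
      then have "\<eta> * norm b > 0" using p b0 by auto
      from mult_pos_pos[OF this, of "real (card A)"] have "\<eta> * norm b * real (card A) > 0" using A by simp
      then have "\<eta> * norm b < \<eta> * norm b * (real (card A) + 1)" by (simp add: distrib_left)
      then show ?thesis using c(2) by (simp add: mult.assoc)
    next
      case True
      then show ?thesis using c(1) by linarith
    qed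
    have mw: "mw \<in> A - {l, mv}" using lines mv_neq_mw by blast
    have mwl: "mw \<in> A - {l}" using lines by blast
    have "z \<in> open_segment v w"
    proof (rule in_edge[OF z(1)])
      show "sg mv * N mv z > 0" using z(2) pos lines by auto
      have "sg mw * N mw p - dist z p \<le> sg mw * N mw z"
        using N_lipschitz[of mw z p] sg_cases[OF mwl] lines by auto
      then show "sg mw * N mw z > 0" using bspec[OF big mw] dz \<eta>b by linarith
    qed
    moreover have "(\<Sum>k\<in>A. N k z / N k p) \<le> real (card A)"
    proof (rule sum_quotients_le[OF z(1)])
      fix k assume k: "k \<in> A - {l}"
      show "N k z / N k p \<le> 1 + 1 / real (card A)"
      proof (cases "k = mv")
        case True
        have "N mv p \<noteq> 0" using pos lines by force
        then show ?thesis using True z(2) by simp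
      next
        case False
        then have "c \<le> sg k * N k p" using big k by blast
        then show ?thesis by (rule quotient_le[OF k c(1) _ dz]) (use c(2) in \<open>simp add: mult.assoc\<close>)
      qed
    qed
    ultimately show "\<exists>z\<in>open_segment v w. (\<Sum>k\<in>A. N k z / N k p) \<le> real (card A)" by blast
  qed
qed

text \<open>
  The sign vectors of the middle cell on the side \<open>\<tau>\<close> of \<open>l\<close> and, below, of the cells on this side beyond \<open>v\<close> and beyond \<open>w\<close>.
\<close>

definition sM :: "real \<Rightarrow> (real^2) set \<Rightarrow> real" where "sM \<tau> = sg(l := \<tau>)"

definition sV :: "real \<Rightarrow> (real^2) set \<Rightarrow> real" where "sV \<tau> = sg(l := \<tau>, mv := - sg mv)"

definition sW :: "real \<Rightarrow> (real^2) set \<Rightarrow> real" where "sW \<tau> = sg(l := \<tau>, mw := - sg mw)"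

definition good_cell :: "real \<Rightarrow> ((real^2) set \<Rightarrow> real) \<Rightarrow> bool" where
  "good_cell \<eta> \<sigma> \<longleftrightarrow> cell (T \<eta>) \<sigma> \<noteq> {} \<and>
    (\<forall>\<delta>>0. \<forall>\<^sub>F e in at_right 0. connected {q \<in> cell (T \<eta>) \<sigma>. \<bar>G q\<bar> = e} \<and> {q \<in> cell (T \<eta>) \<sigma>. \<bar>G q\<bar> = e} \<noteq> {} \<and>
      hausdorff_close \<delta> {q \<in> cell (T \<eta>) \<sigma>. \<bar>G q\<bar> = e} (frontier (cell (T \<eta>) \<sigma>) \<inter> T \<eta>))"

lemma bounded_T: "bounded (T \<eta>)"
proof -
  have "T \<eta> \<subseteq> ball v (dist v w + \<eta>)"
  proof
    fix p assume "p \<in> T \<eta>"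
    then obtain x where x: "x \<in> open_segment v w" "dist x p < \<eta>" by (auto simp: mem_tube)
    have "dist v x \<le> dist v w"
      using dist_in_closed_segment[OF open_closed_segment[OF x(1)]] by (simp add: dist_commute)
    then show "p \<in> ball v (dist v w + \<eta>)" using x(2) dist_triangle[of v p x] by simp
  qed
  then show ?thesis using bounded_ball bounded_subset by blast
qed

lemma good_cellI:
  assumes a: "a \<in> cell (T \<eta>) \<sigma>"
    and Y: "connected Y" "Y \<noteq> {}" "Y \<subseteq> T \<eta>" "\<And>y k. y \<in> Y \<Longrightarrow> k \<in> A \<Longrightarrow> \<sigma> k * N k y \<ge> 0" "\<And>y. y \<in> Y \<Longrightarrow> G y = 0"
    and star: "\<And>p. p \<in> cell (T \<eta>) \<sigma> \<Longrightarrow> \<exists>z\<in>Y. (\<Sum>k\<in>A. N k z / N k p) \<le> real (card A)"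
    and ends: "\<And>k x. k \<in> A \<Longrightarrow> x \<in> closure (cell (T \<eta>) \<sigma>) \<Longrightarrow> N k x = 0 \<Longrightarrow>
      \<exists>y\<in>T \<eta>. N k y = 0 \<and> y \<in> closure (cell (T \<eta>) \<sigma>)"
  shows "good_cell \<eta> \<sigma>"
  unfolding good_cell_def
proof (intro conjI allI impI)
  show "cell (T \<eta>) \<sigma> \<noteq> {}" using a by blast
  fix \<delta> :: real assume \<delta>: "\<delta> > 0"
  have "\<sigma> k * N k a > 0" if "k \<in> A" for k using a that by (simp add: cell_def)
  then have "\<bar>G a\<bar> > 0" by (force simp: G_eq_0)
  then have "\<forall>\<^sub>F e in at_right 0. e * 1 < \<bar>G a\<bar>" by (rule eventually_mult_less_at_right)
  moreover have "\<forall>\<^sub>F e in at_right 0. hausdorff_close \<delta> {q \<in> cell (T \<eta>) \<sigma>. \<bar>G q\<bar> = e} (frontier (cell (T \<eta>) \<sigma>) \<inter> T \<eta>)"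
    by (rule eventually_level_hausdorff_close[OF convex_T open_tube bounded_T a \<delta>]) (rule ends)
  moreover note eventually_at_right_0_pos
  ultimately
  show "\<forall>\<^sub>F e in at_right 0. connected {q \<in> cell (T \<eta>) \<sigma>. \<bar>G q\<bar> = e} \<and> {q \<in> cell (T \<eta>) \<sigma>. \<bar>G q\<bar> = e} \<noteq> {} \<and>
      hausdorff_close \<delta> {q \<in> cell (T \<eta>) \<sigma>. \<bar>G q\<bar> = e} (frontier (cell (T \<eta>) \<sigma>) \<inter> T \<eta>)"
  proof eventually_elim
    case (elim e)
    have ea: "e < \<bar>G a\<bar>" using elim(1) by simp
    have "connected {q \<in> cell (T \<eta>) \<sigma>. \<bar>G q\<bar> = e}" "{q \<in> cell (T \<eta>) \<sigma>. \<bar>G q\<bar> = e} \<noteq> {}"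
      by (rule connected_level_in_cell[OF convex_T a ea elim(3)], rule Y, rule Y, rule Y, (rule Y; assumption),
          (rule Y; assumption), (rule star; assumption))+
    then show ?case using elim(2) by blast
  qed
qed

lemma v_in_T: "\<eta> > 0 \<Longrightarrow> v \<in> T \<eta>" and w_in_T: "\<eta> > 0 \<Longrightarrow> w \<in> T \<eta>"
  by (rule segment_in_tube[of v], auto, rule segment_in_tube[of w], auto)

text \<open>
  Here \<open>Y\<close> is the edge. A point of the cell is moved to it parallel to \<open>mv\<close> if it is far from \<open>mw\<close>, and parallel to \<open>mw\<close> otherwise.
\<close>

lemma eventually_good_middle_cell:
  "\<forall>\<^sub>F \<eta> in at_right 0. \<forall>\<tau>\<in>{1, -1}. good_cell \<eta> (sM \<tau>)"
proof -
  interpret sw: bounded_edge A n b l w v mw mv by (rule swap)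
  obtain c C where c: "c > 0" and bounds: "\<forall>\<^sub>F \<eta> in at_right 0. \<forall>p\<in>T \<eta>. (\<forall>k\<in>A - {l, mv, mw}. c \<le> sg k * N k p) \<and>
    (c \<le> sg mv * N mv p \<or> c \<le> sg mw * N mw p) \<and> (sg mv * N mv p \<le> 0 \<longrightarrow> dist p v \<le> C * \<eta>)"
    by (rule tube_bounds) (rule that; assumption)
  obtain K where K: "K > 0" and star_v: "\<And>p \<eta> c. c > 0 \<Longrightarrow> \<eta> * K \<le> c \<Longrightarrow> \<bar>N l p\<bar> \<le> \<eta> \<Longrightarrow>
    (\<forall>k\<in>A - {l}. sg k * N k p > 0) \<Longrightarrow> (\<forall>k\<in>A - {l, mv}. c \<le> sg k * N k p) \<Longrightarrow>
    \<exists>z\<in>open_segment v w. (\<Sum>k\<in>A. N k z / N k p) \<le> real (card A)"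
    by (rule star_towards_edge) (rule that; assumption)
  obtain K' where K': "K' > 0" and star_w: "\<And>p \<eta> c. c > 0 \<Longrightarrow> \<eta> * K' \<le> c \<Longrightarrow> \<bar>N l p\<bar> \<le> \<eta> \<Longrightarrow>
    (\<forall>k\<in>A - {l}. sg k * N k p > 0) \<Longrightarrow> (\<forall>k\<in>A - {l, mw}. c \<le> sg k * N k p) \<Longrightarrow>
    \<exists>z\<in>open_segment v w. (\<Sum>k\<in>A. N k z / N k p) \<le> real (card A)"
    by (rule sw.star_towards_edge[unfolded swap_simps]) (rule that; assumption)
  have "\<forall>\<^sub>F \<eta> in at_right 0. \<forall>k\<in>A - {l}. \<eta> * 1 < sg k * N k mid"
    using fin sg_pos_on_edge[OF _ mid_in] by (intro eventually_ball_finite ballI eventually_mult_less_at_right) auto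
  with bounds eventually_mult_less_at_right[OF c, of K] eventually_mult_less_at_right[OF c, of K'] eventually_at_right_0_pos
  show ?thesis
  proof eventually_elim
    case (elim \<eta>)
    note B = elim(1) and \<eta>K = elim(2,3) and \<eta> = elim(4) and \<eta>mid = elim(5)
    show ?case
    proof
      fix \<tau> :: real assume "\<tau> \<in> {1, -1}"
      then have \<tau>: "\<tau> = 1 \<or> \<tau> = -1" by auto
      have nonneg: "sM \<tau> k * N k y \<ge> 0" if "y \<in> closed_segment v w" "k \<in> A" for y k
        using sg_nonneg_on_segment[OF _ that(1), of k] that N_l_segment[OF that(1)] by (auto simp: sM_def)
      define a where "a = mid + (\<tau> * (\<eta> / 2)) *\<^sub>R n l"
      have da: "dist a mid = \<eta> / 2" using \<tau> \<eta> unit[OF lines(1)] by (auto simp: a_def dist_norm)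
      have a: "a \<in> cell (T \<eta>) (sM \<tau>)"
      proof -
        have "a \<in> T \<eta>"
          using segment_in_tube[OF open_closed_segment[OF mid_in], of a] da \<eta> by (simp add: dist_commute)
        moreover have "\<tau> * N l a > 0" unfolding a_def N_l_normal using \<tau> \<eta> by auto
        moreover have "sg k * N k a > 0" if k: "k \<in> A - {l}" for k
          using N_near_mid[OF k, of a "\<eta> / 2"] da bspec[OF \<eta>mid k] \<eta> by simp
        ultimately show ?thesis by (auto simp: cell_def sM_def)
      qed
      have vcl: "v \<in> closure (cell (T \<eta>) (sM \<tau>))"
        by (rule mem_closure_cell[OF convex_T v_in_T[OF \<eta>] nonneg a]) auto
      have wcl: "w \<in> closure (cell (T \<eta>) (sM \<tau>))"
        by (rule mem_closure_cell[OF convex_T w_in_T[OF \<eta>] nonneg a]) auto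
      show "good_cell \<eta> (sM \<tau>)"
      proof (rule good_cellI[OF a])
        show "connected (open_segment v w)" by (simp add: convex_connected)
        show "open_segment v w \<noteq> {}" using mid_in by blast
        show "open_segment v w \<subseteq> T \<eta>" using segment_in_tube[OF open_closed_segment] \<eta> by fastforce
        show "sM \<tau> k * N k y \<ge> 0" if "y \<in> open_segment v w" "k \<in> A" for y k
          using nonneg[OF open_closed_segment[OF that(1)] that(2)] .
        show "G y = 0" if "y \<in> open_segment v w" for y
          using N_l_segment[OF open_closed_segment[OF that]] lines by (auto simp: G_eq_0)
      next
        fix p assume p: "p \<in> cell (T \<eta>) (sM \<tau>)"
        then have pT: "p \<in> T \<eta>" by (simp add: cell_def)
        have pos: "\<forall>k\<in>A - {l}. sg k * N k p > 0"
        proof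
          fix k assume k: "k \<in> A - {l}"
          then have "sM \<tau> k * N k p > 0" using p by (simp add: cell_def)
          moreover have "k \<noteq> l" using k by blast
          ultimately show "sg k * N k p > 0" by (simp add: sM_def)
        qed
        have Nl: "\<bar>N l p\<bar> \<le> \<eta>" using N_l_tube[OF pT] by simp
        from bspec[OF B pT] have others: "\<forall>k\<in>A - {l, mv, mw}. c \<le> sg k * N k p"
          and two: "c \<le> sg mv * N mv p \<or> c \<le> sg mw * N mw p" by blast+
        from two show "\<exists>z\<in>open_segment v w. (\<Sum>k\<in>A. N k z / N k p) \<le> real (card A)"
        proof
          assume "c \<le> sg mw * N mw p"
          then have "\<forall>k\<in>A - {l, mv}. c \<le> sg k * N k p" using others by blast
          then show ?thesis by (intro star_v[OF c _ Nl pos]) (use \<eta>K in auto)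
        next
          assume "c \<le> sg mv * N mv p"
          then have "\<forall>k\<in>A - {l, mw}. c \<le> sg k * N k p" using others by blast
          then show ?thesis by (intro star_w[OF c _ Nl pos]) (use \<eta>K in auto)
        qed
      next
        fix k x assume k: "k \<in> A" and x: "x \<in> closure (cell (T \<eta>) (sM \<tau>))" "N k x = 0"
        have "k \<in> {l, mv, mw}"
        proof (rule ccontr)
          assume nk: "k \<notin> {l, mv, mw}"
          have "closed {q. c \<le> sg k * N k q}" by (intro closed_Collect_le continuous_intros)
          moreover have "cell (T \<eta>) (sM \<tau>) \<subseteq> {q. c \<le> sg k * N k q}"
            using B k nk by (auto simp: cell_def)
          ultimately have "c \<le> sg k * N k x" using closure_minimal x(1) by blast
          then show False using x(2) c by simp
        qed
        then show "\<exists>y\<in>T \<eta>. N k y = 0 \<and> y \<in> closure (cell (T \<eta>) (sM \<tau>))"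
          using vcl wcl v_in_T[OF \<eta>] w_in_T[OF \<eta>] N_at_ends by blast
      qed
    qed
  qed
qed

text \<open>
  Here \<open>Y\<close> consists of \<open>v\<close> alone: two forms vanish there, and the others hardly vary on the cell, which lies near \<open>v\<close>.
\<close>

lemma eventually_good_end_cell:
  "\<forall>\<^sub>F \<eta> in at_right 0. \<forall>\<tau>\<in>{1, -1}. good_cell \<eta> (sV \<tau>)"
proof -
  obtain c C where c: "c > 0" and C: "C > 0" and bounds: "\<forall>\<^sub>F \<eta> in at_right 0. \<forall>p\<in>T \<eta>. (\<forall>k\<in>A - {l, mv, mw}. c \<le> sg k * N k p) \<and>
    (c \<le> sg mv * N mv p \<or> c \<le> sg mw * N mw p) \<and> (sg mv * N mv p \<le> 0 \<longrightarrow> dist p v \<le> C * \<eta>)"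
    by (rule tube_bounds) (rule that; assumption)
  have neq: "l \<noteq> mv" "mw \<noteq> mv" using lines mv_neq_mw by auto
  have "\<forall>\<^sub>F \<eta> in at_right 0. \<forall>k\<in>A - {l, mv}. \<eta> * 1 < sg k * N k v"
    using fin sg_pos_at_v by (intro eventually_ball_finite ballI eventually_mult_less_at_right) auto
  with bounds eventually_mult_less_at_right[OF c, of "C * (real (card A) + 1)"] eventually_at_right_0_pos
  show ?thesis
  proof eventually_elim
    case (elim \<eta>)
    note B = elim(1) and \<eta>C = elim(2) and \<eta> = elim(3) and \<eta>v = elim(4)
    show ?case
    proof
      fix \<tau> :: real assume "\<tau> \<in> {1, -1}"
      then have \<tau>: "\<tau> = 1 \<or> \<tau> = -1" by auto
      have mv: "sg mv = 1 \<or> sg mv = -1" using sg_cases lines by blast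
      obtain d where d: "n l \<bullet> d = \<tau>" "n mv \<bullet> d = - sg mv"
        using det2_solve[OF transversal[OF lines(1,2) neq(1)]] by blast
      have d0: "norm d > 0" using d \<tau> by auto
      define s where "s = \<eta> / (2 * norm d)"
      have s: "s > 0" "s * norm d = \<eta> / 2" using \<eta> d0 by (auto simp: s_def)
      define a where "a = v + s *\<^sub>R d"
      have da: "dist a v = \<eta> / 2" using s by (simp add: a_def dist_norm)
      have a: "a \<in> cell (T \<eta>) (sV \<tau>)"
      proof -
        have "a \<in> T \<eta>" using segment_in_tube[of v a] da \<eta> by (simp add: dist_commute)
        moreover have "N l a = s * \<tau>" "N mv a = - s * sg mv" by (simp_all add: a_def N_add N_at_ends d)
        then have "\<tau> * N l a > 0" "- sg mv * N mv a > 0" using \<tau> mv s by auto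
        moreover have "sg k * N k a > 0" if k: "k \<in> A - {l, mv}" for k
        proof -
          have "sg k * N k v - dist v a \<le> sg k * N k a" using k by (intro sg_lipschitz) auto
          then show ?thesis using bspec[OF \<eta>v k] \<eta> da by (simp add: dist_commute)
        qed
        ultimately show ?thesis using neq by (auto simp: cell_def sV_def)
      qed
      have nonneg: "sV \<tau> k * N k v \<ge> 0" if "k \<in> A" for k
        using sg_pos_at_v[of k] that N_at_ends by (auto simp: sV_def less_imp_le)
      have vcl: "v \<in> closure (cell (T \<eta>) (sV \<tau>))"
        by (rule mem_closure_cell[OF convex_T v_in_T[OF \<eta>] nonneg a])
      show "good_cell \<eta> (sV \<tau>)"
      proof (rule good_cellI[OF a, where Y = "{v}"])
        show "{v} \<subseteq> T \<eta>" using v_in_T[OF \<eta>] by simp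
        show "G y = 0" if "y \<in> {v}" for y using that N_at_ends lines by (auto simp: G_eq_0)
        show "sV \<tau> k * N k y \<ge> 0" if "y \<in> {v}" "k \<in> A" for y k using nonneg that by simp
      next
        fix p assume p: "p \<in> cell (T \<eta>) (sV \<tau>)"
        then have pT: "p \<in> T \<eta>" by (simp add: cell_def)
        have "sV \<tau> mv * N mv p > 0" using p lines by (simp add: cell_def)
        then have neg: "sg mv * N mv p < 0" by (simp add: sV_def)
        then have dp: "dist v p \<le> C * \<eta>" using bspec[OF B pT] by (simp add: dist_commute)
        have big: "c \<le> sg k * N k p" if "k \<in> A - {l, mv}" for k
          using bspec[OF B pT] that neg c by (cases "k = mw") auto
        have "(\<Sum>k\<in>A. N k v / N k p) \<le> real (card A)"
        proof (rule sum_quotients_le[OF N_at_ends(1)])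
          fix k assume k: "k \<in> A - {l}"
          show "N k v / N k p \<le> 1 + 1 / real (card A)"
          proof (cases "k = mv")
            case False
            then have "c \<le> sg k * N k p" using big k by blast
            then show ?thesis
              by (rule quotient_le[OF k c _ dp]) (use \<eta>C in \<open>simp add: mult.assoc mult.left_commute\<close>)
          qed (simp add: N_at_ends)
        qed
        then show "\<exists>z\<in>{v}. (\<Sum>k\<in>A. N k z / N k p) \<le> real (card A)" by simp
      next
        fix k x assume k: "k \<in> A" and x: "x \<in> closure (cell (T \<eta>) (sV \<tau>))" "N k x = 0"
        have "k \<in> {l, mv}"
        proof (rule ccontr)
          assume nk: "k \<notin> {l, mv}"
          have "closed {q. c \<le> sg k * N k q}" by (intro closed_Collect_le continuous_intros)
          moreover have "cell (T \<eta>) (sV \<tau>) \<subseteq> {q. c \<le> sg k * N k q}"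
          proof
            fix q assume q: "q \<in> cell (T \<eta>) (sV \<tau>)"
            then have "sV \<tau> mv * N mv q > 0" "q \<in> T \<eta>" using lines by (simp_all add: cell_def)
            then have "sg mv * N mv q < 0" "q \<in> T \<eta>" by (simp_all add: sV_def)
            then show "q \<in> {q. c \<le> sg k * N k q}" using bspec[OF B, of q] k nk c by (cases "k = mw") auto
          qed
          ultimately have "c \<le> sg k * N k x" using closure_minimal x(1) by blast
          then show False using x(2) c by simp
        qed
        then show "\<exists>y\<in>T \<eta>. N k y = 0 \<and> y \<in> closure (cell (T \<eta>) (sV \<tau>))"
          using vcl v_in_T[OF \<eta>] N_at_ends by blast
      qed simp_all
    qed
  qed
qed

lemma swap_cell_simps: "bounded_edge.sV n b l w v mw = sW" "bounded_edge.good_cell A n b w v = good_cell"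
proof -
  interpret sw: bounded_edge A n b l w v mw mv by (rule swap)
  show "sw.sV = sW" by (simp add: sw.sV_def sW_def fun_eq_iff swap_simps)
  show "sw.good_cell = good_cell" by (simp add: sw.good_cell_def good_cell_def fun_eq_iff swap_simps)
qed

lemma prod_signs:
  "(\<Prod>k\<in>A. sM \<tau> k) = \<tau> * S" "(\<Prod>k\<in>A. sV \<tau> k) = - \<tau> * S" "(\<Prod>k\<in>A. sW \<tau> k) = - \<tau> * S"
proof -
  have one: "(\<Prod>k\<in>A. f k) = f l * (\<Prod>k\<in>A - {l}. f k)" for f :: "(real^2) set \<Rightarrow> real"
    using fin lines by (simp add: prod.remove)
  have two: "(\<Prod>k\<in>A - {l}. f k) = f m * (\<Prod>k\<in>A - {l} - {m}. f k)" if "m \<in> A" "m \<noteq> l"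
    for f :: "(real^2) set \<Rightarrow> real" and m
    using fin that by (simp add: prod.remove)
  have cong: "(\<Prod>k\<in>A - {l}. (sg(l := \<tau>)) k) = (\<Prod>k\<in>A - {l}. sg k)" by (intro prod.cong) auto
  show "(\<Prod>k\<in>A. sM \<tau> k) = \<tau> * S" unfolding one[of "sM \<tau>"] using cong by (simp add: sM_def S_def)
  have upd: "(\<Prod>k\<in>A. (sg(l := \<tau>, m := - sg m)) k) = - \<tau> * S" if m: "m \<in> A" "m \<noteq> l" for m
  proof -
    have "(\<Prod>k\<in>A - {l} - {m}. (sg(l := \<tau>, m := - sg m)) k) = (\<Prod>k\<in>A - {l} - {m}. sg k)"
      by (intro prod.cong) auto
    then show ?thesis using m two[OF m, of sg] by (simp add: one two[OF m] S_def)
  qed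
  show "(\<Prod>k\<in>A. sV \<tau> k) = - \<tau> * S" "(\<Prod>k\<in>A. sW \<tau> k) = - \<tau> * S"
    unfolding sV_def sW_def using upd lines by auto
qed

lemma G_on_cell:
  assumes "p \<in> cell U \<sigma>" "\<And>k. k \<in> A \<Longrightarrow> \<sigma> k = 1 \<or> \<sigma> k = -1"
  shows "G p = (\<Prod>k\<in>A. \<sigma> k) * \<bar>G p\<bar>"
proof -
  have "N k p = \<sigma> k * \<bar>N k p\<bar>" if k: "k \<in> A" for k
  proof -
    have "\<sigma> k * N k p > 0" using assms(1) k by (simp add: cell_def)
    then show ?thesis using assms(2)[OF k] by auto
  qed
  then have "(\<Prod>k\<in>A. N k p) = (\<Prod>k\<in>A. \<sigma> k * \<bar>N k p\<bar>)" by (intro prod.cong refl)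
  then have "G p = (\<Prod>k\<in>A. \<sigma> k) * (\<Prod>k\<in>A. \<bar>N k p\<bar>)" by (simp add: G_def prod.distrib)
  moreover have "\<bar>G p\<bar> = (\<Prod>k\<in>A. \<bar>N k p\<bar>)" by (simp add: G_def abs_prod)
  ultimately show ?thesis by simp
qed

lemma signs_cases:
  assumes "\<tau> = 1 \<or> \<tau> = -1" "k \<in> A"
  shows "sM \<tau> k = 1 \<or> sM \<tau> k = -1" "sV \<tau> k = 1 \<or> sV \<tau> k = -1" "sW \<tau> k = 1 \<or> sW \<tau> k = -1"
proof -
  have sk: "k \<noteq> l \<Longrightarrow> sg k = 1 \<or> sg k = -1" using sg_cases[of k] assms(2) by blast
  have sv: "sg mv = 1 \<or> sg mv = -1" "sg mw = 1 \<or> sg mw = -1" using sg_cases lines by blast+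
  show "sM \<tau> k = 1 \<or> sM \<tau> k = -1" using sk assms(1) by (simp add: sM_def)
  show "sV \<tau> k = 1 \<or> sV \<tau> k = -1" "sW \<tau> k = 1 \<or> sW \<tau> k = -1"
    using sk sv assms(1) by (auto simp: sV_def sW_def)
qed

text \<open>
  The lines cut the tube into six cells. In exactly three of them \<open>G\<close> has the sign of \<open>\<epsilon>\<close>: the middle cell on one side of \<open>l\<close> and the
  two end cells on the other side. The parts of the curve in these cells are its components.
\<close>

lemma eventually_product_respects:
  "\<forall>\<^sub>F \<eta> in at_right 0. \<forall>\<delta>>0. \<forall>\<^sub>F \<epsilon> in at 0. respects_edge \<eta> \<delta> A {q. G q = \<epsilon>} (open_segment v w)"
proof -
  interpret sw: bounded_edge A n b l w v mw mv by (rule swap)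
  obtain c C where c: "c > 0" and bounds: "\<forall>\<^sub>F \<eta> in at_right 0. \<forall>p\<in>T \<eta>. (\<forall>k\<in>A - {l, mv, mw}. c \<le> sg k * N k p) \<and>
    (c \<le> sg mv * N mv p \<or> c \<le> sg mw * N mw p) \<and> (sg mv * N mv p \<le> 0 \<longrightarrow> dist p v \<le> C * \<eta>)"
    by (rule tube_bounds) (rule that; assumption)
  have neq: "l \<noteq> mv" "l \<noteq> mw" "mw \<noteq> mv" using lines mv_neq_mw by auto
  show ?thesis
    using eventually_good_middle_cell eventually_good_end_cell
      sw.eventually_good_end_cell[unfolded swap_cell_simps] bounds
  proof eventually_elim
    case (elim \<eta>)
    note goods = elim(1-3) and B = elim(4)
    show ?case
    proof (intro allI impI)
      fix \<delta> :: real assume \<delta>: "\<delta> > 0"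
      define ok where "ok = (\<lambda>e \<sigma>. connected {q \<in> cell (T \<eta>) \<sigma>. \<bar>G q\<bar> = e} \<and> {q \<in> cell (T \<eta>) \<sigma>. \<bar>G q\<bar> = e} \<noteq> {} \<and>
        hausdorff_close \<delta> {q \<in> cell (T \<eta>) \<sigma>. \<bar>G q\<bar> = e} (frontier (cell (T \<eta>) \<sigma>) \<inter> T \<eta>))"
      have "\<forall>\<^sub>F e in at_right 0. \<forall>\<tau>\<in>{1, -1}. ok e (sM \<tau>) \<and> ok e (sV \<tau>) \<and> ok e (sW \<tau>)"
      proof (intro eventually_ball_finite ballI eventually_conj)
        have okI: "\<forall>\<^sub>F e in at_right 0. ok e \<sigma>" if "good_cell \<eta> \<sigma>" for \<sigma>
          unfolding ok_def by (rule mp[OF spec[OF conjunct2[OF that[unfolded good_cell_def]]] \<delta>])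
        fix \<tau> :: real assume "\<tau> \<in> {1, -1}"
        then show "\<forall>\<^sub>F e in at_right 0. ok e (sM \<tau>)" "\<forall>\<^sub>F e in at_right 0. ok e (sV \<tau>)"
          "\<forall>\<^sub>F e in at_right 0. ok e (sW \<tau>)"
          using goods by (intro okI; blast)+
      qed simp
      then have "\<forall>\<^sub>F \<epsilon> in at 0. \<forall>\<tau>\<in>{1, -1}. ok \<bar>\<epsilon>\<bar> (sM \<tau>) \<and> ok \<bar>\<epsilon>\<bar> (sV \<tau>) \<and> ok \<bar>\<epsilon>\<bar> (sW \<tau>)"
        by (rule eventually_at_0_abs)
      moreover have "\<forall>\<^sub>F \<epsilon> in at 0. \<epsilon> \<noteq> (0::real)" by (simp add: eventually_neq_at_within)
      ultimately show "\<forall>\<^sub>F \<epsilon> in at 0. respects_edge \<eta> \<delta> A {q. G q = \<epsilon>} (open_segment v w)"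
      proof eventually_elim
        case (elim \<epsilon>)
        define \<tau> where "\<tau> = S * sgn \<epsilon>"
        have \<tau>: "\<tau> = 1 \<or> \<tau> = -1" "- \<tau> = 1 \<or> - \<tau> = -1"
          using S_cases elim(2) by (auto simp: \<tau>_def sgn_if)
        have SS: "S * S = 1" using S_cases by auto
        define E where "E = (\<lambda>\<sigma>. {q \<in> cell (T \<eta>) \<sigma>. \<bar>G q\<bar> = \<bar>\<epsilon>\<bar>})"
        let ?X = "{q. G q = \<epsilon>} \<inter> T \<eta>"
        \<comment> \<open>The sign vectors of the three cells in which \<open>G\<close> has the sign of \<open>\<epsilon>\<close>.\<close>
        define \<Sigma> where "\<Sigma> = {sM \<tau>, sV (- \<tau>), sW (- \<tau>)}"
        have ok: "ok \<bar>\<epsilon>\<bar> \<sigma>" if "\<sigma> \<in> \<Sigma>" for \<sigma> using elim(1) that \<tau> unfolding \<Sigma>_def by auto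
        have prod\<Sigma>: "(\<Prod>k\<in>A. \<sigma> k) = sgn \<epsilon>" if "\<sigma> \<in> \<Sigma>" for \<sigma>
          using that SS unfolding \<Sigma>_def by (auto simp: prod_signs \<tau>_def mult.commute mult.left_commute)
        have pm: "\<sigma> k = 1 \<or> \<sigma> k = -1" if "\<sigma> \<in> \<Sigma>" "k \<in> A" for \<sigma> k
          using that(1) signs_cases[OF \<tau>(1) that(2)] signs_cases[OF \<tau>(2) that(2)] unfolding \<Sigma>_def by blast
        have E_eq: "E \<sigma> = {p \<in> ?X. \<forall>k\<in>A. \<sigma> k * N k p > 0}" if \<sigma>: "\<sigma> \<in> \<Sigma>" for \<sigma>
        proof -
          have "G p = \<epsilon>" if "p \<in> cell (T \<eta>) \<sigma>" "\<bar>G p\<bar> = \<bar>\<epsilon>\<bar>" for p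
          proof -
            have "G p = sgn \<epsilon> * \<bar>\<epsilon>\<bar>" using G_on_cell[OF that(1) pm[OF \<sigma>]] prod\<Sigma>[OF \<sigma>] that(2) by simp
            then show ?thesis by (simp add: sgn_mult_abs)
          qed
          then show ?thesis unfolding E_def by (auto simp: cell_def)
        qed
        have XA: "?X \<inter> \<Union>A = {}" using elim(2) G_eq_0_Union by blast
        have E_comp: "E \<sigma> \<in> components ?X" if \<sigma>: "\<sigma> \<in> \<Sigma>" for \<sigma>
          by (rule cell_is_component[OF E_eq[OF \<sigma>] _ _ XA]) (use ok[OF \<sigma>] in \<open>auto simp: ok_def E_def\<close>)
        have D_comp: "cell (T \<eta>) \<sigma> \<in> components (T \<eta> - \<Union>A)" if \<sigma>: "\<sigma> \<in> \<Sigma>" for \<sigma>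
        proof (rule cell_is_component)
          show "cell (T \<eta>) \<sigma> = {p \<in> T \<eta> - \<Union>A. \<forall>k\<in>A. \<sigma> k * N k p > 0}"
          proof -
            have "p \<notin> \<Union>A" if p: "\<forall>k\<in>A. \<sigma> k * N k p > 0" for p
            proof
              assume "p \<in> \<Union>A"
              then obtain k where "k \<in> A" "N k p = 0" using mem_line by blast
              then show False using p by force
            qed
            then show ?thesis unfolding cell_def by blast
          qed
          show "connected (cell (T \<eta>) \<sigma>)" by (intro convex_connected convex_cell convex_T)
          show "cell (T \<eta>) \<sigma> \<noteq> {}" using ok[OF \<sigma>] by (auto simp: ok_def)
        qed blast
        have cover: "\<exists>\<sigma>\<in>\<Sigma>. p \<in> E \<sigma>" if p: "p \<in> ?X" for p
        proof -
          have pT: "p \<in> T \<eta>" and Gp: "G p = \<epsilon>" using p by auto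
          have N0: "N k p \<noteq> 0" if "k \<in> A" for k using that Gp elim(2) G_eq_0 by blast
          define \<rho> where "\<rho> = sgn (N l p)"
          have \<rho>: "\<rho> = 1 \<or> \<rho> = -1" "\<rho> * N l p > 0"
            using N0[OF lines(1)] by (auto simp: \<rho>_def sgn_if)
          have others: "sg k * N k p > 0" if "k \<in> A - {l, mv, mw}" for k
            using bspec[OF B pT] that c by force
          have two: "sg mv * N mv p > 0 \<or> sg mw * N mw p > 0"
            using bspec[OF B pT] c by force
          have nz: "sg mv * N mv p \<noteq> 0" "sg mw * N mw p \<noteq> 0"
            using N0 lines sg_cases[of mv] sg_cases[of mw] by auto
          have "p \<in> cell (T \<eta>) (sM \<rho>) \<or> p \<in> cell (T \<eta>) (sV \<rho>) \<or> p \<in> cell (T \<eta>) (sW \<rho>)"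
          proof -
            consider "sg mv * N mv p > 0" "sg mw * N mw p > 0" | "sg mv * N mv p < 0" "sg mw * N mw p > 0"
              | "sg mv * N mv p > 0" "sg mw * N mw p < 0" using two nz by linarith
            then show ?thesis
            proof cases
              case 1
              have "sM \<rho> k * N k p > 0" if "k \<in> A" for k
                using 1 \<rho>(2) others[of k] that neq by (cases "k = l"; cases "k = mv"; cases "k = mw") (auto simp: sM_def)
              then show ?thesis using pT by (simp add: cell_def)
            next
              case 2
              have "sV \<rho> k * N k p > 0" if "k \<in> A" for k
                using 2 \<rho>(2) others[of k] that neq by (cases "k = l"; cases "k = mv"; cases "k = mw") (auto simp: sV_def)
              then show ?thesis using pT by (simp add: cell_def)
            next
              case 3
              have "sW \<rho> k * N k p > 0" if "k \<in> A" for k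
                using 3 \<rho>(2) others[of k] that neq by (cases "k = l"; cases "k = mv"; cases "k = mw") (auto simp: sW_def)
              then show ?thesis using pT by (simp add: cell_def)
            qed
          qed
          then obtain \<sigma> where \<sigma>: "\<sigma> = sM \<rho> \<or> \<sigma> = sV \<rho> \<or> \<sigma> = sW \<rho>" "p \<in> cell (T \<eta>) \<sigma>" by blast
          have "G p = (\<Prod>k\<in>A. \<sigma> k) * \<bar>G p\<bar>"
            by (rule G_on_cell[OF \<sigma>(2)]) (use \<sigma>(1) signs_cases[OF \<rho>(1)] in blast)
          then have "\<epsilon> = (\<Prod>k\<in>A. \<sigma> k) * \<bar>\<epsilon>\<bar>" using Gp by simp
          then have "(\<Prod>k\<in>A. \<sigma> k) * \<bar>\<epsilon>\<bar> = sgn \<epsilon> * \<bar>\<epsilon>\<bar>" by (simp add: sgn_mult_abs)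
          then have sg: "(\<Prod>k\<in>A. \<sigma> k) = sgn \<epsilon>" using elim(2) by simp
          have "\<sigma> \<in> \<Sigma>"
            using \<sigma>(1)
          proof (elim disjE)
            assume s: "\<sigma> = sM \<rho>"
            then have "\<rho> * S = sgn \<epsilon>" using sg by (simp add: prod_signs)
            then have "\<rho> = \<tau>" using SS unfolding \<tau>_def by (metis mult.assoc mult.commute mult.right_neutral)
            then show ?thesis using s by (simp add: \<Sigma>_def)
          next
            assume s: "\<sigma> = sV \<rho>"
            then have "- \<rho> * S = sgn \<epsilon>" using sg by (simp add: prod_signs)
            then have "- \<rho> = \<tau>" using SS unfolding \<tau>_def by (metis mult.assoc mult.commute mult.right_neutral)
            then have "\<rho> = - \<tau>" by simp
            then show ?thesis using s by (simp add: \<Sigma>_def)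
          next
            assume s: "\<sigma> = sW \<rho>"
            then have "- \<rho> * S = sgn \<epsilon>" using sg by (simp add: prod_signs)
            then have "- \<rho> = \<tau>" using SS unfolding \<tau>_def by (metis mult.assoc mult.commute mult.right_neutral)
            then have "\<rho> = - \<tau>" by simp
            then show ?thesis using s by (simp add: \<Sigma>_def)
          qed
          moreover have "p \<in> E \<sigma>" using \<sigma>(2) Gp by (simp add: E_def)
          ultimately show ?thesis by blast
        qed
        have comps: "components ?X = E ` \<Sigma>"
        proof (intro equalityI subsetI)
          fix C' assume C': "C' \<in> components ?X"
          then obtain p where p: "p \<in> C'" using in_components_nonempty by blast
          then have "p \<in> ?X" using in_components_subset[OF C'] by blast
          then obtain \<sigma> where \<sigma>: "\<sigma> \<in> \<Sigma>" "p \<in> E \<sigma>" using cover by blast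
          then have "C' = E \<sigma>" using components_eq[OF C' E_comp[OF \<sigma>(1)]] p by blast
          then show "C' \<in> E ` \<Sigma>" using \<sigma>(1) by blast
        qed (use E_comp in blast)
        have disjoint: "E \<sigma> \<noteq> E \<sigma>'" if \<sigma>: "\<sigma> \<in> \<Sigma>" and k: "k \<in> A" "\<sigma> k = - \<sigma>' k" for \<sigma> \<sigma>' k
        proof
          assume eq: "E \<sigma> = E \<sigma>'"
          obtain p where "p \<in> E \<sigma>" using ok[OF \<sigma>] unfolding ok_def E_def by blast
          then have "\<sigma> k * N k p > 0" "\<sigma>' k * N k p > 0" using eq k(1) by (auto simp: E_def cell_def)
          then show False using k(2) by simp
        qed
        have "E (sM \<tau>) \<noteq> E (sV (- \<tau>))" "E (sM \<tau>) \<noteq> E (sW (- \<tau>))" "E (sV (- \<tau>)) \<noteq> E (sW (- \<tau>))"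
          using disjoint[of "sM \<tau>" l "sV (- \<tau>)"] disjoint[of "sM \<tau>" l "sW (- \<tau>)"]
            disjoint[of "sV (- \<tau>)" mv "sW (- \<tau>)"] lines neq
          by (auto simp: \<Sigma>_def sM_def sV_def sW_def)
        then have "card (E ` \<Sigma>) = 3" by (simp add: \<Sigma>_def)
        then show ?case
          unfolding respects_edge_def comps using D_comp ok unfolding ok_def E_def by blast
      qed
    qed
  qed
qed

end

context line_arrangement begin

section \<open>Counting crunodes and bounded edges\<close>

lemma crunodes_card: "card A * (card A - 1) \<le> 2 * card (crunodes A)"
proof -
  let ?P = "{B. B \<subseteq> A \<and> card B = 2}"
  have "\<exists>v. v \<in> crunodes A \<and> (\<forall>l\<in>B. v \<in> l)" if B: "B \<in> ?P" for B
  proof -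
    obtain l m where lm: "B = {l, m}" "l \<noteq> m" using B by (auto simp: card_2_iff)
    then have A: "l \<in> A" "m \<in> A" using B by auto
    obtain v where v: "v \<in> l" "v \<in> m" using crunode_exists[OF A lm(2)] by blast
    then have "v \<in> crunodes A" using A lm(2) unfolding crunodes_def by blast
    then show ?thesis using v lm(1) by blast
  qed
  then have "\<forall>B\<in>?P. \<exists>v. v \<in> crunodes A \<and> (\<forall>l\<in>B. v \<in> l)" ..
  from bchoice[OF this] obtain f where f': "\<forall>B\<in>?P. f B \<in> crunodes A \<and> (\<forall>l\<in>B. f B \<in> l)" ..
  note f = bspec[OF f']
  have "inj_on f ?P"
  proof (rule inj_onI)
    fix B B' assume B: "B \<in> ?P" and B': "B' \<in> ?P" and eq: "f B = f B'"
    obtain l m where lm: "B = {l, m}" "l \<noteq> m" using B by (auto simp: card_2_iff)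
    obtain l' m' where lm': "B' = {l', m'}" "l' \<noteq> m'" using B' by (auto simp: card_2_iff)
    have mem: "f B \<in> l" "f B \<in> m" "f B \<in> l'" "f B \<in> m'" using f[OF B] f[OF B'] lm lm' eq by auto
    have A: "l \<in> A" "m \<in> A" "l' \<in> A" "m' \<in> A" using B B' lm lm' by auto
    have "k \<in> {l, m}" if "k \<in> A" "f B \<in> k" for k
      using no_triple[of l m k] A lm(2) mem that by blast
    then have "B' \<subseteq> B" using A mem lm(1) lm'(1) by blast
    moreover have "finite B" "card B' = card B" using lm lm' by auto
    ultimately show "B = B'" by (metis card_subset_eq)
  qed
  then have "card ?P \<le> card (crunodes A)"
    using f finite_crunodes by (intro card_inj_on_le[of f]) auto
  then have "card A choose 2 \<le> card (crunodes A)" using n_subsets[OF fin, of 2] by simp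
  then have "2 * (card A * (card A - 1) div 2) \<le> 2 * card (crunodes A)" by (simp only: choose_two mult_le_mono2)
  moreover have "even (card A * (card A - 1))" by (cases "card A") auto
  ultimately show ?thesis by (simp only: dvd_mult_div_cancel)
qed

definition line_coord :: "(real^2) set \<Rightarrow> real^2 \<Rightarrow> real" where "line_coord l p = rot90 (n l) \<bullet> p"

lemma line_coord_inj: "l \<in> A \<Longrightarrow> p \<in> l \<Longrightarrow> q \<in> l \<Longrightarrow> line_coord l p = line_coord l q \<Longrightarrow> p = q"
proof -
  assume l: "l \<in> A" and p: "p \<in> l" and q: "q \<in> l" and eq: "line_coord l p = line_coord l q"
  have "n l \<bullet> n l = 1" using unit[OF l] by (simp add: dot_square_norm)
  then have "det2 (n l) (rot90 (n l)) = 1" by (simp add: det2_def rot90_def inner_real2)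
  moreover have "n l \<bullet> (p - q) = 0" using p q mem_line[OF l] N_offset by metis
  moreover have "rot90 (n l) \<bullet> (p - q) = 0" using eq by (simp add: line_coord_def inner_diff_right)
  ultimately have "p - q = 0" using det2_inner_eq_0 by (metis zero_neq_one)
  then show ?thesis by simp
qed

lemma line_coord_between:
  assumes l: "l \<in> A" and pts: "p \<in> l" "q \<in> l" "x \<in> l"
  shows "x \<in> open_segment p q \<and> line_coord l p < line_coord l q \<longleftrightarrow> line_coord l p < line_coord l x \<and> line_coord l x < line_coord l q"
proof (cases "line_coord l p < line_coord l q")
  case True
  then have ne: "q - p \<noteq> 0" by auto
  have "n l \<noteq> 0" using unit[OF l] by auto
  moreover have "n l \<bullet> (x - p) = 0" "n l \<bullet> (q - p) = 0"
    using pts mem_line[OF l] N_offset by metis+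
  ultimately obtain \<tau> where \<tau>: "x - p = \<tau> *\<^sub>R (q - p)" using orthogonal_imp_parallel[OF _ ne] by blast
  then have x: "x = (1 - \<tau>) *\<^sub>R p + \<tau> *\<^sub>R q" by (simp add: algebra_simps)
  have px: "line_coord l x = line_coord l p + \<tau> * (line_coord l q - line_coord l p)"
    by (simp add: x line_coord_def inner_add_right algebra_simps)
  have "line_coord l p < line_coord l x \<and> line_coord l x < line_coord l q \<longleftrightarrow> 0 < \<tau> \<and> \<tau> < 1"
  proof -
    have "0 < \<tau> * (line_coord l q - line_coord l p) \<longleftrightarrow> 0 < \<tau>" "0 < (1 - \<tau>) * (line_coord l q - line_coord l p) \<longleftrightarrow> \<tau> < 1"
      using True by (simp_all add: zero_less_mult_iff)
    moreover have "line_coord l q - line_coord l x = (1 - \<tau>) * (line_coord l q - line_coord l p)"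
      using px by (simp add: algebra_simps)
    ultimately show ?thesis using px by linarith
  qed
  moreover have "x \<in> open_segment p q \<longleftrightarrow> 0 < \<tau> \<and> \<tau> < 1"
  proof
    assume "x \<in> open_segment p q"
    then obtain u where u: "0 < u" "u < 1" "x = (1 - u) *\<^sub>R p + u *\<^sub>R q" by (auto simp: in_segment)
    then have "(u - \<tau>) *\<^sub>R (q - p) = 0" by (simp add: x algebra_simps)
    then show "0 < \<tau> \<and> \<tau> < 1" using u ne by simp
  next
    assume "0 < \<tau> \<and> \<tau> < 1"
    then show "x \<in> open_segment p q" using ne x by (auto simp: in_segment)
  qed
  ultimately show ?thesis using True by blast
qed auto

text \<open>
  A connected set that contains the segment and no crunode stays on \<open>l\<close>, and its coordinates cannot pass those of \<open>p\<close> and \<open>q\<close>.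
\<close>

lemma consecutive_crunodes_bounded_edge:
  assumes l: "l \<in> A" and p: "p \<in> crunodes A" "p \<in> l" and q: "q \<in> crunodes A" "q \<in> l"
    and lt: "line_coord l p < line_coord l q"
    and cons: "\<And>r. r \<in> crunodes A \<Longrightarrow> r \<in> l \<Longrightarrow> line_coord l p < line_coord l r \<Longrightarrow> line_coord l q \<le> line_coord l r"
  shows "open_segment p q \<in> bounded_edges A"
proof -
  let ?e = "open_segment p q"
  have "affine l" using line[OF l] affine_hyperplane by metis
  then have "closed_segment p q \<subseteq> l" using p q closed_segment_subset affine_imp_convex by blast
  then have el: "?e \<subseteq> l" using open_closed_segment by blast
  have nocr: "x \<notin> crunodes A" if x: "x \<in> ?e" for x
  proof
    assume c: "x \<in> crunodes A"
    have "line_coord l p < line_coord l x \<and> line_coord l x < line_coord l q" using line_coord_between[OF l p(2) q(2)] x el lt by blast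
    then show False using cons[OF c] x el by force
  qed
  have ne: "?e \<noteq> {}" using lt by auto
  have max: "D = ?e" if D: "?e \<subseteq> D" "D \<subseteq> \<Union>A - crunodes A" "connected D" for D
  proof -
    have Dl: "D \<subseteq> l" using connected_stays_on_line[OF D(3,2) l] D(1) ne el by blast
    obtain y where y: "y \<in> ?e" using ne by blast
    have ylt: "line_coord l p < line_coord l y" "line_coord l y < line_coord l q" using line_coord_between[OF l p(2) q(2)] y el lt by blast+
    have cont: "continuous_on D (\<lambda>x. line_coord l x - c)" for c unfolding line_coord_def by (intro continuous_intros)
    have "x \<in> ?e" if x: "x \<in> D" for x
    proof -
      have "line_coord l x > line_coord l p"
      proof (rule ccontr)
        assume "\<not> ?thesis"
        then obtain z where "z \<in> D" "line_coord l z - line_coord l p = 0"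
          using connected_opposite_signs[OF D(3) cont[of "line_coord l p"] x, of y] y D(1) ylt by auto
        then have "z = p" using line_coord_inj[OF l _ p(2), of z] Dl by auto
        then show False using \<open>z \<in> D\<close> D(2) p(1) by blast
      qed
      moreover have "line_coord l x < line_coord l q"
      proof (rule ccontr)
        assume "\<not> ?thesis"
        then obtain z where "z \<in> D" "line_coord l z - line_coord l q = 0"
          using connected_opposite_signs[OF D(3) cont[of "line_coord l q"] _ x, of y] y D(1) ylt by auto
        then have "z = q" using line_coord_inj[OF l _ q(2), of z] Dl by auto
        then show False using \<open>z \<in> D\<close> D(2) q(1) by blast
      qed
      ultimately show ?thesis using line_coord_between[OF l p(2) q(2), of x] x Dl by blast
    qed
    then show ?thesis using D(1) by blast
  qed
  have "?e \<subseteq> \<Union>A - crunodes A" using el l nocr by blast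
  moreover have "connected ?e" by (simp add: convex_connected)
  ultimately have "?e \<in> components (\<Union>A - crunodes A)"
    unfolding in_components_maximal using ne max by blast
  then show ?thesis using p(1) q(1) unfolding bounded_edges_def edges_def by blast
qed

lemma crunodes_on_line_card:
  assumes l: "l \<in> A"
  shows "card A - 1 \<le> card (crunodes A \<inter> l)"
proof -
  have "\<forall>m\<in>A - {l}. \<exists>v. v \<in> l \<and> v \<in> m" using crunode_exists[OF l] by blast
  then obtain f where f: "\<And>m. m \<in> A - {l} \<Longrightarrow> f m \<in> l \<and> f m \<in> m" by metis
  have "inj_on f (A - {l})"
  proof (rule inj_onI, rule ccontr)
    fix m m' assume m: "m \<in> A - {l}" "m' \<in> A - {l}" "f m = f m'" "m \<noteq> m'"
    then show False using no_triple[of l m m'] f[of m] f[of m'] l by auto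
  qed
  moreover have "f ` (A - {l}) \<subseteq> crunodes A \<inter> l"
  proof
    fix x assume "x \<in> f ` (A - {l})"
    then obtain m where "m \<in> A - {l}" "x = f m" by blast
    then show "x \<in> crunodes A \<inter> l" using f[of m] l unfolding crunodes_def by blast
  qed
  ultimately have "card (A - {l}) \<le> card (crunodes A \<inter> l)"
    using finite_crunodes by (intro card_inj_on_le[of f]) auto
  then show ?thesis using l fin by simp
qed

text \<open>
  Each line carries at least \<open>card A - 1\<close> crunodes; those that are not the last one on the line are followed by a bounded edge.
\<close>

lemma bounded_edges_card: "card A * (card A - 2) \<le> card (bounded_edges A)"
proof -
  define P where "P = (\<lambda>l. {p \<in> crunodes A \<inter> l. \<exists>q\<in>crunodes A \<inter> l. line_coord l p < line_coord l q})"
  have finP: "finite (P l)" for l unfolding P_def using finite_crunodes by simp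
  have cardP: "card A - 2 \<le> card (P l)" if l: "l \<in> A" for l
  proof (cases "crunodes A \<inter> l = {}")
    case True then show ?thesis using crunodes_on_line_card[OF l] by simp
  next
    case False
    define M where "M = Max (line_coord l ` (crunodes A \<inter> l))"
    have finI: "finite (line_coord l ` (crunodes A \<inter> l))" using finite_crunodes by simp
    have "M \<in> line_coord l ` (crunodes A \<inter> l)" unfolding M_def using finI False by (intro Max_in) auto
    then obtain m where m: "m \<in> crunodes A \<inter> l" "line_coord l m = M" by auto
    have "crunodes A \<inter> l \<subseteq> insert m (P l)"
    proof
      fix p assume p: "p \<in> crunodes A \<inter> l"
      have "line_coord l p \<le> M" unfolding M_def using finI p by (intro Max_ge) auto
      then have "p = m \<or> line_coord l p < line_coord l m" using line_coord_inj[OF l, of p m] p m by force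
      then show "p \<in> insert m (P l)" using p m(1) unfolding P_def by blast
    qed
    then have "card (crunodes A \<inter> l) \<le> card (insert m (P l))" using finP by (intro card_mono) auto
    also have "\<dots> \<le> Suc (card (P l))" by (rule card_insert_le_m1[of "Suc (card (P l))", simplified]) auto
    finally show ?thesis using crunodes_on_line_card[OF l] by simp
  qed
  have "\<exists>q. q \<in> crunodes A \<inter> l \<and> line_coord l p < line_coord l q \<and> (\<forall>r\<in>crunodes A \<inter> l. line_coord l p < line_coord l r \<longrightarrow> line_coord l q \<le> line_coord l r)"
    if "p \<in> P l" for l p
  proof -
    let ?Q = "{q \<in> crunodes A \<inter> l. line_coord l p < line_coord l q}"
    have "finite ?Q" "?Q \<noteq> {}" using finite_crunodes that by (auto simp: P_def)
    then obtain q where "q \<in> ?Q" "\<forall>r\<in>?Q. line_coord l q \<le> line_coord l r"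
      using arg_min_if_finite(1)[of ?Q "line_coord l"] arg_min_least[of ?Q _ "line_coord l"] by blast
    then show ?thesis by blast
  qed
  note ex_next = this
  define nxt where "nxt = (\<lambda>l p. SOME q. q \<in> crunodes A \<inter> l \<and> line_coord l p < line_coord l q \<and>
     (\<forall>r\<in>crunodes A \<inter> l. line_coord l p < line_coord l r \<longrightarrow> line_coord l q \<le> line_coord l r))"
  have nxt: "nxt l p \<in> crunodes A \<inter> l \<and> line_coord l p < line_coord l (nxt l p) \<and>
     (\<forall>r\<in>crunodes A \<inter> l. line_coord l p < line_coord l r \<longrightarrow> line_coord l (nxt l p) \<le> line_coord l r)" if "p \<in> P l" for l p
    unfolding nxt_def by (rule someI_ex[OF ex_next[OF that]])
  define f where "f = (\<lambda>(l, p). open_segment p (nxt l p))"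
  have "inj_on f (Sigma A P)"
  proof (rule inj_onI)
    fix x y assume x: "x \<in> Sigma A P" and y: "y \<in> Sigma A P" and eq: "f x = f y"
    obtain l p where xl: "x = (l, p)" by (cases x)
    obtain m q where ym: "y = (m, q)" by (cases y)
    have l: "l \<in> A" "p \<in> P l" and m: "m \<in> A" "q \<in> P m" using x y xl ym by auto
    have nx: "p \<in> l" "nxt l p \<in> l" "line_coord l p < line_coord l (nxt l p)" and ny: "q \<in> m" "nxt m q \<in> m" "line_coord m q < line_coord m (nxt m q)"
      using nxt[OF l(2)] nxt[OF m(2)] l m unfolding P_def by auto
    have ne: "p \<noteq> nxt l p" "q \<noteq> nxt m q" using nx ny by auto
    have "open_segment p (nxt l p) = open_segment q (nxt m q)" using eq by (simp add: f_def xl ym)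
    then have "closed_segment p (nxt l p) = closed_segment q (nxt m q)"
      using ne closure_open_segment by metis
    then have set: "{p, nxt l p} = {q, nxt m q}" by (simp only: closed_segment_eq)
    have "l = m"
    proof (rule ccontr)
      assume "l \<noteq> m"
      have "p \<in> m" "nxt l p \<in> m" using set ny(1,2) by (auto simp: doubleton_eq_iff)
      then have "p = nxt l p" by (rule crunode_unique[OF l(1) m(1) \<open>l \<noteq> m\<close> nx(1) _ nx(2)])
      then show False using ne by blast
    qed
    then have "p = q" using set nx(3) ny(3) by (auto simp: doubleton_eq_iff)
    then show "x = y" using xl ym \<open>l = m\<close> by simp
  qed
  moreover have "f ` Sigma A P \<subseteq> bounded_edges A"
  proof
    fix e assume "e \<in> f ` Sigma A P"
    then obtain l p where lp: "l \<in> A" "p \<in> P l" "e = open_segment p (nxt l p)" by (auto simp: f_def)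
    show "e \<in> bounded_edges A"
      unfolding lp(3) using nxt[OF lp(2)] lp(2)
      by (intro consecutive_crunodes_bounded_edge[OF lp(1)]) (auto simp: P_def)
  qed
  ultimately have "card (Sigma A P) \<le> card (bounded_edges A)"
    using finite_bounded_edges by (intro card_inj_on_le[of f])
  moreover have "card A * (card A - 2) \<le> card (Sigma A P)"
  proof -
    have "card (Sigma A P) = (\<Sum>l\<in>A. card (P l))" using fin finP by simp
    also have "\<dots> \<ge> (\<Sum>l\<in>A. card A - 2)" using cardP by (rule sum_mono)
    finally show ?thesis by simp
  qed
  ultimately show ?thesis by simp
qed

section \<open>Linear equations of the lines\<close>

text \<open>
  A line is infinite, so one of finitely many affine functions whose zero sets cover it vanishes on all of it; such a function is
  proportional to the equation of the line.
\<close>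

lemma line_covered:
  assumes l: "l \<in> A" and "finite I" and \<nu>: "\<And>i. i \<in> I \<Longrightarrow> \<nu> i \<noteq> 0"
    and cov: "\<And>p. p \<in> l \<Longrightarrow> \<exists>i\<in>I. \<nu> i \<bullet> p = \<beta> i"
  shows "\<exists>i\<in>I. \<exists>t. t \<noteq> 0 \<and> (\<forall>p. \<nu> i \<bullet> p - \<beta> i = t * N l p)"
proof -
  define u where "u = rot90 (n l)"
  have nu: "u \<bullet> n l = 0" by (simp add: u_def rot90_def inner_real2)
  have n0: "n l \<noteq> 0" using unit[OF l] by auto
  then have u0: "u \<noteq> 0" by (auto simp: u_def rot90_def vec_eq_iff forall_2)
  have nn: "n l \<bullet> n l = 1" using unit[OF l] by (simp add: dot_square_norm)
  define p0 where "p0 = b l *\<^sub>R n l"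
  have on: "p0 + t *\<^sub>R u \<in> l" for t
    using nu by (simp add: mem_line[OF l] N_def p0_def inner_add_right nn inner_commute)
  have "\<exists>i\<in>I. \<nu> i \<bullet> u = 0 \<and> \<nu> i \<bullet> p0 = \<beta> i"
  proof (rule ccontr)
    assume neg: "\<not> ?thesis"
    have "UNIV \<subseteq> (\<Union>i\<in>I. {t. \<nu> i \<bullet> (p0 + t *\<^sub>R u) = \<beta> i})" using cov[OF on] by blast
    moreover have "finite {t. \<nu> i \<bullet> (p0 + t *\<^sub>R u) = \<beta> i}" if i: "i \<in> I" for i
    proof (cases "\<nu> i \<bullet> u = 0")
      case True
      then have "\<nu> i \<bullet> p0 \<noteq> \<beta> i" using neg i by blast
      then show ?thesis using True by (simp add: inner_add_right)
    next
      case False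
      have "{t. \<nu> i \<bullet> (p0 + t *\<^sub>R u) = \<beta> i} \<subseteq> {(\<beta> i - \<nu> i \<bullet> p0) / (\<nu> i \<bullet> u)}"
        using False by (auto simp: inner_add_right field_simps)
      then show ?thesis using finite_subset by blast
    qed
    ultimately have "finite (UNIV :: real set)" using assms(2) finite_subset by blast
    then show False using infinite_UNIV_char_0 by blast
  qed
  then obtain i where i: "i \<in> I" "\<nu> i \<bullet> u = 0" "\<nu> i \<bullet> p0 = \<beta> i" by blast
  obtain t where t: "\<nu> i = t *\<^sub>R n l"
    using orthogonal_imp_parallel[OF u0 n0 _ nu, of "\<nu> i"] i(2) by (auto simp: inner_commute)
  have "t \<noteq> 0" using t \<nu>[OF i(1)] by auto
  moreover have "\<nu> i \<bullet> p - \<beta> i = t * N l p" for p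
    using i(3) by (simp add: t p0_def N_def nn algebra_simps)
  ultimately show ?thesis using i(1) by blast
qed

end

lemma eval2_mult: "eval2 (F * F') p = eval2 F p * eval2 F' p"
  by (simp add: eval2_def)

lemma eval2_add: "eval2 (F + F') p = eval2 F p + eval2 F' p"
  by (simp add: eval2_def)

lemma eval2_smult: "eval2 (smult [:c:] F) p = c * eval2 F p"
  by (simp add: eval2_def)

lemma eval2_prod: "eval2 (\<Prod>i\<in>I. L i) p = (\<Prod>i\<in>I. eval2 (L i) p)"
  by (induction I rule: infinite_finite_induct) (auto simp: eval2_mult, simp_all add: eval2_def)

context line_arrangement begin

text \<open>
  Each line is the zero set of one of the \<open>L i\<close>, and as there are as many lines as equations, this is a bijection.
\<close>

lemma line_equations_product:
  assumes L: "line_equations A (card A) L"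
  shows "\<exists>c. c \<noteq> 0 \<and> (\<forall>p. (\<Prod>i<card A. eval2 (L i) p) = c * G p)"
proof -
  have "\<forall>i<card A. \<exists>a b c. (a \<noteq> 0 \<or> b \<noteq> 0) \<and> L i = [:[:c, a:], [:b:]:]"
    using L unfolding line_equations_def linear_poly_def by blast
  then obtain \<alpha> \<beta> \<gamma> where lin: "\<And>i. i < card A \<Longrightarrow> (\<alpha> i \<noteq> 0 \<or> \<beta> i \<noteq> 0) \<and> L i = [:[:\<gamma> i, \<alpha> i:], [:\<beta> i:]:]" by metis
  define \<nu> where "\<nu> = (\<lambda>i. vector [\<alpha> i, \<beta> i] :: real^2)"
  have ev: "eval2 (L i) p = \<nu> i \<bullet> p - (- \<gamma> i)" if "i < card A" for i p
    using lin[OF that] by (simp add: eval2_linear \<nu>_def inner_real2)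
  have \<nu>0: "\<nu> i \<noteq> 0" if "i \<in> {..<card A}" for i using lin that by (auto simp: \<nu>_def vec_eq_iff forall_2)
  have zero: "(\<exists>i<card A. eval2 (L i) p = 0) \<longleftrightarrow> p \<in> \<Union>A" for p
  proof -
    have "p \<in> zero_locus (\<Prod>i<card A. L i) \<longleftrightarrow> p \<in> \<Union>A" using L unfolding line_equations_def by simp
    then show ?thesis by (auto simp: zero_locus_def eval2_prod)
  qed
  have "\<exists>i\<in>{..<card A}. \<exists>t. t \<noteq> 0 \<and> (\<forall>p. \<nu> i \<bullet> p - (- \<gamma> i) = t * N l p)" if l: "l \<in> A" for l
  proof (rule line_covered[OF l])
    show "\<exists>i\<in>{..<card A}. \<nu> i \<bullet> p = - \<gamma> i" if "p \<in> l" for p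
    proof -
      have "p \<in> \<Union>A" using that l by blast
      then obtain i where i: "i < card A" "eval2 (L i) p = 0" using zero by blast
      then have "\<nu> i \<bullet> p = - \<gamma> i" using ev[OF i(1), of p] by linarith
      then show ?thesis using i(1) by blast
    qed
  qed (use \<nu>0 in auto)
  then have "\<forall>l\<in>A. \<exists>i t. i < card A \<and> t \<noteq> 0 \<and> (\<forall>p. eval2 (L i) p = t * N l p)" using ev by (metis lessThan_iff)
  then obtain \<iota> t where it: "\<And>l. l \<in> A \<Longrightarrow> \<iota> l < card A \<and> t l \<noteq> 0 \<and> (\<forall>p. eval2 (L (\<iota> l)) p = t l * N l p)" by metis
  have inj: "inj_on \<iota> A"
  proof (rule inj_onI)
    fix l m assume l: "l \<in> A" and m: "m \<in> A" and eq: "\<iota> l = \<iota> m"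
    have "t l * N l p = t m * N m p" for p using it[OF l] it[OF m] eq by metis
    then have "N l p = 0 \<longleftrightarrow> N m p = 0" for p using it[OF l] it[OF m] by (metis mult_eq_0_iff)
    then show "l = m" using mem_line[OF l] mem_line[OF m] by blast
  qed
  have im: "\<iota> ` A = {..<card A}"
    using it inj by (intro card_subset_eq) (auto simp: card_image)
  have "(\<Prod>i<card A. eval2 (L i) p) = (\<Prod>l\<in>A. t l) * G p" for p
  proof -
    have "(\<Prod>i<card A. eval2 (L i) p) = (\<Prod>l\<in>A. eval2 (L (\<iota> l)) p)"
      unfolding im[symmetric] using inj by (simp add: prod.reindex)
    also have "\<dots> = (\<Prod>l\<in>A. t l * N l p)" using it by (intro prod.cong refl) blast
    finally show ?thesis by (simp add: G_def prod.distrib)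
  qed
  moreover have "(\<Prod>l\<in>A. t l) \<noteq> 0" using it fin by simp
  ultimately show ?thesis by blast
qed

section \<open>The lower bounds for the number of cusps\<close>

lemma bounded_edges_locale:
  assumes "e \<in> bounded_edges A"
  obtains l v w mv mw where "bounded_edge A n b l v w mv mw" "e = open_segment v w" "v \<in> crunodes A" "w \<in> crunodes A"
proof -
  obtain v w where vw: "v \<in> crunodes A" "w \<in> crunodes A" "e = open_segment v w" "e \<in> edges A"
    using assms unfolding bounded_edges_def by blast
  then obtain l mv mw where "bounded_edge A n b l v w mv mw" using bounded_edge_of_component by metis
  then show thesis using that vw by blast
qed

lemma eventually_respected_same_side:
  "\<forall>\<^sub>F \<eta> in at_right 0. \<forall>\<^sub>F \<delta> in at_right 0. \<forall>H. real_polynomial_function H \<longrightarrow> (\<forall>c\<in>crunodes A. H c \<noteq> 0) \<longrightarrow>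
    (\<forall>\<^sub>F \<epsilon> in at 0. {e \<in> bounded_edges A. respects_edge \<eta> \<delta> A {q. perturb G H \<epsilon> q = 0} e} \<subseteq> same_side_edges H)"
proof -
  define P where "P = (\<lambda>\<eta> \<delta> e. \<forall>H. real_polynomial_function H \<longrightarrow> (\<forall>c\<in>crunodes A. H c \<noteq> 0) \<longrightarrow>
    (\<forall>\<^sub>F \<epsilon> in at 0. respects_edge \<eta> \<delta> A {q. perturb G H \<epsilon> q = 0} e \<longrightarrow> e \<in> same_side_edges H))"
  have "\<forall>\<^sub>F \<eta> in at_right 0. \<forall>e\<in>bounded_edges A. \<forall>\<^sub>F \<delta> in at_right 0. P \<eta> \<delta> e"
  proof (rule eventually_ball_finite[OF finite_bounded_edges], rule ballI)
    fix e assume e: "e \<in> bounded_edges A"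
    obtain l v w mv mw where be: "bounded_edge A n b l v w mv mw" "e = open_segment v w" "v \<in> crunodes A" "w \<in> crunodes A"
      by (rule bounded_edges_locale[OF e])
    have same: "e \<in> same_side_edges H" if "H v * H w > 0" for H
      using e be that unfolding same_side_edges_def by blast
    from bounded_edge.eventually_respected_imp_same_side[OF be(1)]
    show "\<forall>\<^sub>F \<eta> in at_right 0. \<forall>\<^sub>F \<delta> in at_right 0. P \<eta> \<delta> e"
    proof (rule eventually_mono, elim eventually_mono)
      fix \<eta> \<delta>
      assume all: "\<forall>H. real_polynomial_function H \<longrightarrow> (\<forall>c\<in>crunodes A. H c \<noteq> 0) \<longrightarrow>
        (\<forall>\<^sub>F \<epsilon> in at 0. respects_edge \<eta> \<delta> A {q. perturb G H \<epsilon> q = 0} (open_segment v w) \<longrightarrow> H v * H w > 0)"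
      show "P \<eta> \<delta> e"
        unfolding P_def
      proof (intro allI impI)
        fix H assume H: "real_polynomial_function H" "\<forall>c\<in>crunodes A. H c \<noteq> 0"
        from mp[OF mp[OF spec[OF all] H(1)] H(2)]
        show "\<forall>\<^sub>F \<epsilon> in at 0. respects_edge \<eta> \<delta> A {q. perturb G H \<epsilon> q = 0} e \<longrightarrow> e \<in> same_side_edges H"
          by (rule eventually_mono) (use same be(2) in blast)
      qed
    qed
  qed
  then have "\<forall>\<^sub>F \<eta> in at_right 0. \<forall>\<^sub>F \<delta> in at_right 0. \<forall>e\<in>bounded_edges A. P \<eta> \<delta> e"
    by (rule eventually_mono) (rule eventually_ball_finite[OF finite_bounded_edges])
  then show ?thesis
  proof (rule eventually_mono, elim eventually_mono, intro allI impI)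
    fix \<eta> \<delta> H
    assume "\<forall>e\<in>bounded_edges A. P \<eta> \<delta> e" "real_polynomial_function H" "\<forall>c\<in>crunodes A. H c \<noteq> 0"
    then have "\<forall>\<^sub>F \<epsilon> in at 0. \<forall>e\<in>bounded_edges A. respects_edge \<eta> \<delta> A {q. perturb G H \<epsilon> q = 0} e \<longrightarrow> e \<in> same_side_edges H"
      unfolding P_def by (intro eventually_ball_finite[OF finite_bounded_edges]) blast
    then show "\<forall>\<^sub>F \<epsilon> in at 0. {e \<in> bounded_edges A. respects_edge \<eta> \<delta> A {q. perturb G H \<epsilon> q = 0} e} \<subseteq> same_side_edges H"
      by (rule eventually_mono) blast
  qed
qed

lemma eventually_product_respects_all:
  "\<forall>\<^sub>F \<eta> in at_right 0. \<forall>\<delta>>0. \<forall>\<^sub>F \<epsilon> in at 0. \<forall>e\<in>bounded_edges A. respects_edge \<eta> \<delta> A {q. G q = \<epsilon>} e"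
proof -
  have "\<forall>\<^sub>F \<eta> in at_right 0. \<forall>e\<in>bounded_edges A. \<forall>\<delta>>0. \<forall>\<^sub>F \<epsilon> in at 0. respects_edge \<eta> \<delta> A {q. G q = \<epsilon>} e"
  proof (rule eventually_ball_finite[OF finite_bounded_edges], rule ballI)
    fix e assume e: "e \<in> bounded_edges A"
    obtain l v w mv mw where be: "bounded_edge A n b l v w mv mw" "e = open_segment v w"
      by (rule bounded_edges_locale[OF e])
    show "\<forall>\<^sub>F \<eta> in at_right 0. \<forall>\<delta>>0. \<forall>\<^sub>F \<epsilon> in at 0. respects_edge \<eta> \<delta> A {q. G q = \<epsilon>} e"
      unfolding be(2) by (rule bounded_edge.eventually_product_respects[OF be(1)])
  qed
  then show ?thesis
  proof (rule eventually_mono, intro allI impI)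
    fix \<eta> \<delta> :: real
    assume "\<forall>e\<in>bounded_edges A. \<forall>\<delta>>0. \<forall>\<^sub>F \<epsilon> in at 0. respects_edge \<eta> \<delta> A {q. G q = \<epsilon>} e" "\<delta> > 0"
    then have "\<forall>e\<in>bounded_edges A. \<forall>\<^sub>F \<epsilon> in at 0. respects_edge \<eta> \<delta> A {q. G q = \<epsilon>} e" by simp
    then show "\<forall>\<^sub>F \<epsilon> in at 0. \<forall>e\<in>bounded_edges A. respects_edge \<eta> \<delta> A {q. G q = \<epsilon>} e"
      by (rule eventually_ball_finite[OF finite_bounded_edges])
  qed
qed

end

lemma generic_arrangement_normal_form:
  assumes "generic_arrangement \<A>"
  shows "\<exists>n b. line_arrangement \<A> n b"
proof -
  note gen = assms[unfolded generic_arrangement_def]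
  note lines = conjunct1[OF conjunct2[OF gen]] and par = conjunct1[OF conjunct2[OF conjunct2[OF gen]]]
    and triple = conjunct2[OF conjunct2[OF conjunct2[OF gen]]]
  have "\<exists>n b. norm n = 1 \<and> l = {p. n \<bullet> p = b}" if l: "l \<in> \<A>" for l
  proof -
    have "affine l" "aff_dim l = 1" using bspec[OF lines l] by simp_all
    then have hull: "affine hull l = l" and dim: "aff_dim l = int (DIM(real^2) - 1)"
      by (simp_all add: affine_hull_eq)
    then obtain a \<beta> where a: "a \<noteq> 0" "l = {x. a \<bullet> x = \<beta>}"
    proof -
      have "\<exists>a \<beta>. a \<noteq> 0 \<and> affine hull l = {x. a \<bullet> x = \<beta>}"
        using aff_dim_eq_hyperplane[of l] dim by (rule iffD1)
      then have "\<exists>a \<beta>. a \<noteq> 0 \<and> l = {x. a \<bullet> x = \<beta>}" unfolding hull .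
      then show thesis using that by blast
    qed
    show ?thesis
    proof (intro exI conjI)
      show "norm (a /\<^sub>R norm a) = 1" using a(1) by simp
      have "{x. a \<bullet> x = \<beta>} = {p. (a /\<^sub>R norm a) \<bullet> p = \<beta> / norm a}"
        using a(1) by (simp add: divide_inverse mult.commute)
      with a(2) show "l = {p. (a /\<^sub>R norm a) \<bullet> p = \<beta> / norm a}" by (rule trans)
    qed
  qed
  then have "\<forall>l\<in>\<A>. \<exists>n b. norm n = 1 \<and> l = {p. n \<bullet> p = b}" by (intro ballI)
  from bchoice[OF this] obtain n where "\<forall>l\<in>\<A>. \<exists>b. norm (n l) = 1 \<and> l = {p. n l \<bullet> p = b}" ..
  from bchoice[OF this] obtain b where "\<forall>l\<in>\<A>. norm (n l) = 1 \<and> l = {p. n l \<bullet> p = b l}" ..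
  note nb = bspec[OF this]
  have mem: "x \<in> l \<longleftrightarrow> n l \<bullet> x = b l" if "l \<in> \<A>" for l x using conjunct2[OF nb[OF that]] by blast
  have "line_arrangement \<A> n b"
  proof
    show "finite \<A>" using gen by (rule conjunct1)
    show "norm (n l) = 1" "l = {p. n l \<bullet> p = b l}" if "l \<in> \<A>" for l
      using conjunct1[OF nb[OF that]] conjunct2[OF nb[OF that]] .
    show "l \<inter> m \<inter> k = {}" if "l \<in> \<A>" "m \<in> \<A>" "k \<in> \<A>" "l \<noteq> m" "m \<noteq> k" "l \<noteq> k" for l m k
      using triple that by blast
    show "det2 (n l) (n m) \<noteq> 0" if l: "l \<in> \<A>" and m: "m \<in> \<A>" and lm: "l \<noteq> m" for l m
    proof
      assume det: "det2 (n l) (n m) = 0"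
      have np: "\<not> affine_parallel l m" using par l m lm by blast
      have nn: "n l \<bullet> n l = 1" "n m \<bullet> n m = 1"
        using conjunct1[OF nb[OF l]] conjunct1[OF nb[OF m]] by (simp_all add: dot_square_norm)
      have "n l \<noteq> 0" using nn by auto
      then have "rot90 (n l) \<noteq> 0" by (auto simp: rot90_def vec_eq_iff forall_2)
      moreover have "rot90 (n l) \<bullet> n m = 0" using det by (simp add: rot90_def det2_def inner_real2)
      moreover have "rot90 (n l) \<bullet> n l = 0" by (simp add: rot90_def inner_real2)
      ultimately obtain t where t: "n m = t *\<^sub>R n l" using orthogonal_imp_parallel \<open>n l \<noteq> 0\<close> by blast
      have "t * t = 1" using nn t by simp
      define s where "s = (t * b m - b l) *\<^sub>R n l"
      have "m = (\<lambda>x. s + x) ` l"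
      proof (intro equalityI subsetI)
        fix x assume "x \<in> m"
        then have "n m \<bullet> x = b m" using mem[OF m] by blast
        then have "t * (t * (n l \<bullet> x)) = t * b m" by (simp add: t)
        then have "n l \<bullet> x = t * b m" using \<open>t * t = 1\<close> by (simp add: mult.assoc[symmetric])
        then have "n l \<bullet> (x - s) = b l" by (simp add: s_def inner_diff_right nn)
        then have "x - s \<in> l" using mem[OF l] by blast
        then show "x \<in> (\<lambda>x. s + x) ` l" by (intro image_eqI[of _ _ "x - s"]) auto
      next
        fix x assume "x \<in> (\<lambda>x. s + x) ` l"
        then obtain y where y: "y \<in> l" "x = s + y" by blast
        have "n l \<bullet> y = b l" using mem[OF l] y(1) by blast
        then have "n m \<bullet> x = t * (t * b m)" by (simp add: t y(2) s_def inner_add_right nn algebra_simps)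
        then have "n m \<bullet> x = b m" using \<open>t * t = 1\<close> by (simp add: mult.assoc[symmetric])
        then show "x \<in> m" using mem[OF m] by blast
      qed
      then have "affine_parallel l m" unfolding affine_parallel_def by blast
      then show False using np by blast
    qed
  qed
  then show ?thesis by blast
qed

lemma eventually_at_0_divide:
  fixes c :: real
  assumes "\<forall>\<^sub>F \<epsilon> in at 0. P \<epsilon>" "c \<noteq> 0"
  shows "\<forall>\<^sub>F \<epsilon> in at 0. P (\<epsilon> / c)"
proof -
  have "((\<lambda>\<epsilon>. \<epsilon> / c) \<longlongrightarrow> 0 / c) (at 0)" using assms(2) by (intro tendsto_intros)
  moreover have "\<forall>\<^sub>F \<epsilon> in at 0. \<epsilon> \<noteq> (0::real)" by (simp add: eventually_neq_at_within)
  then have "\<forall>\<^sub>F \<epsilon> in at 0. \<epsilon> / c \<noteq> 0" by eventually_elim (use assms(2) in simp)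
  ultimately have "filterlim (\<lambda>\<epsilon>. \<epsilon> / c) (at 0) (at 0)" by (simp add: filterlim_at)
  then show ?thesis using assms(1) by (rule eventually_compose_filterlim[rotated])
qed

theorem proposition5p1:
  fixes \<A> :: "(real^2) set set" and d :: nat
  assumes "generic_arrangement \<A>" and "card \<A> = d"
  shows
    "(\<forall>\<^sub>F \<eta> in at_right 0. \<forall>\<^sub>F \<delta> in at_right 0.
       \<forall>L H. line_equations \<A> d L \<longrightarrow> total_degree_le d H \<longrightarrow>
         (\<forall>v\<in>crunodes \<A>. eval2 H v \<noteq> 0) \<longrightarrow>
         (\<forall>\<^sub>F \<epsilon> in at 0.
            let R = zero_locus ((\<Prod>i<d. L i) + smult [:\<epsilon>:] H) in
            enat (d * (d - 1) + card {e \<in> bounded_edges \<A>. respects_edge \<eta> \<delta> \<A> R e})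
              \<le> num_evolute_cusps R)) \<and>
     (\<forall>\<^sub>F \<eta> in at_right 0. \<forall>\<^sub>F \<delta> in at_right 0.
       \<forall>L. line_equations \<A> d L \<longrightarrow>
         (\<forall>\<^sub>F \<epsilon> in at 0.
            let R = {p. (\<Prod>i<d. eval2 (L i) p) = \<epsilon>} in
            (\<forall>e \<in> bounded_edges \<A>. respects_edge \<eta> \<delta> \<A> R e) \<and>
            enat (d * (2 * d - 3)) \<le> num_evolute_cusps R))"
proof -
  obtain n b where "line_arrangement \<A> n b" using generic_arrangement_normal_form[OF assms(1)] by blast
  then interpret line_arrangement \<A> n b .
  have d: "card \<A> = d" by fact
  show ?thesis
  proof (intro conjI)
    show "\<forall>\<^sub>F \<eta> in at_right 0. \<forall>\<^sub>F \<delta> in at_right 0.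
       \<forall>L H. line_equations \<A> d L \<longrightarrow> total_degree_le d H \<longrightarrow>
         (\<forall>v\<in>crunodes \<A>. eval2 H v \<noteq> 0) \<longrightarrow>
         (\<forall>\<^sub>F \<epsilon> in at 0.
            let R = zero_locus ((\<Prod>i<d. L i) + smult [:\<epsilon>:] H) in
            enat (d * (d - 1) + card {e \<in> bounded_edges \<A>. respects_edge \<eta> \<delta> \<A> R e})
              \<le> num_evolute_cusps R)"
      using eventually_respected_same_side
    proof (rule eventually_mono, elim eventually_mono, intro allI impI)
      fix \<eta> \<delta> L H
      assume side: "\<forall>H. real_polynomial_function H \<longrightarrow> (\<forall>c\<in>crunodes \<A>. H c \<noteq> 0) \<longrightarrow>
          (\<forall>\<^sub>F \<epsilon> in at 0. {e \<in> bounded_edges \<A>. respects_edge \<eta> \<delta> \<A> {q. perturb G H \<epsilon> q = 0} e} \<subseteq> same_side_edges H)"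
        and L: "line_equations \<A> d L" and H: "\<forall>v\<in>crunodes \<A>. eval2 H v \<noteq> 0"
      obtain c where c: "c \<noteq> 0" "\<And>p. (\<Prod>i<d. eval2 (L i) p) = c * G p"
        using line_equations_product L d by metis
      let ?h = "eval2 H"
      have R: "zero_locus ((\<Prod>i<d. L i) + smult [:\<epsilon>:] H) = {q. perturb G ?h (\<epsilon> / c) q = 0}" for \<epsilon>
        using c(1) by (auto simp: zero_locus_def eval2_add eval2_smult eval2_prod c(2) field_simps)
      have "\<forall>\<^sub>F \<epsilon> in at 0. enat (d * (d - 1) + card {e \<in> bounded_edges \<A>. respects_edge \<eta> \<delta> \<A> {q. perturb G ?h \<epsilon> q = 0} e})
          \<le> num_evolute_cusps {q. perturb G ?h \<epsilon> q = 0}"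
        using mp[OF mp[OF spec[OF side] eval2_real_polynomial_function] H]
          eventually_many_cusps[OF eval2_real_polynomial_function H]
      proof eventually_elim
        case (elim \<epsilon>)
        have "card {e \<in> bounded_edges \<A>. respects_edge \<eta> \<delta> \<A> {q. perturb G ?h \<epsilon> q = 0} e} \<le> card (same_side_edges ?h)"
          using elim(1) finite_same_side_edges by (intro card_mono)
        then have "enat (d * (d - 1) + card {e \<in> bounded_edges \<A>. respects_edge \<eta> \<delta> \<A> {q. perturb G ?h \<epsilon> q = 0} e})
            \<le> enat (2 * card (crunodes \<A>) + card (same_side_edges ?h))"
          using crunodes_card d by simp
        then show ?case using elim(2) by (rule order_trans)
      qed
      from eventually_at_0_divide[OF this c(1)]
      show "\<forall>\<^sub>F \<epsilon> in at 0. let R = zero_locus ((\<Prod>i<d. L i) + smult [:\<epsilon>:] H) in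
            enat (d * (d - 1) + card {e \<in> bounded_edges \<A>. respects_edge \<eta> \<delta> \<A> R e}) \<le> num_evolute_cusps R"
        unfolding Let_def R .
    qed
  next
    have "\<forall>\<^sub>F \<eta> in at_right 0. \<forall>\<^sub>F \<delta> in at_right 0. \<forall>\<^sub>F \<epsilon> in at 0. \<forall>e\<in>bounded_edges \<A>. respects_edge \<eta> \<delta> \<A> {q. G q = \<epsilon>} e"
      using eventually_product_respects_all
    proof (rule eventually_mono)
      fix \<eta> assume "\<forall>\<delta>>0. \<forall>\<^sub>F \<epsilon> in at 0. \<forall>e\<in>bounded_edges \<A>. respects_edge \<eta> \<delta> \<A> {q. G q = \<epsilon>} e"
      then show "\<forall>\<^sub>F \<delta> in at_right 0. \<forall>\<^sub>F \<epsilon> in at 0. \<forall>e\<in>bounded_edges \<A>. respects_edge \<eta> \<delta> \<A> {q. G q = \<epsilon>} e"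
        by (intro eventually_mono[OF eventually_at_right_0_pos]) blast
    qed
    then show "\<forall>\<^sub>F \<eta> in at_right 0. \<forall>\<^sub>F \<delta> in at_right 0.
       \<forall>L. line_equations \<A> d L \<longrightarrow>
         (\<forall>\<^sub>F \<epsilon> in at 0.
            let R = {p. (\<Prod>i<d. eval2 (L i) p) = \<epsilon>} in
            (\<forall>e \<in> bounded_edges \<A>. respects_edge \<eta> \<delta> \<A> R e) \<and>
            enat (d * (2 * d - 3)) \<le> num_evolute_cusps R)"
    proof (rule eventually_mono, elim eventually_mono, intro allI impI)
      fix \<eta> \<delta> L
      assume resp: "\<forall>\<^sub>F \<epsilon> in at 0. \<forall>e\<in>bounded_edges \<A>. respects_edge \<eta> \<delta> \<A> {q. G q = \<epsilon>} e"
        and L: "line_equations \<A> d L"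
      obtain c where c: "c \<noteq> 0" "\<And>p. (\<Prod>i<d. eval2 (L i) p) = c * G p"
        using line_equations_product L d by metis
      have R: "{p. (\<Prod>i<d. eval2 (L i) p) = \<epsilon>} = {q. G q = \<epsilon> / c}" for \<epsilon>
        using c(1) by (auto simp: c(2) field_simps)
      have all: "same_side_edges (\<lambda>_. -1) = bounded_edges \<A>"
        unfolding same_side_edges_def bounded_edges_def by auto
      have num: "d * (2 * d - 3) \<le> 2 * card (crunodes \<A>) + card (bounded_edges \<A>)"
      proof -
        \<comment> \<open>Truncated subtraction makes the left side zero for \<open>d \<le> 1\<close>.\<close>
        have "d * (2 * d - 3) \<le> d * (d - 1) + d * (d - 2)"
        proof (cases "d \<ge> 2")
          case True
          then have "2 * d - 3 = (d - 1) + (d - 2)" by simp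
          then show ?thesis by (simp only: distrib_left order_refl)
        next
          case False
          then have "d = 0 \<or> d = 1" by linarith
          then show ?thesis by auto
        qed
        then show ?thesis using crunodes_card bounded_edges_card d by simp
      qed
      have "\<forall>\<^sub>F \<epsilon> in at 0. enat (2 * card (crunodes \<A>) + card (bounded_edges \<A>)) \<le> num_evolute_cusps {q. G q = \<epsilon>}"
        using eventually_many_cusps[OF real_polynomial_function_const, of "-1"] by (simp add: all)
      with resp have "\<forall>\<^sub>F \<epsilon> in at 0. (\<forall>e\<in>bounded_edges \<A>. respects_edge \<eta> \<delta> \<A> {q. G q = \<epsilon>} e) \<and>
         enat (d * (2 * d - 3)) \<le> num_evolute_cusps {q. G q = \<epsilon>}"
      proof eventually_elim
        case (elim \<epsilon>)
        have "enat (d * (2 * d - 3)) \<le> enat (2 * card (crunodes \<A>) + card (bounded_edges \<A>))" using num by simp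
        then show ?case using elim order_trans by blast
      qed
      from eventually_at_0_divide[OF this c(1)]
      show "\<forall>\<^sub>F \<epsilon> in at 0. let R = {p. (\<Prod>i<d. eval2 (L i) p) = \<epsilon>} in
            (\<forall>e \<in> bounded_edges \<A>. respects_edge \<eta> \<delta> \<A> R e) \<and> enat (d * (2 * d - 3)) \<le> num_evolute_cusps R"
        unfolding Let_def R .
    qed
  qed
qed

end
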